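(* Let $D$ be a smoothly bounded convex domain of finite type in $\mathbf{C}^n$. Then for all $R > 0$, there exist positive constants $C_1$ and $C_2$ depending only on $R$ and $D$ such that for each $q$ in $D$ sufficiently close to $\partial D$, $$P\big(q, C_1\, d(q,\partial D)\big) \subset B_D(q,R) \subset P\big(q, C_2\, d(q,\partial D)\big),$$ where $P(q,r)$ denotes McNeal's polydisc.
   Context: $d(q,\partial D)$ is the Euclidean distance to $\partial D$, and $B_D(q,R)$ is the ball of radius $R$ around $q$ in the Kobayashi distance $d_D$, where $d_D(p,q)$ is the infimum of $\int_0^1F^K_D(\gamma,\dot\gamma)\,dt$ over piecewise differentiable curves from $p$ to $q$ and $F^K_D(z,\xi)=\inf\{1/\alpha:\alpha>0,\ f\in\mathcal{O}(\Delta,D),\ f(0)=z,\ f'(0)=\alpha\xi\}$, $\Delta$ the unit disc. Finite type is in the sense of D'Angelo. McNeal's polydisc. Let $\rho$ be a smooth defining function of $D=\{\rho<0\}$ such that the sets $\{\rho<\eta\}$ are convex for $-\eta_0<\eta<\eta_0$, some $\eta_0>0$. For $q\in D$ close to $\partial D$ and small $\epsilon>0$ let $D_{q,\epsilon}=\{\rho<\rho(q)+\epsilon\}$. Let $p^n_{q,\epsilon}\in\partial D_{q,\epsilon}$ be the point closest to $q$, $\tau_n(q,\epsilon)=|q-p^n_{q,\epsilon}|$, and $L_n$ the complex line through $q$ and $p^n_{q,\epsilon}$. Among the complex lines through $q$ orthogonal to $L_n$, let $\tau_{n-1}(q,\epsilon)$ be the largest distance from $q$ to $\partial D_{q,\epsilon}$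 along such a line, attained at a point $p^{n-1}_{q,\epsilon}\in\partial D_{q,\epsilon}$, and let $L_{n-1}$ be the complex line through $q$ and $p^{n-1}_{q,\epsilon}$. Repeat in the orthogonal complement of the complex span of the lines already chosen, to obtain $\tau_i(q,\epsilon)$, $p^i_{q,\epsilon}$, $L_i$ for $i=n,n-1,\dots,1$. Let $T^{q,\epsilon}$ be the translation sending $q$ to $0$, and $U^{q,\epsilon}$ a unitary map sending $L_i$ to the $z_i$-axis and $p^i_{q,\epsilon}-q$ to a point on the $\mathrm{Re}\,z_i$-axis, and put $(z_1^{q,\epsilon},\dots,z_n^{q,\epsilon})=U^{q,\epsilon}\circ T^{q,\epsilon}(z_1,\dots,z_n)$. Then $$P(q,\epsilon)=\{|z_1^{q,\epsilon}|<\tau_1(q,\epsilon),\dots,|z_n^{q,\epsilon}|<\tau_n(q,\epsilon)\}.$$ *)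

theory Defs
  imports "HOL-Analysis.Analysis"
begin

text \<open>
  \<open>\<complex>\<^sup>n\<close> is \<^typ>\<open>complex ^ 'n\<close> with a linearly ordered finite index type, since McNeal's construction
  runs through the coordinates from the last one down to the first.
\<close>

type_synonym 'n cspace = "complex ^ 'n"

primrec Ck_on :: "nat \<Rightarrow> ('a::real_normed_vector \<Rightarrow> 'b::real_normed_vector) \<Rightarrow> 'a set \<Rightarrow> bool" where
  "Ck_on 0 f S \<longleftrightarrow> continuous_on S f"
| "Ck_on (Suc k) f S \<longleftrightarrow>
     (\<forall>x\<in>S. f differentiable (at x)) \<and> (\<forall>v. Ck_on k (\<lambda>x. frechet_derivative f (at x) v) S)"

definition smooth_on :: "('a::real_normed_vector \<Rightarrow> 'b::real_normed_vector) \<Rightarrow> 'a set \<Rightarrow> bool" where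
  "smooth_on f S \<longleftrightarrow> (\<forall>k. Ck_on k f S)"

definition smooth_defining_function :: "(complex ^ 'n \<Rightarrow> real) \<Rightarrow> (complex ^ 'n) set \<Rightarrow> bool" where
  "smooth_defining_function \<rho> D \<longleftrightarrow>
     smooth_on \<rho> UNIV \<and> D = {z. \<rho> z < 0} \<and>
     (\<forall>z\<in>frontier D. frechet_derivative \<rho> (at z) \<noteq> (\<lambda>v. 0))"

text \<open>All iterated directional derivatives of order less than \<open>k\<close> vanish at \<open>x\<close>; this only
  depends on the germ of \<open>f\<close> at \<open>x\<close>.\<close>

primrec vanishes_to_order ::
  "nat \<Rightarrow> ('a::real_normed_vector \<Rightarrow> 'b::real_normed_vector) \<Rightarrow> 'a \<Rightarrow> bool" where
  "vanishes_to_order 0 f x \<longleftrightarrow> True"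
| "vanishes_to_order (Suc k) f x \<longleftrightarrow>
     f x = 0 \<and> (\<forall>v. vanishes_to_order k (\<lambda>y. frechet_derivative f (at y) v) x)"

definition vanishing_order ::
  "('a::real_normed_vector \<Rightarrow> 'b::real_normed_vector) \<Rightarrow> 'a \<Rightarrow> enat" where
  "vanishing_order f x = Sup {enat k |k. vanishes_to_order k f x}"

definition nonconstant_holomorphic_germs :: "complex ^ 'n \<Rightarrow> (complex \<Rightarrow> complex ^ 'n) set" where
  "nonconstant_holomorphic_germs p =
     {\<gamma>. (\<forall>i. (\<lambda>\<zeta>. \<gamma> \<zeta> $ i) analytic_on {0}) \<and> \<gamma> 0 = p \<and> \<not> (\<forall>\<^sub>F \<zeta> in nhds 0. \<gamma> \<zeta> = p)}"

text \<open>The maximal order of contact of one-dimensional complex analytic germs with the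
  hypersurface \<open>{\<rho> = 0}\<close> at \<open>p\<close>.\<close>

definition dangelo_type :: "(complex ^ 'n \<Rightarrow> real) \<Rightarrow> complex ^ 'n \<Rightarrow> ereal" where
  "dangelo_type \<rho> p =
     (SUP \<gamma>\<in>nonconstant_holomorphic_germs p.
        ereal_of_enat (vanishing_order (\<rho> \<circ> \<gamma>) 0) /
        ereal_of_enat (vanishing_order (\<lambda>\<zeta>. \<gamma> \<zeta> - p) 0))"

definition finite_type :: "(complex ^ 'n \<Rightarrow> real) \<Rightarrow> (complex ^ 'n) set \<Rightarrow> bool" where
  "finite_type \<rho> D \<longleftrightarrow> (\<forall>p\<in>frontier D. dangelo_type \<rho> p < \<infinity>)"

definition kobayashi_metric :: "(complex ^ 'n) set \<Rightarrow> complex ^ 'n \<Rightarrow> complex ^ 'n \<Rightarrow> real" where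
  "kobayashi_metric D z \<xi> =
     Inf {1 / \<alpha> |\<alpha>. \<alpha> > 0 \<and>
       (\<exists>f. (\<forall>i. (\<lambda>\<zeta>. f \<zeta> $ i) holomorphic_on ball 0 1) \<and> f ` ball 0 1 \<subseteq> D \<and>
            f 0 = z \<and> (\<forall>i. deriv (\<lambda>\<zeta>. f \<zeta> $ i) 0 = of_real \<alpha> * \<xi> $ i))}"

text \<open>The length is a nonnegative Lebesgue integral, so that curves of infinite length (which
  \<^const>\<open>piecewise_differentiable_on\<close> admits, derivatives being possibly unbounded)
  get length \<open>\<infinity>\<close> and do not contribute to the infimum.\<close>

definition kobayashi_length :: "(complex ^ 'n) set \<Rightarrow> (real \<Rightarrow> complex ^ 'n) \<Rightarrow> ennreal" where
  "kobayashi_length D \<gamma> =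
     (\<integral>\<^sup>+t\<in>{0..1}. ennreal (kobayashi_metric D (\<gamma> t) (vector_derivative \<gamma> (at t))) \<partial>lborel)"

definition kobayashi_dist :: "(complex ^ 'n) set \<Rightarrow> complex ^ 'n \<Rightarrow> complex ^ 'n \<Rightarrow> ennreal" where
  "kobayashi_dist D p q =
     Inf {kobayashi_length D \<gamma> |\<gamma>. \<gamma> piecewise_differentiable_on {0..1} \<and>
            \<gamma> ` {0..1} \<subseteq> D \<and> \<gamma> 0 = p \<and> \<gamma> 1 = q}"

definition kobayashi_ball :: "(complex ^ 'n) set \<Rightarrow> complex ^ 'n \<Rightarrow> real \<Rightarrow> (complex ^ 'n) set" where
  "kobayashi_ball D q R = {z\<in>D. kobayashi_dist D q z < ennreal R}"

definition hermitian_product :: "complex ^ 'n \<Rightarrow> complex ^ 'n \<Rightarrow> complex" where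
  "hermitian_product v w = (\<Sum>i\<in>UNIV. v $ i * cnj (w $ i))"

definition unitary_matrix :: "complex ^ 'n ^ 'n \<Rightarrow> bool" where
  "unitary_matrix U \<longleftrightarrow> (\<chi> i j. cnj (U $ j $ i)) ** U = mat 1"

definition complex_line :: "complex ^ 'n \<Rightarrow> complex ^ 'n \<Rightarrow> (complex ^ 'n) set" where
  "complex_line q p = {q + c *s (p - q) |c. True}"

definition mcneal_domain :: "(complex ^ 'n \<Rightarrow> real) \<Rightarrow> complex ^ 'n \<Rightarrow> real \<Rightarrow> (complex ^ 'n) set" where
  "mcneal_domain \<rho> q \<epsilon> = {z. \<rho> z < \<rho> q + \<epsilon>}"

definition orthogonal_lines ::
  "('n::{finite,linorder}) cspace \<Rightarrow> ('n \<Rightarrow> 'n cspace) \<Rightarrow> 'n \<Rightarrow> 'n cspace set set" where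
  "orthogonal_lines q p i =
     {complex_line q (q + v) |v. v \<noteq> 0 \<and> (\<forall>j>i. hermitian_product v (p j - q) = 0)}"

definition distance_along :: "(complex ^ 'n) set \<Rightarrow> complex ^ 'n \<Rightarrow> (complex ^ 'n) set \<Rightarrow> real" where
  "distance_along \<Omega> q L = infdist q (L \<inter> frontier \<Omega>)"

text \<open>\<open>p\<close> is a family of points obtained by McNeal's procedure. Each \<open>p i\<close> need not be unique.
  The first point chosen minimises the distance to \<open>q\<close>, all later ones come from a maximisation.\<close>

definition mcneal_points ::
  "(('n::{finite,linorder}) cspace) set \<Rightarrow> 'n cspace \<Rightarrow> ('n \<Rightarrow> 'n cspace) \<Rightarrow> bool" where
  "mcneal_points \<Omega> q p \<longleftrightarrow>
     (\<forall>i. p i \<in> frontier \<Omega>) \<and>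
     dist q (p (Max UNIV)) = infdist q (frontier \<Omega>) \<and>
     (\<forall>i. i \<noteq> Max UNIV \<longrightarrow>
        is_arg_max (distance_along \<Omega> q) (\<lambda>L. L \<in> orthogonal_lines q p i) (complex_line q (p i)) \<and>
        dist q (p i) = distance_along \<Omega> q (complex_line q (p i)))"

definition mcneal_coordinates ::
  "('n::{finite,linorder}) cspace \<Rightarrow> ('n \<Rightarrow> 'n cspace) \<Rightarrow> ('n cspace, 'n) vec \<Rightarrow> bool" where
  "mcneal_coordinates q p U \<longleftrightarrow>
     unitary_matrix U \<and>
     (\<forall>i. (\<lambda>z. U *v (z - q)) ` complex_line q (p i) = range (axis i) \<and>
          (\<exists>r::real. U *v (p i - q) = axis i (of_real r)))"

text \<open>The set of all polydiscs \<open>P(q, \<epsilon>)\<close>, one for each possible choice in the construction.\<close>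

definition mcneal_polydiscs ::
  "(('n::{finite,linorder}) cspace \<Rightarrow> real) \<Rightarrow> 'n cspace \<Rightarrow> real \<Rightarrow> 'n cspace set set" where
  "mcneal_polydiscs \<rho> q \<epsilon> =
     {{z. \<forall>i. cmod ((U *v (z - q)) $ i) < dist q (p i)} |p U.
        mcneal_points (mcneal_domain \<rho> q \<epsilon>) q p \<and> mcneal_coordinates q p U}"

end

theory Submission
  imports Defs "HOL-Complex_Analysis.Conformal_Mappings"
begin

text \<open>Both sides of the claimed inclusions are compared with one convex body. For an open convex set
  \<open>\<Omega>\<close> containing \<open>q\<close>, let \<open>K(\<Omega>, q)\<close> (\<open>balanced_core\<close> below) be the set of vectors \<open>x\<close> for which the
  affine disc of all \<open>q + c x\<close> with \<open>|c| \<le> 1\<close> lies in the closure of \<open>\<Omega>\<close>. Write \<open>\<Omega>\<^sub>q(\<epsilon>)\<close> for the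
  sublevel set \<open>{\<rho> < \<rho>(q) + \<epsilon>}\<close>, and \<open>n\<close> for the dimension.

  A polydisc \<open>P(q, \<epsilon>)\<close> is comparable to \<open>q + K(\<Omega>\<^sub>q(\<epsilon>), q)\<close> with constants that depend on \<open>n\<close> only
  (\<open>mcneal_polydisc_core\<close>). One inclusion is convexity, since the axes of the polydisc lie in the core.
  For the other, a vector of the core is stripped of its components along the chosen directions one by
  one; the extremality of each choice bounds the component removed.

  The Kobayashi ball of radius \<open>R\<close> is squeezed in the same way. A half-space containing \<open>D\<close> is the
  preimage of a half-plane under a complex linear functional; as the functional contracts Kobayashi
  distances, all supporting half-spaces together give \<open>B(q, R) - q \<subseteq> (exp (2 R) + 1) K(D, q)\<close>
  (\<open>kobayashi_ball_in_multiple_of_core\<close>). Conversely, if a large multiple of \<open>z - q\<close> still lies in the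
  core, then \<open>z\<close> is close to \<open>q\<close> already inside one affine disc (\<open>kobayashi_dist_le_of_disc\<close>).

  It remains to compare the cores of \<open>\<Omega>\<^sub>q(\<epsilon>)\<close> for different \<open>\<epsilon>\<close>, and this is where finite type enters:
  for every \<open>M\<close> there is \<open>c > 0\<close> such that \<open>M K(\<Omega>\<^sub>q(c \<epsilon>), q) \<subseteq> K(\<Omega>\<^sub>q(\<epsilon>), q)\<close> for all \<open>q\<close> near the boundary
  and all small \<open>\<epsilon>\<close> (\<open>doubling\<close>, stated there as bounds on \<open>\<rho>\<close>). Let \<open>\<rho> - \<rho>(q) \<le> c \<epsilon>\<close> on a disc of radius
  \<open>r\<close> about \<open>q\<close> in some complex line. By convexity of the sublevel sets \<open>\<rho> - \<rho>(q)\<close> is then also bounded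
  below by a multiple of \<open>- c \<epsilon>\<close> there (\<open>two_sided_bound\<close>). By finite type and compactness \<open>\<rho>\<close> varies by
  at least a multiple of \<open>r\<^sup>N\<close> on the disc, with one \<open>N\<close> for all points and directions
  (\<open>nondegenerate_near_frontier\<close>). Hence \<open>r\<^sup>N\<close> is at most a multiple of \<open>c \<epsilon>\<close>, so at scale \<open>r\<close> the
  function \<open>\<rho>\<close> agrees with a polynomial of degree \<open>N\<close> up to an error of the same size, and the bound
  passes to the disc of radius \<open>M r\<close> at the cost of a constant factor (\<open>finite_difference_extrapolation\<close>).

  Finally \<open>- \<rho>(q)\<close> is comparable to the distance \<open>d\<close> of \<open>q\<close> to the boundary, so that \<open>D\<close> contains
  \<open>\<Omega>\<^sub>q(c\<^sub>0 d)\<close> and is contained in \<open>\<Omega>\<^sub>q(C\<^sub>0 d)\<close>, and the inclusions can be combined.\<close>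

section \<open>Iterated differences and derivatives\<close>

primrec finite_difference :: "'a::real_normed_vector list \<Rightarrow> ('a \<Rightarrow> real) \<Rightarrow> 'a \<Rightarrow> real" where
  "finite_difference [] f x = f x"
| "finite_difference (w # ws) f x = finite_difference ws f (x + w) - finite_difference ws f x"

text \<open>The head of the list is the first direction of differentiation, as in the recursions of
  \<^const>\<open>Ck_on\<close> and \<^const>\<open>vanishes_to_order\<close>.\<close>

primrec iterated_derivative :: "'a::real_normed_vector list \<Rightarrow> ('a \<Rightarrow> real) \<Rightarrow> 'a \<Rightarrow> real" where
  "iterated_derivative [] f = f"
| "iterated_derivative (w # ws) f = iterated_derivative ws (\<lambda>x. frechet_derivative f (at x) w)"

lemma smooth_on_UNIV_D:
  assumes "smooth_on f UNIV"
  shows smooth_on_differentiable: "f differentiable (at x)"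
    and smooth_on_directional_derivative: "smooth_on (\<lambda>x. frechet_derivative f (at x) w) UNIV"
    and smooth_on_continuous: "continuous_on UNIV f"
proof -
  have k: "Ck_on k f UNIV" for k using assms by (simp add: smooth_on_def)
  show "f differentiable (at x)" using k[of "Suc 0"] by auto
  show "continuous_on UNIV f" using k[of 0] by auto
  show "smooth_on (\<lambda>x. frechet_derivative f (at x) w) UNIV"
    unfolding smooth_on_def
  proof
    fix j show "Ck_on j (\<lambda>x. frechet_derivative f (at x) w) UNIV" using k[of "Suc j"] by auto
  qed
qed

lemma finite_difference_has_derivative:
  assumes "\<And>y. (f has_derivative f' y) (at y)"
  shows "(finite_difference ws f has_derivative (\<lambda>v. finite_difference ws (\<lambda>y. f' y v) x)) (at x)"
proof (induction ws arbitrary: x)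
  case Nil
  have "finite_difference [] f = f" by (rule ext) simp
  then show ?case using assms by simp
next
  case (Cons w ws)
  have sh: "((\<lambda>y. finite_difference ws f (y + w)) has_derivative
       (\<lambda>v. finite_difference ws (\<lambda>y. f' y v) (x + w))) (at x)"
    by (rule has_derivative_compose[of "\<lambda>y. y + w" "\<lambda>v. v" x UNIV, OF _ Cons.IH[of "x + w"]])
       (auto intro!: derivative_eq_intros)
  have "finite_difference (w # ws) f = (\<lambda>y. finite_difference ws f (y + w) - finite_difference ws f y)"
    by (rule ext) simp
  then show ?case using has_derivative_diff[OF sh Cons.IH[of x]] by simp
qed

text \<open>The mean value theorem, applied once for each direction in the list. Through it differences of
  the function itself do the work of Taylor expansions in what follows.\<close>

lemma finite_difference_mean_value:
  fixes f :: "'a::real_normed_vector \<Rightarrow> real"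
  assumes "smooth_on f UNIV"
  shows "\<exists>y. norm (y - x) \<le> sum_list (map norm ws) \<and> finite_difference ws f x = iterated_derivative ws f y"
  using assms
proof (induction ws arbitrary: f x)
  case Nil
  then show ?case by auto
next
  case (Cons w ws)
  let ?f' = "\<lambda>y. frechet_derivative f (at y)"
  define \<phi> where "\<phi> = (\<lambda>t::real. finite_difference ws f (x + t *\<^sub>R w))"
  have der: "(finite_difference ws f has_derivative (\<lambda>v. finite_difference ws (\<lambda>y. ?f' y v) z)) (at z)" for z
    by (rule finite_difference_has_derivative)
       (use smooth_on_differentiable[OF Cons.prems] frechet_derivative_works in blast)
  have "(\<phi> has_real_derivative finite_difference ws (\<lambda>y. ?f' y w) (x + t *\<^sub>R w)) (at t)" for t
  proof -
    let ?L = "\<lambda>v. finite_difference ws (\<lambda>y. ?f' y v) (x + t *\<^sub>R w)"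
    have "(\<phi> has_derivative (\<lambda>s. ?L (s *\<^sub>R w))) (at t)"
      unfolding \<phi>_def
      by (rule has_derivative_compose[of "\<lambda>t. x + t *\<^sub>R w" "\<lambda>s. s *\<^sub>R w", OF _ der])
         (auto intro!: derivative_eq_intros)
    moreover have "?L (s *\<^sub>R w) = ?L w * s" for s
      using linear_cmul[OF has_derivative_linear[OF der[of "x + t *\<^sub>R w"]], of s w] by simp
    ultimately show ?thesis by (simp only: has_field_derivative_def)
  qed
  then obtain t where t: "0 < t" "t < 1"
      "\<phi> 1 - \<phi> 0 = finite_difference ws (\<lambda>y. ?f' y w) (x + t *\<^sub>R w)"
    using MVT2[of 0 1 \<phi> "\<lambda>t. finite_difference ws (\<lambda>y. ?f' y w) (x + t *\<^sub>R w)"] by auto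
  obtain y where y: "norm (y - (x + t *\<^sub>R w)) \<le> sum_list (map norm ws)"
      "finite_difference ws (\<lambda>y. ?f' y w) (x + t *\<^sub>R w) = iterated_derivative ws (\<lambda>y. ?f' y w) y"
    using Cons.IH[OF smooth_on_directional_derivative[OF Cons.prems, of w]] by blast
  have "norm (y - x) \<le> norm (y - (x + t *\<^sub>R w)) + norm (t *\<^sub>R w)"
    using norm_triangle_ineq[of "y - (x + t *\<^sub>R w)" "t *\<^sub>R w"] by simp
  also have "norm (t *\<^sub>R w) \<le> norm w" using t by (simp add: mult_left_le_one_le)
  finally have "norm (y - x) \<le> sum_list (map norm (w # ws))" using y by simp
  moreover have "finite_difference (w # ws) f x = iterated_derivative (w # ws) f y"
    using t y by (simp add: \<phi>_def)
  ultimately show ?case by blast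
qed

lemma iterated_derivative_sum:
  fixes g :: "'b \<Rightarrow> 'a::real_normed_vector \<Rightarrow> real"
  assumes "finite B" "\<And>b. b \<in> B \<Longrightarrow> smooth_on (g b) UNIV"
  shows "iterated_derivative ws (\<lambda>x. \<Sum>b\<in>B. c b * g b x) y = (\<Sum>b\<in>B. c b * iterated_derivative ws (g b) y)"
  using assms(2)
proof (induction ws arbitrary: g)
  case Nil
  then show ?case by simp
next
  case (Cons w ws)
  have "frechet_derivative (\<lambda>x. \<Sum>b\<in>B. c b * g b x) (at x) w = (\<Sum>b\<in>B. c b * frechet_derivative (g b) (at x) w)" for x
  proof -
    have "((\<lambda>x. \<Sum>b\<in>B. c b * g b x) has_derivative
        (\<lambda>w. \<Sum>b\<in>B. c b * frechet_derivative (g b) (at x) w)) (at x)"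
      by (intro has_derivative_sum has_derivative_mult_right)
         (use Cons.prems smooth_on_differentiable frechet_derivative_works in blast)
    from fun_cong[OF frechet_derivative_at[OF this], of w] show ?thesis by simp
  qed
  then show ?case
    using Cons.IH[of "\<lambda>b x. frechet_derivative (g b) (at x) w"]
      smooth_on_directional_derivative[OF Cons.prems] by simp
qed

lemma iterated_derivative_scale:
  fixes f :: "'a::real_normed_vector \<Rightarrow> real"
  assumes "smooth_on f UNIV"
  shows "iterated_derivative (map (\<lambda>w. h *\<^sub>R w) ws) f x = h ^ length ws * iterated_derivative ws f x"
  using assms
proof (induction ws arbitrary: f)
  case Nil
  then show ?case by simp
next
  case (Cons w ws)
  let ?g = "\<lambda>y. frechet_derivative f (at y) w"
  have "frechet_derivative f (at y) (h *\<^sub>R w) = h * ?g y" for y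
    using linear_frechet_derivative[OF smooth_on_differentiable[OF Cons.prems]] linear_cmul by fastforce
  then have "iterated_derivative (map (\<lambda>w. h *\<^sub>R w) (w # ws)) f x
      = iterated_derivative (map (\<lambda>w. h *\<^sub>R w) ws) (\<lambda>y. h * ?g y) x"
    by simp
  also have "\<dots> = h * iterated_derivative (map (\<lambda>w. h *\<^sub>R w) ws) ?g x"
    using iterated_derivative_sum[of "{()}" "\<lambda>_. ?g" _ "\<lambda>_. h" x]
      smooth_on_directional_derivative[OF Cons.prems] by simp
  finally show ?case using Cons.IH[OF smooth_on_directional_derivative[OF Cons.prems, of w]] by simp
qed

text \<open>Expanding each direction in the basis leaves derivatives in fixed directions, with the
  coordinates as coefficients. Joint continuity in the directions and the base point is what
  allows compactness arguments over all directions at once.\<close>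

lemma continuous_on_iterated_derivative:
  fixes f :: "'a::euclidean_space \<Rightarrow> real" and X :: "'s::topological_space \<Rightarrow> 'a"
  assumes "smooth_on f UNIV" "continuous_on S X" "\<And>g. g \<in> set gs \<Longrightarrow> continuous_on S g"
  shows "continuous_on S (\<lambda>s. iterated_derivative (map (\<lambda>g. g s) gs) f (X s))"
  using assms(1,3)
proof (induction gs arbitrary: f)
  case Nil
  then show ?case
    using continuous_on_compose2[OF smooth_on_continuous[OF Nil(1)] assms(2)] by simp
next
  case (Cons g gs)
  let ?d = "\<lambda>b x. frechet_derivative f (at x) b"
  have lin: "frechet_derivative f (at x) w = (\<Sum>b\<in>Basis. (w \<bullet> b) * ?d b x)" for x w
  proof -
    have L: "linear (frechet_derivative f (at x))"
      using linear_frechet_derivative[OF smooth_on_differentiable[OF Cons.prems(1)]] .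
    have "frechet_derivative f (at x) w = frechet_derivative f (at x) (\<Sum>b\<in>Basis. (w \<bullet> b) *\<^sub>R b)"
      by (simp add: euclidean_representation)
    then show ?thesis using L by (simp add: linear_sum linear_cmul)
  qed
  have "iterated_derivative (map (\<lambda>g. g s) (g # gs)) f (X s) =
      (\<Sum>b\<in>Basis. (g s \<bullet> b) * iterated_derivative (map (\<lambda>g. g s) gs) (?d b) (X s))" for s
    using iterated_derivative_sum[of Basis ?d "map (\<lambda>g. g s) gs" "\<lambda>b. g s \<bullet> b" "X s"]
      smooth_on_directional_derivative[OF Cons.prems(1)]
    by (simp add: lin[of _ "g s"])
  moreover have "continuous_on S (\<lambda>s. \<Sum>b\<in>Basis. (g s \<bullet> b) * iterated_derivative (map (\<lambda>g. g s) gs) (?d b) (X s))"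
  proof (intro continuous_on_sum continuous_on_mult)
    show "continuous_on S (\<lambda>s. g s \<bullet> b)" for b
      using Cons.prems(2)[of g] by (auto intro!: continuous_on_inner)
    show "continuous_on S (\<lambda>s. iterated_derivative (map (\<lambda>g. g s) gs) (?d b) (X s))" for b
      using Cons.prems by (intro Cons.IH smooth_on_directional_derivative) auto
  qed
  ultimately show ?case by simp
qed

lemma finite_difference_bound:
  assumes "\<And>y. norm (y - x) \<le> sum_list (map norm ws) \<Longrightarrow> \<bar>\<phi> y\<bar> \<le> \<tau>"
  shows "\<bar>finite_difference ws \<phi> x\<bar> \<le> 2 ^ length ws * \<tau>"
  using assms
proof (induction ws arbitrary: x)
  case Nil
  then show ?case by simp
next
  case (Cons w ws)
  have "\<bar>finite_difference ws \<phi> (x + w)\<bar> \<le> 2 ^ length ws * \<tau>"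
  proof (rule Cons.IH)
    fix y assume "norm (y - (x + w)) \<le> sum_list (map norm ws)"
    then show "\<bar>\<phi> y\<bar> \<le> \<tau>"
      using norm_triangle_ineq[of "y - (x + w)" w] by (intro Cons.prems) simp
  qed
  moreover have "\<bar>finite_difference ws \<phi> x\<bar> \<le> 2 ^ length ws * \<tau>"
    by (rule Cons.IH) (auto intro!: Cons.prems add_increasing)
  ultimately show ?case by simp
qed

lemma finite_difference_diff_const:
  assumes "ws \<noteq> []"
  shows "finite_difference ws (\<lambda>y. \<phi> y - c) x = finite_difference ws \<phi> x"
proof -
  have "finite_difference ws (\<lambda>y. \<phi> y - c) x = finite_difference ws \<phi> x - (if ws = [] then c else 0)" for ws x
    by (induction ws arbitrary: x) auto
  then show ?thesis using assms by simp
qed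

lemma finite_difference_compose:
  assumes "\<And>x w. g (x + w) = g x + L w"
  shows "finite_difference (map L ws) \<phi> (g x) = finite_difference ws (\<lambda>y. \<phi> (g y)) x"
  by (induction ws arbitrary: x) (auto simp flip: assms)

text \<open>In the \<open>k\<close>-th difference the top value has coefficient one, and the remaining binomial
  coefficients add up to \<open>2\<^sup>k - 1\<close> in absolute value.\<close>

lemma finite_difference_leading_term:
  assumes "\<And>i. i < k \<Longrightarrow> \<bar>\<phi> (x + real i *\<^sub>R u)\<bar> \<le> B" "B \<ge> 0"
  shows "\<bar>finite_difference (replicate k u) \<phi> x - \<phi> (x + real k *\<^sub>R u)\<bar> \<le> (2 ^ k - 1) * B"
  using assms(1)
proof (induction k arbitrary: x)
  case 0
  then show ?case by simp
next
  case (Suc k)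
  let ?D = "finite_difference (replicate k u) \<phi>"
  have "\<bar>?D (x + u) - \<phi> ((x + u) + real k *\<^sub>R u)\<bar> \<le> (2 ^ k - 1) * B"
  proof (rule Suc.IH)
    fix i assume "i < k"
    then show "\<bar>\<phi> (x + u + real i *\<^sub>R u)\<bar> \<le> B"
      using Suc.prems[of "Suc i"] by (simp add: scaleR_add_left algebra_simps)
  qed
  moreover have "\<bar>?D x - \<phi> (x + real k *\<^sub>R u)\<bar> \<le> (2 ^ k - 1) * B"
    by (rule Suc.IH) (use Suc.prems in auto)
  moreover have "\<bar>\<phi> (x + real k *\<^sub>R u)\<bar> \<le> B" using Suc.prems[of k] by simp
  moreover have shift: "(x + u) + real k *\<^sub>R u = x + real (Suc k) *\<^sub>R u" by (simp add: scaleR_add_left algebra_simps)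
  moreover have "\<bar>a - b - c\<bar> \<le> C + C + B" if "\<bar>a - c\<bar> \<le> C" "\<bar>b - d\<bar> \<le> C" "\<bar>d\<bar> \<le> B" for a b c d C :: real
    using that by linarith
  ultimately have "\<bar>?D (x + u) - ?D x - \<phi> ((x + u) + real k *\<^sub>R u)\<bar> \<le> (2 ^ k - 1) * B + (2 ^ k - 1) * B + B"
    by blast
  also have "\<dots> = (2 ^ Suc k - 1) * B" by (simp add: algebra_simps)
  finally show ?case by (simp only: shift replicate_Suc finite_difference.simps)
qed

text \<open>A function whose \<open>k\<close>-th differences are small behaves like a polynomial of degree less
  than \<open>k\<close>. Each new value is determined, up to \<open>E\<close>, by the \<open>k\<close> equally spaced values before it,
  so the bound grows by a factor \<open>2\<^sup>k + 1\<close> per unit of length.\<close>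

lemma finite_difference_extrapolation:
  fixes \<phi> :: "'a::real_normed_vector \<Rightarrow> real"
  assumes D: "\<And>t. 0 \<le> t \<Longrightarrow> t \<le> real J \<Longrightarrow> \<bar>finite_difference (replicate k u) \<phi> (x + t *\<^sub>R u)\<bar> \<le> E"
    and s: "\<And>t. 0 \<le> t \<Longrightarrow> t \<le> real k \<Longrightarrow> \<bar>\<phi> (x + t *\<^sub>R u)\<bar> \<le> s"
    and k: "k > 0" and t: "0 \<le> t" "t \<le> real k + real J"
  shows "\<bar>\<phi> (x + t *\<^sub>R u)\<bar> \<le> (2 ^ k + 1) ^ J * (s + E)"
proof -
  have E: "E \<ge> 0" using D[of 0] by auto
  have s0: "s \<ge> 0" using s[of 0] by auto
  have "\<bar>\<phi> (x + t *\<^sub>R u)\<bar> \<le> (2 ^ k + 1) ^ j * (s + E)" if "j \<le> J" "0 \<le> t" "t \<le> real k + real j" for j t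
    using that
  proof (induction j arbitrary: t)
    case 0
    then show ?case using s[of t] E by auto
  next
    case (Suc j)
    let ?B = "(2 ^ k + 1) ^ j * (s + E)"
    have B0: "?B \<ge> 0" using E s0 by simp
    have EB: "E \<le> ?B"
    proof -
      have "1 * (s + E) \<le> (2 ^ k + 1) ^ j * (s + E)"
        using E s0 by (intro mult_right_mono one_le_power) auto
      then show ?thesis using s0 by simp
    qed
    have BB: "?B \<le> (2 ^ k + 1) ^ Suc j * (s + E)"
      using E s0 by (intro mult_right_mono power_increasing) auto
    show ?case
    proof (cases "t \<le> real k + real j")
      case True
      then show ?thesis using Suc BB by fastforce
    next
      case False
      define t' where "t' = t - real k"
      have t': "0 \<le> t'" "t' \<le> real J" using False Suc.prems by (auto simp: t'_def)
      have "\<bar>finite_difference (replicate k u) \<phi> (x + t' *\<^sub>R u) - \<phi> ((x + t' *\<^sub>R u) + real k *\<^sub>R u)\<bar> \<le> (2 ^ k - 1) * ?B"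
      proof (rule finite_difference_leading_term[OF _ B0])
        fix i assume "i < k"
        then have "real i \<le> real k - 1" by linarith
        then have "\<bar>\<phi> (x + (t' + real i) *\<^sub>R u)\<bar> \<le> ?B"
          using Suc t' by (intro Suc.IH) (auto simp: t'_def)
        then show "\<bar>\<phi> (x + t' *\<^sub>R u + real i *\<^sub>R u)\<bar> \<le> ?B" by (simp add: scaleR_add_left add.assoc)
      qed
      moreover have "(x + t' *\<^sub>R u) + real k *\<^sub>R u = x + t *\<^sub>R u" by (simp add: t'_def scaleR_diff_left)
      ultimately have "\<bar>\<phi> (x + t *\<^sub>R u)\<bar> \<le> (2 ^ k - 1) * ?B + E" using D[OF t'] by auto
      also have "\<dots> \<le> (2 ^ k - 1) * ?B + ?B" using EB by simp
      also have "\<dots> = 2 ^ k * ?B" by (simp add: algebra_simps)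
      also have "\<dots> \<le> (2 ^ k + 1) * ?B" using B0 by (intro mult_right_mono) auto
      finally show ?thesis by (simp add: mult_ac)
    qed
  qed
  then show ?thesis using t by blast
qed

text \<open>The form in which compactness is used below: \<open>N\<close> is a constant that may be enlarged, and a
  local constant at each point of \<open>F\<close> becomes one constant for a neighbourhood of \<open>F\<close>.\<close>

lemma compact_uniform_neighbourhood:
  fixes F :: "'a::metric_space set"
  assumes "compact F"
    and mono: "\<And>m n y. m \<le> n \<Longrightarrow> P m y \<Longrightarrow> P n y"
    and loc: "\<And>x. x \<in> F \<Longrightarrow> \<exists>N::nat. \<exists>e>0. \<forall>y. dist x y < e \<longrightarrow> P N y"
  shows "\<exists>N. \<exists>e>0. \<forall>x\<in>F. \<forall>y. dist x y < e \<longrightarrow> P N y"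
proof (rule ccontr)
  assume "\<not> ?thesis"
  then have "\<forall>n. \<exists>x y. x \<in> F \<and> dist x y < 1 / Suc n \<and> \<not> P n y"
    by (metis of_nat_0_less_iff zero_less_Suc zero_less_divide_1_iff)
  then obtain x y where xy: "\<And>n::nat. x n \<in> F" "\<And>n. dist (x n) (y n) < 1 / Suc n" "\<And>n. \<not> P n (y n)"
    by metis
  obtain l r where l: "l \<in> F" "strict_mono (r::nat \<Rightarrow> nat)" "(x \<circ> r) \<longlonglongrightarrow> l"
    using \<open>compact F\<close> xy(1) unfolding compact_def by metis
  obtain N e where N: "e > 0" "\<And>y. dist l y < e \<Longrightarrow> P N y" using loc[OF l(1)] by blast
  have "\<forall>\<^sub>F n in sequentially. dist ((x \<circ> r) n) l < e / 2" using l(3) N(1) unfolding tendsto_iff by (meson half_gt_zero)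
  moreover have "\<forall>\<^sub>F n in sequentially. 1 / real (Suc n) < e / 2"
    using N(1) LIMSEQ_inverse_real_of_nat[unfolded tendsto_iff] by (auto simp: inverse_eq_divide dest!: spec[of _ "e/2"])
  moreover have "\<forall>\<^sub>F n in sequentially. n \<ge> N" by (rule eventually_ge_at_top)
  ultimately have "\<forall>\<^sub>F n in sequentially. dist ((x \<circ> r) n) l < e / 2 \<and> 1 / real (Suc n) < e / 2 \<and> n \<ge> N"
    by eventually_elim auto
  then obtain n where n: "dist (x (r n)) l < e / 2" "1 / real (Suc n) < e / 2" "n \<ge> N"
    by (auto simp: eventually_sequentially)
  have rn: "r n \<ge> n" using l(2) by (rule seq_suble)
  have "1 / real (Suc (r n)) \<le> 1 / real (Suc n)" using rn by (intro divide_left_mono) auto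
  then have "dist (x (r n)) (y (r n)) < e / 2" using xy(2)[of "r n"] n by linarith
  then have "dist l (y (r n)) < e"
    using n(1) dist_triangle[of l "y (r n)" "x (r n)"] by (simp add: dist_commute)
  then have "P N (y (r n))" by (rule N)
  then have "P (r n) (y (r n))" using mono[of N "r n"] n rn by auto
  then show False using xy(3) by blast
qed

section \<open>Complex scalars and the Hermitian product\<close>

lemma norm_vector_scalar_mult: "norm (c *s (x :: complex ^ 'n)) = cmod c * norm x"
  by (simp add: norm_vec_def norm_mult L2_set_def power_mult_distrib sum_distrib_left[symmetric] real_sqrt_mult)

lemma scaleR_eq_vector_scalar_mult: "t *\<^sub>R (x :: complex ^ 'n) = of_real t *s x"
  by (simp add: vec_eq_iff scaleR_conv_of_real[where 'a = complex])

lemma bounded_linear_vector_scalar_mult_left: "bounded_linear (\<lambda>c. c *s (x :: complex ^ 'n))"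
  by (rule bounded_linear_intro[of _ "norm x"])
     (auto simp: vector_sadd_rdistrib scaleR_eq_vector_scalar_mult vector_smult_assoc
        scaleR_conv_of_real[where 'a = complex] norm_vector_scalar_mult)

lemma bounded_linear_vector_scalar_mult_right: "bounded_linear (\<lambda>x :: complex ^ 'n. c *s x)"
  by (rule bounded_linear_intro[of _ "cmod c"])
     (auto simp: vector_add_ldistrib scaleR_eq_vector_scalar_mult vector_smult_assoc norm_vector_scalar_mult mult_ac)

lemmas continuous_on_vector_scalar_mult_left [continuous_intros] =
  bounded_linear.continuous_on[OF bounded_linear_vector_scalar_mult_left]
lemmas continuous_on_vector_scalar_mult_right [continuous_intros] =
  bounded_linear.continuous_on[OF bounded_linear_vector_scalar_mult_right]

lemma hermitian_product_left:
  "hermitian_product (x + y) z = hermitian_product x z + hermitian_product y z"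
  "hermitian_product (x - y) z = hermitian_product x z - hermitian_product y z"
  "hermitian_product (c *s x) z = c * hermitian_product x z"
  by (simp_all add: hermitian_product_def sum.distrib sum_subtractf sum_distrib_left algebra_simps)

lemma cnj_hermitian_product: "cnj (hermitian_product x y) = hermitian_product y x"
  by (simp add: hermitian_product_def mult.commute)

lemma hermitian_product_self: "hermitian_product x x = of_real ((norm x)\<^sup>2)"
  by (simp add: hermitian_product_def complex_norm_square[symmetric] norm_vec_def L2_set_def sum_nonneg)

lemma Re_hermitian_product: "Re (hermitian_product x y) = x \<bullet> y"
  by (simp add: hermitian_product_def inner_vec_def inner_complex_def)

lemma unimodular_rotation: "\<exists>c. cmod c = 1 \<and> c * z = of_real (cmod z)"
proof (cases "z = 0")
  case True
  then show ?thesis by (intro exI[of _ 1]) auto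
next
  case False
  then show ?thesis
    by (intro exI[of _ "cnj z / of_real (cmod z)"])
       (simp add: norm_divide power2_eq_square[symmetric] complex_norm_square[symmetric] mult.commute[of "cnj z"],
        simp add: power2_eq_square)
qed

lemma cmod_hermitian_product_le: "cmod (hermitian_product x y) \<le> norm x * norm y"
proof -
  obtain c where c: "cmod c = 1" "c * hermitian_product x y = of_real (cmod (hermitian_product x y))"
    using unimodular_rotation by blast
  have "cmod (hermitian_product x y) = Re (hermitian_product (c *s x) y)"
    using c by (simp add: hermitian_product_left)
  also have "\<dots> \<le> norm (c *s x) * norm y" by (simp add: Re_hermitian_product norm_cauchy_schwarz)
  finally show ?thesis using c by (simp add: norm_vector_scalar_mult)
qed

text \<open>The modulus of a complex functional is attained by its real part on a rotation of the
  argument; so real half-space estimates on a circled set bound the complex functional.\<close>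

lemma cmod_hermitian_product_leI:
  assumes "\<And>c. cmod c = 1 \<Longrightarrow> (c *s x) \<bullet> y \<le> B"
  shows "cmod (hermitian_product x y) \<le> B"
proof -
  obtain c where c: "cmod c = 1" "c * hermitian_product x y = of_real (cmod (hermitian_product x y))"
    using unimodular_rotation by blast
  then have "cmod (hermitian_product x y) = (c *s x) \<bullet> y"
    by (simp add: hermitian_product_left flip: Re_hermitian_product)
  then show ?thesis using assms c by metis
qed

lemma complex_line_add: "complex_line q (q + x) = {q + c *s x |c. True}"
  by (simp add: complex_line_def)

lemma complex_line_rescale:
  assumes "c \<noteq> 0" shows "complex_line q (q + c *s x) = complex_line q (q + x)"
proof -
  have "q + d *s x \<in> complex_line q (q + c *s x)" for d
    unfolding complex_line_add
    by (rule CollectI, rule exI[of _ "d / c"]) (simp add: assms vector_smult_assoc)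
  moreover have "q + d *s (c *s x) \<in> complex_line q (q + x)" for d
    unfolding complex_line_add vector_smult_assoc by blast
  ultimately show ?thesis unfolding complex_line_add by blast
qed

lemma hermitian_product_axis: "hermitian_product w (axis i c) = w $ i * cnj c"
proof -
  have "hermitian_product w (axis i c) = (\<Sum>j\<in>UNIV. if j = i then w $ i * cnj c else 0)"
    unfolding hermitian_product_def by (rule sum.cong) (auto simp: axis_def)
  then show ?thesis by simp
qed

lemma hermitian_product_unitary:
  assumes "unitary_matrix U" shows "hermitian_product (U *v x) (U *v y) = hermitian_product x y"
proof -
  have uni: "(\<Sum>i\<in>UNIV. cnj (U $ i $ k) * U $ i $ j) = (if k = j then 1 else 0)" for j k
    using assms[unfolded unitary_matrix_def] by (auto simp: vec_eq_iff matrix_matrix_mult_def mat_def)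
  have "hermitian_product (U *v x) (U *v y) =
      (\<Sum>i\<in>UNIV. \<Sum>j\<in>UNIV. \<Sum>k\<in>UNIV. x $ j * cnj (y $ k) * (cnj (U $ i $ k) * U $ i $ j))"
    by (simp add: hermitian_product_def matrix_vector_mult_def sum_product mult_ac)
  also have "\<dots> = (\<Sum>j\<in>UNIV. \<Sum>i\<in>UNIV. \<Sum>k\<in>UNIV. x $ j * cnj (y $ k) * (cnj (U $ i $ k) * U $ i $ j))"
    by (rule sum.swap)
  also have "\<dots> = (\<Sum>j\<in>UNIV. \<Sum>k\<in>UNIV. x $ j * cnj (y $ k) * (\<Sum>i\<in>UNIV. cnj (U $ i $ k) * U $ i $ j))"
    unfolding sum_distrib_left by (rule sum.cong[OF refl]) (rule sum.swap)
  also have "\<dots> = hermitian_product x y"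
    by (simp add: uni hermitian_product_def if_distrib cong: if_cong)
  finally show ?thesis .
qed

lemma matrix_vector_mult_sum: "A *v (\<Sum>x\<in>S. f x) = (\<Sum>x\<in>S. A *v f x)"
  by (induction S rule: infinite_finite_induct) (auto simp: matrix_vector_right_distrib)

section \<open>The balanced core of a convex set\<close>

text \<open>After translating \<open>q\<close> to the origin, this is the largest subset of the closure of \<open>\<Omega>\<close> that is
  closed under multiplication by complex numbers of modulus at most one.\<close>

definition balanced_core :: "(complex ^ 'n) set \<Rightarrow> complex ^ 'n \<Rightarrow> (complex ^ 'n) set" where
  "balanced_core \<Omega> q = {x. \<forall>c. cmod c \<le> 1 \<longrightarrow> q + c *s x \<in> closure \<Omega>}"

locale pointed_convex_domain =
  fixes \<Omega> :: "(complex ^ 'n) set" and q :: "complex ^ 'n"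
  assumes open_domain: "open \<Omega>" and convex_domain: "convex \<Omega>" and bounded_domain: "bounded \<Omega>"
    and base_point: "q \<in> \<Omega>"
begin

abbreviation "K \<equiv> balanced_core \<Omega> q"

text \<open>A point \<open>q + c x\<close> with \<open>|c| < 1\<close> lies strictly between the interior point \<open>q\<close> and a point of the
  closure.\<close>

lemma core_disc:
  assumes "x \<in> K" "cmod c < 1" shows "q + c *s x \<in> \<Omega>"
proof (cases "c = 0")
  case True
  then show ?thesis using base_point by simp
next
  case False
  define u where "u = c / of_real (cmod c)"
  have u: "cmod u = 1" "c = of_real (cmod c) * u" using False by (auto simp: u_def norm_divide)
  have "q + u *s x \<in> closure \<Omega>" using assms(1) u by (simp add: balanced_core_def)
  then have "(q + u *s x) - (1 - cmod c) *\<^sub>R ((q + u *s x) - q) \<in> interior \<Omega>"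
    using assms(2) base_point open_domain
    by (intro mem_interior_closure_convex_shrink convex_domain) (auto simp: interior_open)
  moreover have "(q + u *s x) - (1 - cmod c) *\<^sub>R ((q + u *s x) - q) = q + cmod c *\<^sub>R (u *s x)"
    by (simp add: algebra_simps)
  moreover have "cmod c *\<^sub>R (u *s x) = c *s x"
    using u(2) by (simp add: scaleR_eq_vector_scalar_mult vector_smult_assoc)
  ultimately show ?thesis
    using open_domain by (simp only: interior_open)
qed

lemma core_intro:
  assumes "\<And>c. cmod c < 1 \<Longrightarrow> q + c *s x \<in> \<Omega>" shows "x \<in> K"
proof -
  have "closed ((\<lambda>c. q + c *s x) -` closure \<Omega>)"
    by (rule closed_vimage[OF closed_closure]) (intro continuous_intros)
  moreover have "ball 0 1 \<subseteq> (\<lambda>c. q + c *s x) -` closure \<Omega>" using assms closure_subset[of \<Omega>] by (auto simp: subset_iff)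
  ultimately have "closure (ball 0 1) \<subseteq> (\<lambda>c. q + c *s x) -` closure \<Omega>" by (rule closure_minimal[rotated])
  then show ?thesis by (auto simp: balanced_core_def subset_iff)
qed

lemma core_scale: "x \<in> K \<Longrightarrow> cmod c \<le> 1 \<Longrightarrow> c *s x \<in> K"
  by (auto simp: balanced_core_def vector_smult_assoc norm_mult mult_le_one)

lemma convex_core: "convex K"
proof (rule convexI)
  fix x y and u v :: real
  assume *: "x \<in> K" "y \<in> K" "0 \<le> u" "0 \<le> v" "u + v = 1"
  show "u *\<^sub>R x + v *\<^sub>R y \<in> K" unfolding balanced_core_def
  proof safe
    fix c :: complex assume "cmod c \<le> 1"
    then have "u *\<^sub>R (q + c *s x) + v *\<^sub>R (q + c *s y) \<in> closure \<Omega>"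
      using * by (intro convexD[OF convex_closure[OF convex_domain]]) (auto simp: balanced_core_def)
    moreover have "u *\<^sub>R (q + c *s x) + v *\<^sub>R (q + c *s y) = (u + v) *\<^sub>R q + c *s (u *\<^sub>R x + v *\<^sub>R y)"
      by (simp add: scaleR_eq_vector_scalar_mult vec_eq_iff algebra_simps)
    ultimately show "q + c *s (u *\<^sub>R x + v *\<^sub>R y) \<in> closure \<Omega>" using * by simp
  qed
qed

lemma closed_core: "closed K"
proof -
  have "K = (\<Inter>c\<in>{c. cmod c \<le> 1}. (\<lambda>x. q + c *s x) -` closure \<Omega>)" by (auto simp: balanced_core_def)
  also have "closed \<dots>"
    by (intro closed_INT ballI closed_vimage closed_closure continuous_intros)
  finally show ?thesis .
qed

lemma bounded_core: "bounded K"
proof -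
  have "K \<subseteq> (\<lambda>y. y - q) ` closure \<Omega>"
  proof
    fix x assume "x \<in> K"
    then have "q + 1 *s x \<in> closure \<Omega>" unfolding balanced_core_def by (auto dest!: spec[of _ 1])
    then show "x \<in> (\<lambda>y. y - q) ` closure \<Omega>" by (intro image_eqI[of _ _ "q + x"]) auto
  qed
  moreover have "bounded ((\<lambda>y. y - q) ` closure \<Omega>)"
    using bounded_translation[OF bounded_closure[OF bounded_domain], of "- q"] by simp
  ultimately show ?thesis by (rule bounded_subset[rotated])
qed

lemma small_in_core: "\<exists>e>0. \<forall>x. norm x < e \<longrightarrow> x \<in> K"
proof -
  obtain e where e: "e > 0" "ball q e \<subseteq> \<Omega>" using open_domain base_point open_contains_ball by blast
  have "x \<in> K" if "norm x < e" for x
  proof (rule core_intro)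
    fix c :: complex assume "cmod c < 1"
    then have "norm (c *s x) \<le> norm x" by (simp add: norm_vector_scalar_mult mult_left_le_one_le)
    then have "norm (c *s x) < e" using that by simp
    then show "q + c *s x \<in> \<Omega>" using e(2) by (auto simp: dist_norm)
  qed
  then show ?thesis using e by blast
qed

lemma frontier_on_segment:
  assumes "q + c *s x \<notin> \<Omega>"
  shows "\<exists>d. cmod d \<le> cmod c \<and> q + d *s x \<in> frontier \<Omega>"
proof -
  let ?S = "closed_segment q (q + c *s x)"
  have "?S \<inter> \<Omega> \<noteq> {}" using base_point by auto
  moreover have "?S - \<Omega> \<noteq> {}" using assms by auto
  ultimately have "?S \<inter> frontier \<Omega> \<noteq> {}" by (intro connected_Int_frontier) auto
  then obtain t where t: "0 \<le> t" "t \<le> 1" "(1 - t) *\<^sub>R q + t *\<^sub>R (q + c *s x) \<in> frontier \<Omega>"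
    by (auto simp: in_segment)
  have "(1 - t) *\<^sub>R q + t *\<^sub>R (q + c *s x) = q + (of_real t * c) *s x"
    by (simp add: scaleR_eq_vector_scalar_mult vec_eq_iff algebra_simps)
  then show ?thesis using t by (intro exI[of _ "of_real t * c"]) (auto simp: norm_mult mult_left_le_one_le)
qed

lemma line_meets_frontier:
  assumes "x \<noteq> 0" shows "complex_line q (q + x) \<inter> frontier \<Omega> \<noteq> {}"
proof -
  obtain B where B: "\<And>y. y \<in> \<Omega> \<Longrightarrow> norm y \<le> B" using bounded_domain by (auto simp: bounded_iff)
  define c where "c = (B + norm q + 1) / norm x"
  have "q + of_real c *s x \<notin> \<Omega>"
  proof
    assume "q + of_real c *s x \<in> \<Omega>"
    then have "norm (q + of_real c *s x) \<le> B" by (rule B)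
    moreover have "norm (of_real c *s x) \<le> norm (q + of_real c *s x) + norm q"
      using norm_triangle_ineq4[of "q + of_real c *s x" q] by simp
    moreover have "norm (of_real c *s x) \<ge> B + norm q + 1"
    proof -
      have "B + norm q + 1 = c * norm x" using assms by (simp add: c_def)
      also have "\<dots> \<le> \<bar>c\<bar> * norm x" by (intro mult_right_mono) auto
      finally show ?thesis by (simp add: norm_vector_scalar_mult)
    qed
    ultimately show False by linarith
  qed
  then show ?thesis using frontier_on_segment[of "of_real c" x] by (auto simp: complex_line_add)
qed

text \<open>A segment from \<open>q\<close> that leaves \<open>\<Omega>\<close> crosses the frontier, so an open disc about \<open>q\<close> that meets no
  frontier point stays inside.\<close>

lemma core_of_frontier_distance:
  assumes "\<And>d. q + d *s x \<in> frontier \<Omega> \<Longrightarrow> norm x \<le> dist q (q + d *s x)"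
  shows "x \<in> K"
proof (rule core_intro, rule ccontr)
  fix c assume c: "cmod c < 1" "q + c *s x \<notin> \<Omega>"
  then obtain d where d: "cmod d \<le> cmod c" "q + d *s x \<in> frontier \<Omega>" using frontier_on_segment by blast
  then have "norm x \<le> cmod d * norm x" using assms[of d] by (simp add: dist_norm norm_vector_scalar_mult)
  moreover have "x \<noteq> 0" using c base_point by auto
  ultimately show False using d c by auto
qed

text \<open>With the converse below: the distance to the frontier along a complex line is the radius of the
  largest disc about \<open>q\<close> in that line, so that maximising it over lines means maximising the norm
  over the core.\<close>

lemma norm_le_distance_along:
  assumes "x \<in> K" "x \<noteq> 0" shows "norm x \<le> distance_along \<Omega> q (complex_line q (q + x))"
  unfolding distance_along_def infdist_notempty[OF line_meets_frontier[OF assms(2)]]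
proof (rule cINF_greatest[OF line_meets_frontier[OF assms(2)]], safe)
  fix y assume y: "y \<in> complex_line q (q + x)" "y \<in> frontier \<Omega>"
  then obtain c where c: "y = q + c *s x" by (auto simp: complex_line_add)
  have "\<not> cmod c < 1" using core_disc[OF assms(1), of c] y c open_domain by (auto simp: frontier_def interior_open)
  then show "norm x \<le> dist q y" by (simp add: c dist_norm norm_vector_scalar_mult mult_le_cancel_right1)
qed

lemma core_of_distance_along:
  assumes "x \<noteq> 0" "norm x \<le> distance_along \<Omega> q (complex_line q (q + x))" shows "x \<in> K"
proof (rule core_of_frontier_distance)
  fix d assume "q + d *s x \<in> frontier \<Omega>"
  then have "infdist q (complex_line q (q + x) \<inter> frontier \<Omega>) \<le> dist q (q + d *s x)"
    by (intro infdist_le) (auto simp: complex_line_add)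
  then show "norm x \<le> dist q (q + d *s x)" using assms(2) by (simp add: distance_along_def)
qed

end


section \<open>Polydiscs and the core\<close>

definition index_rank :: "'n::{finite,linorder} \<Rightarrow> nat" where
  "index_rank i = card {i<..}"

text \<open>The description of McNeal's polydisc by the chosen points alone, without the unitary map: the
  \<open>i\<close>-th coordinate of \<open>z\<close> is the component of \<open>z - q\<close> along the unit vector in direction \<open>p i - q\<close>.\<close>

definition extremal_polydisc :: "('n::finite) cspace \<Rightarrow> ('n \<Rightarrow> 'n cspace) \<Rightarrow> 'n cspace set" where
  "extremal_polydisc q p = {z. \<forall>i. cmod (hermitian_product (z - q) (p i - q)) < (norm (p i - q))\<^sup>2}"

locale mcneal_basis = pointed_convex_domain \<Omega> q
  for \<Omega> :: "('n::{finite,linorder}) cspace set" and q :: "'n cspace" +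
  fixes p :: "'n \<Rightarrow> 'n cspace"
  assumes mcneal_points: "mcneal_points \<Omega> q p"
begin

abbreviation "v i \<equiv> p i - q"

lemma point_in_frontier: "p i \<in> frontier \<Omega>"
  using mcneal_points by (simp add: mcneal_points_def)

lemma v_nonzero: "v i \<noteq> 0"
  using point_in_frontier[of i] base_point open_domain by (auto simp: frontier_def interior_open)

lemma orthogonal:
  assumes "i < j" shows "hermitian_product (v i) (v j) = 0"
proof -
  have "i \<noteq> Max UNIV" using assms by (metis Max_ge UNIV_I finite leD)
  then have "complex_line q (p i) \<in> orthogonal_lines q p i"
    using mcneal_points by (auto simp: mcneal_points_def is_arg_max_def)
  then obtain w where w: "complex_line q (p i) = complex_line q (q + w)" "hermitian_product w (v j) = 0"
    using assms by (auto simp: orthogonal_lines_def)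
  have "p i = q + 1 *s (p i - q)" by simp
  then have "p i \<in> complex_line q (p i)" unfolding complex_line_def by blast
  then obtain c where "p i = q + c *s w" using w(1) by (auto simp: complex_line_add)
  then show ?thesis using w(2) by (simp add: hermitian_product_left)
qed

lemma orthogonal': "i \<noteq> j \<Longrightarrow> hermitian_product (v i) (v j) = 0"
  using orthogonal[of i j] orthogonal[of j i] cnj_hermitian_product[of "v j" "v i"]
  by (metis complex_cnj_zero neqE)

lemma line_through_point: "complex_line q (q + v i) = complex_line q (p i)"
  by simp

lemma v_in_core: "v i \<in> K"
proof (cases "i = Max UNIV")
  case True
  then have "norm (v i) = infdist q (frontier \<Omega>)"
    using mcneal_points by (simp add: mcneal_points_def dist_norm norm_minus_commute)
  then show ?thesis by (intro core_of_frontier_distance) (simp add: infdist_le)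
next
  case False
  then have "dist q (p i) = distance_along \<Omega> q (complex_line q (q + v i))"
    using mcneal_points unfolding mcneal_points_def line_through_point by blast
  then show ?thesis using v_nonzero by (intro core_of_distance_along) (simp_all add: dist_norm norm_minus_commute)
qed

lemma maximality:
  assumes i: "i \<noteq> Max UNIV" and x: "x \<in> K" "\<And>j. i < j \<Longrightarrow> hermitian_product x (v j) = 0"
  shows "norm x \<le> norm (v i)"
proof (cases "x = 0")
  case False
  have "complex_line q (q + x) \<in> orthogonal_lines q p i" using x False by (auto simp: orthogonal_lines_def)
  then have "distance_along \<Omega> q (complex_line q (q + x)) \<le> distance_along \<Omega> q (complex_line q (p i))"
    using mcneal_points i unfolding mcneal_points_def is_arg_max_def by (meson not_le)
  also have "\<dots> = norm (v i)"
    using mcneal_points i by (metis dist_norm mcneal_points_def norm_minus_commute)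
  finally show ?thesis using norm_le_distance_along[OF x(1) False] by linarith
qed simp

text \<open>A supporting hyperplane of \<open>\<Omega>\<close> at the closest boundary point also supports the ball about \<open>q\<close>
  that touches the boundary there, so it is orthogonal to the radius. This replaces the
  maximality that is available for the other indices.\<close>

lemma closest_point_bound:
  assumes x: "x \<in> K"
  defines "m \<equiv> Max UNIV"
  shows "cmod (hermitian_product x (v m)) \<le> (norm (v m))\<^sup>2"
proof -
  have dm: "norm (v m) = infdist q (frontier \<Omega>)"
    using mcneal_points by (simp add: mcneal_points_def dist_norm norm_minus_commute m_def)
  have "p m \<in> closure \<Omega>" "p m \<notin> rel_interior \<Omega>"
    using point_in_frontier[of m] open_domain base_point
    by (auto simp: frontier_def interior_open rel_interior_open)
  then obtain a where a: "a \<noteq> 0" "\<And>y. y \<in> closure \<Omega> \<Longrightarrow> a \<bullet> y \<ge> a \<bullet> p m"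
    using supporting_hyperplane_relative_frontier[OF convex_domain] by metis
  define b where "b = - a"
  have b: "b \<noteq> 0" "\<And>y. y \<in> closure \<Omega> \<Longrightarrow> b \<bullet> y \<le> b \<bullet> p m"
    using a by (auto simp: b_def)
  define u where "u = (norm (v m) / norm b) *\<^sub>R b"
  have nu: "norm u = norm (v m)" using b by (simp add: u_def)
  have "u \<in> K"
    by (rule core_of_frontier_distance) (simp add: nu dm infdist_le)
  then have "q + 1 *s u \<in> closure \<Omega>" unfolding balanced_core_def by (auto dest!: spec[of _ 1])
  then have "b \<bullet> (q + u) \<le> b \<bullet> p m" using b by simp
  then have "b \<bullet> u \<le> b \<bullet> v m" by (simp add: inner_right_distrib inner_diff_right)
  moreover have "b \<bullet> u = norm b * norm (v m)" using b by (simp add: u_def power2_norm_eq_inner[symmetric] power2_eq_square)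
  moreover have "b \<bullet> v m \<le> norm b * norm (v m)" by (rule norm_cauchy_schwarz)
  ultimately have "b \<bullet> v m = norm b * norm (v m)" by linarith
  then have eq: "norm b *\<^sub>R v m = norm (v m) *\<^sub>R b" using norm_cauchy_schwarz_eq by blast
  have supp: "y \<bullet> v m \<le> p m \<bullet> v m" if "y \<in> closure \<Omega>" for y
  proof -
    have "(p m - y) \<bullet> (norm b *\<^sub>R v m) = norm (v m) * ((p m - y) \<bullet> b)" by (simp add: eq)
    also have "\<dots> \<ge> 0" using b(2)[OF that] by (simp add: inner_commute[of _ b] inner_diff_right)
    finally show ?thesis using b(1) by (simp add: inner_diff_left zero_le_mult_iff)
  qed
  show ?thesis
  proof (rule cmod_hermitian_product_leI)
    fix c :: complex assume "cmod c = 1"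
    then have "q + c *s x \<in> closure \<Omega>" using x by (simp add: balanced_core_def)
    from supp[OF this] have "(c *s x) \<bullet> v m \<le> (p m - q) \<bullet> v m" by (simp add: inner_left_distrib inner_diff_left)
    then show "(c *s x) \<bullet> v m \<le> (norm (v m))\<^sup>2" by (simp add: power2_norm_eq_inner)
  qed
qed

lemma coordinate_bound:
  assumes "x \<in> K" "\<And>j. i < j \<Longrightarrow> hermitian_product x (v j) = 0"
  shows "cmod (hermitian_product x (v i)) \<le> (norm (v i))\<^sup>2"
proof (cases "i = Max UNIV")
  case True
  then show ?thesis using closest_point_bound[OF assms(1)] by simp
next
  case False
  have "cmod (hermitian_product x (v i)) \<le> norm x * norm (v i)" by (rule cmod_hermitian_product_le)
  also have "\<dots> \<le> norm (v i) * norm (v i)" using maximality[OF False assms] by (intro mult_right_mono) auto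
  finally show ?thesis by (simp add: power2_eq_square)
qed

text \<open>A vector of the core is made orthogonal to the directions chosen before \<open>i\<close> by subtracting its
  components one by one. By the previous bound the component subtracted lies in the core as well,
  so the average with it stays in the core: each step costs a factor of two.\<close>

lemma orthogonalised:
  assumes x: "x \<in> K"
  shows "\<exists>y\<in>K. (\<forall>j>i. hermitian_product y (v j) = 0) \<and>
    (\<forall>j\<le>i. 2 ^ index_rank i * hermitian_product y (v j) = hermitian_product x (v j))"
proof (induction "index_rank i" arbitrary: i)
  case 0
  then have "{i<..} = {}" by (simp add: index_rank_def)
  then show ?case using x 0 by (intro bexI[of _ x]) auto
next
  case (Suc k)
  then have ne: "{i<..} \<noteq> {}" by (auto simp: index_rank_def)
  define i' where "i' = Min {i<..}"
  have i': "i < i'" using Min_in[OF finite ne] by (simp add: i'_def)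
  have ge: "i' \<le> j" if "i < j" for j using that by (simp add: i'_def)
  have "{i<..} = insert i' {i'<..}" using i' ge by force
  then have rank: "index_rank i = Suc (index_rank i')" by (simp add: index_rank_def)
  then obtain z where z: "z \<in> K" "\<And>j. i' < j \<Longrightarrow> hermitian_product z (v j) = 0"
      "\<And>j. j \<le> i' \<Longrightarrow> 2 ^ index_rank i' * hermitian_product z (v j) = hermitian_product x (v j)"
    using Suc.hyps(1)[of i'] Suc.hyps(2) by auto
  \<comment> \<open>The coefficient of \<open>v i'\<close> in the orthogonal expansion of \<open>z\<close>.\<close>
  define c where "c = - hermitian_product z (v i') / of_real ((norm (v i'))\<^sup>2)"
  have "cmod c \<le> 1"
    using coordinate_bound[OF z(1,2)] v_nonzero[of i'] by (simp add: c_def norm_divide norm_power divide_le_eq)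
  then have "(1/2) *\<^sub>R z + (1/2) *\<^sub>R (c *s v i') \<in> K"
    using z(1) core_scale[OF v_in_core] by (intro convexD[OF convex_core]) auto
  moreover define y where "y = (1/2) *\<^sub>R z + (1/2) *\<^sub>R (c *s v i')"
  ultimately have yK: "y \<in> K" by simp
  have hy: "2 * hermitian_product y (v j) = hermitian_product z (v j) + c * hermitian_product (v i') (v j)" for j
    by (simp add: y_def scaleR_eq_vector_scalar_mult hermitian_product_left ring_distribs)
  show ?case
  proof (intro bexI[OF _ yK] conjI allI impI)
    fix j assume "i < j"
    show "hermitian_product y (v j) = 0"
    proof (cases "j = i'")
      case True
      have "2 * hermitian_product y (v j) = 0"
        unfolding hy True using v_nonzero[of i'] by (simp add: c_def hermitian_product_self)
      then show ?thesis by simp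
    next
      case False
      then have "i' < j" using ge[OF \<open>i < j\<close>] by simp
      then show ?thesis using hy[of j] z(2) orthogonal'[of i' j] by auto
    qed
  next
    fix j assume "j \<le> i"
    then have "j < i'" using i' by simp
    then have "2 * hermitian_product y (v j) = hermitian_product z (v j)"
      using hy[of j] orthogonal'[of i' j] by simp
    moreover have "2 ^ index_rank i * hermitian_product y (v j) = 2 ^ index_rank i' * (2 * hermitian_product y (v j))"
      by (simp add: rank)
    ultimately show "2 ^ index_rank i * hermitian_product y (v j) = hermitian_product x (v j)"
      using z(3)[of j] \<open>j < i'\<close> by simp
  qed
qed

lemma core_in_multiple_of_polydisc:
  assumes x: "x \<in> K"
  shows "cmod (hermitian_product x (v i)) < 2 ^ CARD('n) * (norm (v i))\<^sup>2"
proof -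
  obtain y where y: "y \<in> K" "\<And>j. i < j \<Longrightarrow> hermitian_product y (v j) = 0"
      "2 ^ index_rank i * hermitian_product y (v i) = hermitian_product x (v i)"
    using orthogonalised[OF x, of i] by blast
  have "index_rank i < CARD('n)" unfolding index_rank_def by (intro psubset_card_mono) auto
  then have lt: "(2::real) ^ index_rank i < 2 ^ CARD('n)" by simp
  have "cmod (hermitian_product x (v i)) = 2 ^ index_rank i * cmod (hermitian_product y (v i))"
    by (simp add: y(3)[symmetric] norm_mult norm_power)
  also have "\<dots> \<le> 2 ^ index_rank i * (norm (v i))\<^sup>2" using coordinate_bound[OF y(1,2)] by simp
  also have "\<dots> < 2 ^ CARD('n) * (norm (v i))\<^sup>2" using lt v_nonzero[of i] by simp
  finally show ?thesis .
qed


text \<open>In the orthogonal basis of the \<open>v i\<close>, which all lie in the core, the coefficients of \<open>z - q\<close> are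
  less than one in modulus. So \<open>z - q\<close> divided by their number is a convex combination of core
  vectors.\<close>

lemma polydisc_in_multiple_of_core:
  assumes U: "mcneal_coordinates q p U" and z: "z \<in> extremal_polydisc q p"
  shows "(1 / real CARD('n)) *\<^sub>R (z - q) \<in> K"
proof -
  obtain r :: "'n \<Rightarrow> real" where r: "\<And>i. U *v v i = axis i (of_real (r i))"
    using U unfolding mcneal_coordinates_def by metis
  define c where "c i = hermitian_product (z - q) (v i) / of_real ((norm (v i))\<^sup>2)" for i
  have uni: "unitary_matrix U" using U by (simp add: mcneal_coordinates_def)
  have coord: "hermitian_product w (v i) = (U *v w) $ i * of_real (r i)" for w i
    using hermitian_product_unitary[OF uni, of w "v i"] by (simp add: r hermitian_product_axis)
  have rsq: "of_real ((norm (v i))\<^sup>2) = (of_real (r i) :: complex) * of_real (r i)" for i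
    using coord[of "v i" i] by (simp add: r hermitian_product_self axis_def)
  have r0: "r i \<noteq> 0" for i using rsq[of i] v_nonzero[of i] by auto
  have "U *v (\<Sum>i\<in>UNIV. c i *s v i) = (\<Sum>i\<in>UNIV. c i *s axis i (of_real (r i)))"
    by (simp only: matrix_vector_mult_sum vector_scalar_commute r)
  also have "\<dots> = U *v (z - q)"
  proof -
    have "c i * of_real (r i) = (U *v (z - q)) $ i" for i
      using r0[of i] unfolding c_def coord rsq by simp
    then show ?thesis by (simp add: vec_eq_iff axis_def if_distrib cong: if_cong)
  qed
  finally have "z - q = (\<Sum>i\<in>UNIV. c i *s v i)"
    using uni unfolding unitary_matrix_def by (metis matrix_vector_mul_assoc matrix_vector_mul_lid)
  then have "(1 / real CARD('n)) *\<^sub>R (z - q) = (\<Sum>i\<in>UNIV. (1 / real CARD('n)) *\<^sub>R (c i *s v i))"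
    by (simp only: scaleR_sum_right)
  also have "\<dots> \<in> K"
  proof (rule convex_sum[OF finite convex_core])
    fix i
    have "cmod (hermitian_product (z - q) (v i)) < (norm (v i))\<^sup>2" using z by (simp add: extremal_polydisc_def)
    then have "cmod (c i) \<le> 1" using v_nonzero[of i] by (simp add: c_def norm_divide norm_power divide_le_eq)
    then show "c i *s v i \<in> K" using core_scale[OF v_in_core] by simp
  qed auto
  finally show ?thesis .
qed

lemma polydisc_eq:
  assumes U: "mcneal_coordinates q p U"
  shows "{z. \<forall>i. cmod ((U *v (z - q)) $ i) < dist q (p i)} = extremal_polydisc q p"
proof -
  obtain r :: "'n \<Rightarrow> real" where r: "\<And>i. U *v v i = axis i (of_real (r i))"
    using U unfolding mcneal_coordinates_def by metis
  have uni: "unitary_matrix U" using U by (simp add: mcneal_coordinates_def)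
  have coord: "hermitian_product w (v i) = (U *v w) $ i * of_real (r i)" for w i
    using hermitian_product_unitary[OF uni, of w "v i"] by (simp add: r hermitian_product_axis)
  have "of_real ((norm (v i))\<^sup>2) = (of_real ((r i)\<^sup>2) :: complex)" for i
    using coord[of "v i" i] by (simp add: r hermitian_product_self axis_def power2_eq_square)
  then have rsq: "(norm (v i))\<^sup>2 = (r i)\<^sup>2" for i using of_real_eq_iff by blast
  then have nr: "norm (v i) = \<bar>r i\<bar>" for i by (metis abs_norm_cancel real_sqrt_abs)
  have r0: "\<bar>r i\<bar> > 0" for i using nr[of i] v_nonzero[of i] by auto
  have "cmod (hermitian_product w (v i)) < (norm (v i))\<^sup>2 \<longleftrightarrow> cmod ((U *v w) $ i) < dist q (p i)" for w i
  proof -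
    have "dist q (p i) = \<bar>r i\<bar>" using nr[of i] by (simp add: dist_norm norm_minus_commute)
    then show ?thesis
      unfolding coord nr norm_mult norm_of_real power2_eq_square by (simp only: mult_less_cancel_right_pos[OF r0] \<open>dist q (p i) = \<bar>r i\<bar>\<close>)
  qed
  then show ?thesis by (simp add: extremal_polydisc_def)
qed

text \<open>The rows of the matrix are the conjugates of the normalised vectors \<open>v i\<close>.\<close>

lemma unitary_coordinates_exist: "\<exists>U. mcneal_coordinates q p U"
proof -
  define U :: "('n cspace, 'n) vec" where "U = (\<chi> i j. cnj (v i $ j) / of_real (norm (v i)))"
  have U: "(U *v w) $ i = hermitian_product w (v i) / of_real (norm (v i))" for w i
    by (simp add: U_def matrix_vector_mult_def hermitian_product_def sum_divide_distrib mult.commute)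
  have "U ** (\<chi> i j. cnj (U $ j $ i)) = mat 1"
  proof -
    have "(U ** (\<chi> i j. cnj (U $ j $ i))) $ i $ k = hermitian_product (v k) (v i) / of_real (norm (v i) * norm (v k))" for i k
      by (simp add: U_def matrix_matrix_mult_def hermitian_product_def sum_divide_distrib mult.commute)
    moreover have "hermitian_product (v k) (v i) / of_real (norm (v i) * norm (v k)) = (if i = k then 1 else 0)" for i k
      using orthogonal'[of k i] v_nonzero[of i] by (auto simp: hermitian_product_self power2_eq_square)
    ultimately show ?thesis by (simp add: vec_eq_iff mat_def)
  qed
  then have uni: "unitary_matrix U" unfolding unitary_matrix_def using matrix_left_right_inverse by blast
  have Uv: "U *v v i = axis i (of_real (norm (v i)))" for i
    using orthogonal'[of i] v_nonzero[of i]
    by (auto simp: vec_eq_iff U axis_def hermitian_product_self power2_eq_square)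
  have "(\<lambda>z. U *v (z - q)) ` complex_line q (p i) = range (axis i)" for i
  proof -
    have line: "U *v (c *s v i) = axis i (c * of_real (norm (v i)))" for c
      unfolding vector_scalar_commute Uv by (simp add: vec_eq_iff axis_def)
    have "(\<lambda>z. U *v (z - q)) ` complex_line q (p i) = range (\<lambda>c. axis i (c * of_real (norm (v i))))"
    proof -
      have "complex_line q (p i) = range (\<lambda>c. q + c *s v i)" by (auto simp: complex_line_def)
      then show ?thesis by (simp only: image_image add_diff_cancel_left' line)
    qed
    also have "\<dots> = range (axis i)"
    proof -
      have "axis i d = axis i (d / of_real (norm (v i)) * of_real (norm (v i)))" for d :: complex
        using v_nonzero[of i] by simp
      then show ?thesis by blast
    qed
    finally show ?thesis .
  qed
  then have "mcneal_coordinates q p U" unfolding mcneal_coordinates_def using uni Uv by blast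
  then show ?thesis by blast
qed

end

text \<open>At least one row of the square system, the one of index \<open>i\<close>, vanishes, so its kernel is nontrivial.\<close>

lemma orthogonal_vector_exists:
  fixes w :: "'n::{finite,linorder} \<Rightarrow> 'n cspace"
  shows "\<exists>x. x \<noteq> 0 \<and> (\<forall>j>i. hermitian_product x (w j) = 0)"
proof (rule ccontr)
  assume *: "\<not> ?thesis"
  define A :: "('n cspace, 'n) vec" where "A = (\<chi> k j. if i < k then cnj (w k $ j) else 0)"
  have Ax: "(A *v x) $ k = (if i < k then hermitian_product x (w k) else 0)" for x k
    by (simp add: A_def matrix_vector_mult_def hermitian_product_def mult.commute)
  have "x = 0" if "A *v x = 0" for x
  proof -
    have "hermitian_product x (w j) = 0" if "i < j" for j
      using that Ax[of x j] \<open>A *v x = 0\<close> by simp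
    then show ?thesis using * by blast
  qed
  then obtain B where "B ** A = mat 1" using matrix_left_invertible_ker by metis
  then have "A ** B = mat 1" using matrix_left_right_inverse by metis
  then have "(A ** B) $ i $ i = 1" by (simp add: mat_def)
  then show False by (simp add: matrix_matrix_mult_def A_def)
qed

lemma orthogonal_lines_cong:
  assumes "\<And>j. i < j \<Longrightarrow> p j = p' j" shows "orthogonal_lines q p i = orthogonal_lines q p' i"
proof -
  have "(\<forall>j>i. hermitian_product v (p j - q) = 0) = (\<forall>j>i. hermitian_product v (p' j - q) = 0)" for v
    using assms by auto
  then show ?thesis by (simp add: orthogonal_lines_def)
qed

context pointed_convex_domain
begin

lemma nearest_frontier_point_on_line:
  assumes "x \<noteq> 0"
  shows "\<exists>r\<in>frontier \<Omega>. complex_line q r = complex_line q (q + x) \<and> dist q r = distance_along \<Omega> q (complex_line q r)"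
proof -
  let ?S = "complex_line q (q + x) \<inter> frontier \<Omega>"
  have ne: "?S \<noteq> {}" by (rule line_meets_frontier[OF assms])
  have "complex_line q (q + x) = (\<lambda>c. q + c *s x) ` UNIV" by (auto simp: complex_line_add)
  moreover have "closed ((\<lambda>c. q + c *s x) ` UNIV)"
  proof -
    have "linear (\<lambda>c. c *s x)" using bounded_linear_vector_scalar_mult_left bounded_linear.linear by blast
    then have "subspace ((\<lambda>c. c *s x) ` UNIV)" using subspace_UNIV linear_subspace_image by blast
    then have "closed ((\<lambda>y. q + y) ` ((\<lambda>c. c *s x) ` UNIV))" by (intro closed_translation closed_subspace)
    then show ?thesis by (simp add: image_image)
  qed
  ultimately have "closed ?S" by (simp add: closed_Int)
  then obtain r where r: "r \<in> ?S" "infdist q ?S = dist q r"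
    using infdist_attains_inf[OF _ ne] by metis
  obtain c where c: "r = q + c *s x" using r(1) by (auto simp: complex_line_add)
  have "c \<noteq> 0" using r(1) c base_point open_domain by (auto simp: frontier_def interior_open)
  then have "complex_line q r = complex_line q (q + x)" unfolding c by (rule complex_line_rescale)
  then show ?thesis using r by (auto simp: distance_along_def)
qed

end

text \<open>The longest vector in the intersection of the compact core with the orthogonal complement.\<close>

lemma longest_orthogonal_line_exists:
  fixes \<Omega> :: "('n::{finite,linorder}) cspace set"
  assumes "pointed_convex_domain \<Omega> q"
  shows "\<exists>r\<in>frontier \<Omega>. is_arg_max (distance_along \<Omega> q) (\<lambda>L. L \<in> orthogonal_lines q p i) (complex_line q r) \<and>
    dist q r = distance_along \<Omega> q (complex_line q r)"
proof -
  interpret pointed_convex_domain \<Omega> q by fact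
  define S where "S = K \<inter> {x. \<forall>j>i. hermitian_product x (p j - q) = 0}"
  have lim: "closed {x. hermitian_product x w = 0}" for w :: "'n cspace"
    unfolding hermitian_product_def by (intro closed_Collect_eq continuous_intros)
  have "{x. \<forall>j>i. hermitian_product x (p j - q) = 0} = (\<Inter>j\<in>{i<..}. {x. hermitian_product x (p j - q) = 0})" by auto
  then have "closed S" unfolding S_def by (auto intro!: closed_Int closed_INT closed_core lim)
  then have comp: "compact S"
    unfolding S_def compact_eq_bounded_closed using bounded_core by (auto intro: bounded_subset)
  obtain y where y: "y \<noteq> 0" "\<forall>j>i. hermitian_product y (p j - q) = 0"
    using orthogonal_vector_exists[of i "\<lambda>j. p j - q"] by blast
  obtain e where e: "e > 0" "\<And>x. norm x < e \<Longrightarrow> x \<in> K" using small_in_core by blast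
  define y' where "y' = of_real (e / 2 / norm y) *s y"
  have y': "y' \<in> S" "norm y' > 0"
    using e y by (auto simp: S_def y'_def norm_vector_scalar_mult hermitian_product_left norm_divide intro!: e(2))
  have "\<exists>x\<in>S. \<forall>y\<in>S. norm y \<le> norm x"
    using y' by (intro continuous_attains_sup[OF comp]) (auto intro!: continuous_intros)
  then obtain x where x: "x \<in> S" "\<And>y. y \<in> S \<Longrightarrow> norm y \<le> norm x" by blast
  have x0: "x \<noteq> 0" using x(2)[OF y'(1)] y'(2) by auto
  have mem: "complex_line q (q + x) \<in> orthogonal_lines q p i"
    using x(1) x0 by (auto simp: orthogonal_lines_def S_def)
  have le: "distance_along \<Omega> q L \<le> norm x" if L: "L \<in> orthogonal_lines q p i" for L
  proof -
    obtain w where w: "L = complex_line q (q + w)" "w \<noteq> 0" "\<forall>j>i. hermitian_product w (p j - q) = 0"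
      using L by (auto simp: orthogonal_lines_def)
    define t where "t = distance_along \<Omega> q L"
    have t0: "t \<ge> 0" by (simp add: t_def distance_along_def infdist_nonneg)
    show ?thesis
    proof (cases "t = 0")
      case False
      define w' where "w' = of_real (t / norm w) *s w"
      have nw': "norm w' = t" using w(2) t0 by (simp add: w'_def norm_vector_scalar_mult norm_divide)
      have "complex_line q (q + w') = L"
        unfolding w(1) w'_def using False w(2) by (intro complex_line_rescale) auto
      then have "w' \<in> K" using nw' False by (intro core_of_distance_along) (auto simp: t_def)
      then have "w' \<in> S" using w(3) by (simp add: S_def w'_def hermitian_product_left)
      then show ?thesis using x(2)[of w'] nw' by (simp add: t_def)
    qed (simp add: t_def)
  qed
  have ge: "norm x \<le> distance_along \<Omega> q (complex_line q (q + x))"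
    using x(1) x0 by (intro norm_le_distance_along) (auto simp: S_def)
  have "is_arg_max (distance_along \<Omega> q) (\<lambda>L. L \<in> orthogonal_lines q p i) (complex_line q (q + x))"
    unfolding is_arg_max_def using mem le ge by (meson dual_order.trans not_le)
  then show ?thesis using nearest_frontier_point_on_line[OF x0] by metis
qed

text \<open>The condition on \<open>p i\<close> refers to \<open>p j\<close> for \<open>j > i\<close> only, so the points can be chosen by recursion
  from the largest index downwards.\<close>

lemma mcneal_points_exist:
  fixes \<Omega> :: "('n::{finite,linorder}) cspace set"
  assumes dom: "pointed_convex_domain \<Omega> q"
  shows "\<exists>p. mcneal_points \<Omega> q p"
proof -
  interpret pointed_convex_domain \<Omega> q by fact
  let ?P = "\<lambda>p i r. r \<in> frontier \<Omega> \<and> (i = Max UNIV \<longrightarrow> dist q r = infdist q (frontier \<Omega>)) \<and>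
    (i \<noteq> Max UNIV \<longrightarrow> is_arg_max (distance_along \<Omega> q) (\<lambda>L. L \<in> orthogonal_lines q p i) (complex_line q r) \<and>
        dist q r = distance_along \<Omega> q (complex_line q r))"
  have "\<exists>p. \<forall>i. ?P p i (p i)"
  proof (rule dependent_wf_choice)
    show "wf {(y, x). (x :: 'n) < y}"
    proof (rule wf_subset[OF wf_measure[of index_rank]])
      show "{(y, x). (x :: 'n) < y} \<subseteq> Wellfounded.measure index_rank"
        by (auto simp: index_rank_def intro!: psubset_card_mono)
    qed
  next
    fix p p' :: "'n \<Rightarrow> 'n cspace" and i r
    assume "\<And>z. (z, i) \<in> {(y, x). x < y} \<Longrightarrow> p z = p' z"
    then have "orthogonal_lines q p i = orthogonal_lines q p' i" by (intro orthogonal_lines_cong) auto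
    then show "?P p i r = ?P p' i r" by simp
  next
    fix i p
    show "\<exists>r. ?P p i r"
    proof (cases "i = Max UNIV")
      case True
      have "frontier \<Omega> \<noteq> {}" using line_meets_frontier[of "axis i 1"] by (auto simp: axis_eq_0_iff)
      then obtain r where "r \<in> frontier \<Omega>" "infdist q (frontier \<Omega>) = dist q r"
        using infdist_attains_inf[OF frontier_closed] by metis
      then show ?thesis using True by (intro exI[of _ r]) auto
    next
      case False
      then show ?thesis using longest_orthogonal_line_exists[OF dom, of p i] by metis
    qed
  qed
  then show ?thesis unfolding mcneal_points_def by metis
qed

lemma mcneal_polydiscs_nonempty:
  assumes "pointed_convex_domain (mcneal_domain \<rho> q \<epsilon>) q"
  shows "mcneal_polydiscs \<rho> q \<epsilon> \<noteq> {}"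
proof -
  obtain p where p: "mcneal_points (mcneal_domain \<rho> q \<epsilon>) q p" using mcneal_points_exist[OF assms] by blast
  then interpret mcneal_basis "mcneal_domain \<rho> q \<epsilon>" q p
    using assms by (simp add: mcneal_basis_def mcneal_basis_axioms_def)
  show ?thesis using p unitary_coordinates_exist unfolding mcneal_polydiscs_def by blast
qed

text \<open>All that the inclusions between polydiscs and Kobayashi balls require of McNeal's construction.\<close>

lemma mcneal_polydisc_core:
  fixes \<rho> :: "('n::{finite,linorder}) cspace \<Rightarrow> real"
  assumes dom: "pointed_convex_domain (mcneal_domain \<rho> q \<epsilon>) q" and P: "P \<in> mcneal_polydiscs \<rho> q \<epsilon>"
  shows mcneal_polydisc_in_multiple_of_core:
      "z \<in> P \<Longrightarrow> (1 / real CARD('n)) *\<^sub>R (z - q) \<in> balanced_core (mcneal_domain \<rho> q \<epsilon>) q"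
    and core_in_multiple_of_mcneal_polydisc:
      "2 ^ CARD('n) *\<^sub>R (z - q) \<in> balanced_core (mcneal_domain \<rho> q \<epsilon>) q \<Longrightarrow> z \<in> P"
proof -
  obtain p U where pU: "mcneal_points (mcneal_domain \<rho> q \<epsilon>) q p" "mcneal_coordinates q p U"
      "P = {z. \<forall>i. cmod ((U *v (z - q)) $ i) < dist q (p i)}"
    using P by (auto simp: mcneal_polydiscs_def)
  interpret mcneal_basis "mcneal_domain \<rho> q \<epsilon>" q p
    using dom pU(1) by (simp add: mcneal_basis_def mcneal_basis_axioms_def)
  have P_eq: "P = extremal_polydisc q p" using pU(3) polydisc_eq[OF pU(2)] by simp
  show "z \<in> P \<Longrightarrow> (1 / real CARD('n)) *\<^sub>R (z - q) \<in> K"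
    using polydisc_in_multiple_of_core[OF pU(2)] P_eq by simp
  show "z \<in> P" if "2 ^ CARD('n) *\<^sub>R (z - q) \<in> K"
  proof -
    have "cmod (hermitian_product (2 ^ CARD('n) *\<^sub>R (z - q)) (v i)) = 2 ^ CARD('n) * cmod (hermitian_product (z - q) (v i))" for i
      unfolding scaleR_eq_vector_scalar_mult hermitian_product_left by (simp add: norm_mult norm_power)
    then show ?thesis using core_in_multiple_of_polydisc[OF that] P_eq by (simp add: extremal_polydisc_def)
  qed
qed

section \<open>The Kobayashi metric and distance of a convex domain\<close>

abbreviation inverse_disc_radii :: "(complex ^ 'n) set \<Rightarrow> complex ^ 'n \<Rightarrow> complex ^ 'n \<Rightarrow> real set" where
  "inverse_disc_radii D z \<xi> \<equiv> {1 / \<alpha> |\<alpha>. \<alpha> > 0 \<and>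
     (\<exists>f. (\<forall>i. (\<lambda>\<zeta>. f \<zeta> $ i) holomorphic_on ball 0 1) \<and> f ` ball 0 1 \<subseteq> D \<and>
          f 0 = z \<and> (\<forall>i. deriv (\<lambda>\<zeta>. f \<zeta> $ i) 0 = of_real \<alpha> * \<xi> $ i))}"

lemma inverse_disc_radius:
  assumes "s > 0" "\<And>\<zeta>. cmod \<zeta> < 1 \<Longrightarrow> z + (of_real s * \<zeta>) *s \<xi> \<in> D"
  shows "1 / s \<in> inverse_disc_radii D z \<xi>"
proof -
  let ?f = "\<lambda>\<zeta>. z + (of_real s * \<zeta>) *s \<xi>"
  have "((\<lambda>\<zeta>. ?f \<zeta> $ i) has_field_derivative of_real s * \<xi> $ i) (at 0)" for i
    by (auto intro!: derivative_eq_intros)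
  then have "deriv (\<lambda>\<zeta>. ?f \<zeta> $ i) 0 = of_real s * \<xi> $ i" for i by (rule DERIV_imp_deriv)
  moreover have "(\<lambda>\<zeta>. ?f \<zeta> $ i) holomorphic_on ball 0 1" for i by (auto intro!: holomorphic_intros)
  moreover have "?f ` ball 0 1 \<subseteq> D" using assms(2) by auto
  moreover have "?f 0 = z" by simp
  ultimately show ?thesis
    using assms(1) by (intro CollectI exI[of _ s] conjI refl exI[of _ ?f] allI)
qed

lemma kobayashi_metric_le:
  assumes "s > 0" "\<And>\<zeta>. cmod \<zeta> < 1 \<Longrightarrow> z + (of_real s * \<zeta>) *s \<xi> \<in> D"
  shows "kobayashi_metric D z \<xi> \<le> 1 / s"
  unfolding kobayashi_metric_def
  by (rule cInf_lower[OF inverse_disc_radius[OF assms]]) (auto intro!: bdd_belowI[of _ 0])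

text \<open>Composing with the Cayley transform of the half-plane that sends \<open>h 0\<close> to the origin reduces this
  to the Schwarz lemma.\<close>

lemma half_plane_schwarz_pick:
  assumes h: "h holomorphic_on ball 0 1" and re: "\<And>\<zeta>. \<zeta> \<in> ball 0 1 \<Longrightarrow> Re (h \<zeta>) < b"
  shows "cmod (deriv h 0) \<le> 2 * (b - Re (h 0))"
proof -
  define u where "u = b - Re (h 0)"
  have u: "u > 0" using re[of 0] by (simp add: u_def)
  define d where "d = (\<lambda>\<zeta>. (of_real b - h \<zeta>) + cnj (of_real b - h 0))"
  have Re_d: "Re (d \<zeta>) > 0" if "\<zeta> \<in> ball 0 1" for \<zeta>
    using re[OF that] u by (simp add: d_def u_def)
  then have dnz: "d \<zeta> \<noteq> 0" if "\<zeta> \<in> ball 0 1" for \<zeta> using that by force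
  define \<phi> where "\<phi> = (\<lambda>\<zeta>. (h \<zeta> - h 0) / d \<zeta>)"
  have hol_d: "d holomorphic_on ball 0 1" unfolding d_def by (intro holomorphic_intros h)
  have hol: "\<phi> holomorphic_on ball 0 1"
    unfolding \<phi>_def using dnz by (intro holomorphic_intros h hol_d) auto
  have lt: "cmod (\<phi> \<zeta>) < 1" if "cmod \<zeta> < 1" for \<zeta>
  proof -
    define w w0 where "w = of_real b - h \<zeta>" and "w0 = of_real b - h 0"
    have "Re w > 0" "Re w0 > 0" using re[of \<zeta>] re[of 0] that by (auto simp: w_def w0_def)
    then have "Re w * Re w0 > 0" by simp
    then have "(cmod (w - w0))\<^sup>2 < (cmod (w + cnj w0))\<^sup>2"
      unfolding cmod_power2 by (simp add: power2_eq_square algebra_simps)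
    then have "cmod (w - w0) < cmod (w + cnj w0)" by (rule power2_less_imp_less) simp
    moreover have "h \<zeta> - h 0 = - (w - w0)" by (simp add: w_def w0_def)
    ultimately show ?thesis
      using dnz[of \<zeta>] that unfolding \<phi>_def d_def w_def w0_def by (simp add: norm_divide norm_minus_commute divide_less_eq)
  qed
  have h': "(h has_field_derivative deriv h 0) (at 0)"
    using h by (intro holomorphic_derivI[of h "ball 0 1"]) auto
  have d': "(d has_field_derivative - deriv h 0) (at 0)"
    unfolding d_def by (auto intro!: derivative_eq_intros h')
  have d0: "d 0 = of_real (2 * u)" by (simp add: d_def u_def complex_eq_iff)
  have "(\<phi> has_field_derivative deriv h 0 / d 0) (at 0)"
    unfolding \<phi>_def using dnz[of 0] by (auto intro!: derivative_eq_intros h' d' simp: divide_simps)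
  then have "deriv \<phi> 0 = deriv h 0 / d 0" by (rule DERIV_imp_deriv)
  moreover have "cmod (deriv \<phi> 0) \<le> 1"
    by (rule Schwarz_Lemma(2)[OF hol _ lt, of 0]) (auto simp: \<phi>_def)
  ultimately show ?thesis using u by (simp add: d0 norm_divide norm_mult divide_le_eq flip: u_def)
qed

text \<open>The functional maps holomorphic discs in \<open>D\<close> to holomorphic discs in a half-plane.\<close>

lemma kobayashi_metric_ge:
  assumes D: "open D" "z \<in> D" and half: "\<And>x. x \<in> D \<Longrightarrow> Re (hermitian_product x a) < b"
  shows "cmod (hermitian_product \<xi> a) / (2 * (b - Re (hermitian_product z a))) \<le> kobayashi_metric D z \<xi>"
  unfolding kobayashi_metric_def
proof (rule cInf_greatest)
  obtain e where e: "e > 0" "ball z e \<subseteq> D" using D open_contains_ball by blast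
  define s where "s = e / (1 + norm \<xi>)"
  have s: "s > 0" using e by (simp add: s_def add_pos_nonneg)
  have "z + (of_real s * \<zeta>) *s \<xi> \<in> D" if "cmod \<zeta> < 1" for \<zeta>
  proof -
    have "norm ((of_real s * \<zeta>) *s \<xi>) \<le> s * norm \<xi>"
      using that s by (auto simp: norm_vector_scalar_mult norm_mult intro!: mult_left_le_one_le)
    also have "\<dots> < s * (1 + norm \<xi>)" using s by simp
    also have "\<dots> = e" by (simp add: s_def add_nonneg_eq_0_iff add_pos_nonneg less_imp_neq[symmetric])
    finally show ?thesis using e by (auto simp: dist_norm)
  qed
  from inverse_disc_radius[OF s this]
  show "inverse_disc_radii D z \<xi> \<noteq> {}" by blast
next
  fix x assume "x \<in> inverse_disc_radii D z \<xi>"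
  then obtain \<alpha> f where f: "x = 1 / \<alpha>" "\<alpha> > 0" "\<And>i. (\<lambda>\<zeta>. f \<zeta> $ i) holomorphic_on ball 0 1"
      "f ` ball 0 1 \<subseteq> D" "f 0 = z" "\<And>i. deriv (\<lambda>\<zeta>. f \<zeta> $ i) 0 = of_real \<alpha> * \<xi> $ i" by blast
  define h where "h = (\<lambda>\<zeta>. hermitian_product (f \<zeta>) a)"
  have hol: "h holomorphic_on ball 0 1"
    unfolding h_def hermitian_product_def by (intro holomorphic_intros f(3))
  have der: "((\<lambda>\<zeta>. f \<zeta> $ i) has_field_derivative of_real \<alpha> * \<xi> $ i) (at 0)" for i
    using holomorphic_derivI[OF f(3)[of i] open_ball, of 0] by (simp add: f(6))
  have "(h has_field_derivative (\<Sum>i\<in>UNIV. of_real \<alpha> * \<xi> $ i * cnj (a $ i))) (at 0)"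
    unfolding h_def hermitian_product_def by (intro DERIV_sum DERIV_cmult_right der)
  then have "deriv h 0 = of_real \<alpha> * hermitian_product \<xi> a"
    by (simp add: DERIV_imp_deriv hermitian_product_def sum_distrib_left mult.assoc)
  moreover have "cmod (deriv h 0) \<le> 2 * (b - Re (h 0))"
    using f(4) by (intro half_plane_schwarz_pick hol) (auto simp: h_def intro!: half)
  ultimately have le: "\<alpha> * cmod (hermitian_product \<xi> a) \<le> 2 * (b - Re (hermitian_product z a))"
    using f(2,5) by (simp add: h_def norm_mult)
  show "cmod (hermitian_product \<xi> a) / (2 * (b - Re (hermitian_product z a))) \<le> x"
    (is "?h / ?u \<le> x")
  proof -
    have u: "?u > 0" using half[OF D(2)] by simp
    have "?h \<le> ?u / \<alpha>" using f(2) le by (simp add: pos_le_divide_eq mult.commute)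
    then have "?h / ?u \<le> (?u / \<alpha>) / ?u" using u by (intro divide_right_mono) auto
    then show ?thesis using u f(1) by simp
  qed
qed

text \<open>The derivative of \<open>\<phi>\<close> is a priori only Henstock-Kurzweil integrable. This gives its
  measurability, and the finite length then makes it Lebesgue integrable.\<close>

lemma norm_increment_le_length:
  fixes \<phi> :: "real \<Rightarrow> 'a::euclidean_space"
  assumes cont: "continuous_on {0..1} \<phi>" and S: "finite S" "\<And>t. t \<in> {0..1} - S \<Longrightarrow> \<phi> differentiable (at t)"
    and len: "(\<integral>\<^sup>+t\<in>{0..1}. ennreal (norm (vector_derivative \<phi> (at t))) \<partial>lborel) \<le> ennreal A" and A: "A \<ge> 0"
  shows "norm (\<phi> 1 - \<phi> 0) \<le> A"
proof -
  let ?d = "\<lambda>t. vector_derivative \<phi> (at t)"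
  let ?g = "\<lambda>t. indicator {0..1} t *\<^sub>R ?d t"
  have int: "(?d has_integral (\<phi> 1 - \<phi> 0)) {0..1}"
    using cont S by (intro fundamental_theorem_of_calculus_strong[of S]) (auto simp: vector_derivative_works[symmetric])
  have meas: "?g \<in> borel_measurable lebesgue" by (rule has_integral_implies_lebesgue_measurable[OF int])
  have le: "(\<integral>\<^sup>+t. ennreal (norm (?g t)) \<partial>lebesgue) \<le> ennreal A"
  proof -
    have "(\<integral>\<^sup>+t. ennreal (norm (?g t)) \<partial>lebesgue) = (\<integral>\<^sup>+t. ennreal (norm (?g t)) \<partial>lborel)"
      by (rule nn_integral_completion)
    also have "\<dots> = (\<integral>\<^sup>+t\<in>{0..1}. ennreal (norm (?d t)) \<partial>lborel)"
      by (intro nn_integral_cong) (auto simp: indicator_def)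
    finally show ?thesis using len by simp
  qed
  have ig: "integrable lebesgue ?g"
    using meas le by (intro integrableI_bounded) (auto simp: top_unique intro: le_less_trans)
  have "(?g has_integral (LINT t|lebesgue. ?g t)) UNIV" by (rule has_integral_integral_lebesgue[OF ig])
  moreover have "(?g has_integral (\<phi> 1 - \<phi> 0)) UNIV"
  proof -
    have "?g = (\<lambda>t. if t \<in> {0..1} then ?d t else 0)" by (auto simp: fun_eq_iff indicator_def)
    then show ?thesis using int has_integral_restrict_UNIV[of "{0..1}" ?d] by simp
  qed
  ultimately have "\<phi> 1 - \<phi> 0 = (LINT t|lebesgue. ?g t)" by (rule has_integral_unique[symmetric])
  then have "ennreal (norm (\<phi> 1 - \<phi> 0)) \<le> (\<integral>\<^sup>+t. ennreal (norm (?g t)) \<partial>lebesgue)"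
    using integral_norm_bound_ennreal[OF ig] by simp
  then show ?thesis using le A by (meson ennreal_le_iff order_trans)
qed

text \<open>Up to a constant, \<open>x \<mapsto> b - \<langle>x, a\<rangle>\<close> maps \<open>D\<close> to the right half-plane, where the derivative of the
  logarithm along the image of a curve is at most twice the Kobayashi length of the velocity of
  the curve.\<close>

lemma kobayashi_ball_in_half_space:
  assumes D: "open D" "q \<in> D" and half: "\<And>x. x \<in> D \<Longrightarrow> Re (hermitian_product x a) < b"
    and z: "z \<in> kobayashi_ball D q R" and R: "R > 0"
  shows "cmod (hermitian_product z a - hermitian_product q a) \<le> (exp (2 * R) + 1) * (b - Re (hermitian_product q a))"
proof -
  have "kobayashi_dist D q z < ennreal R" using z by (simp add: kobayashi_ball_def)
  then obtain \<gamma> where \<gamma>: "\<gamma> piecewise_differentiable_on {0..1}" "\<gamma> ` {0..1} \<subseteq> D" "\<gamma> 0 = q" "\<gamma> 1 = z"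
      "kobayashi_length D \<gamma> < ennreal R"
    by (auto simp: kobayashi_dist_def Inf_less_iff)
  obtain S where S: "finite S" "\<And>t. t \<in> {0..1} - S \<Longrightarrow> \<gamma> differentiable (at t within {0..1})"
    using \<gamma>(1) by (auto simp: piecewise_differentiable_on_def)
  define l where "l x = hermitian_product x a" for x
  \<comment> \<open>The imaginary part makes the image of \<open>q\<close> real, so that its modulus is the distance to the boundary line.\<close>
  define \<beta> where "\<beta> = Complex b (Im (l q))"
  define \<phi> where "\<phi> t = (1/2) *\<^sub>R Ln (\<beta> - l (\<gamma> t))" for t
  have bl: "bounded_linear l"
  proof -
    have "linear l" by (rule linearI) (auto simp: l_def hermitian_product_left scaleR_eq_vector_scalar_mult scaleR_conv_of_real)
    then show ?thesis by (simp add: linear_conv_bounded_linear)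
  qed
  have pos: "Re (\<beta> - l (\<gamma> t)) = b - Re (l (\<gamma> t))" "b - Re (l (\<gamma> t)) > 0" if "t \<in> {0..1}" for t
    using half[OF subsetD[OF \<gamma>(2) imageI[OF that]]] by (auto simp: \<beta>_def l_def)
  have slit: "\<beta> - l (\<gamma> t) \<notin> \<real>\<^sub>\<le>\<^sub>0" if "t \<in> {0..1}" for t
    using pos[OF that] by (auto simp: complex_nonpos_Reals_iff)
  have nz: "\<beta> - l (\<gamma> t) \<noteq> 0" if "t \<in> {0..1}" for t using slit[OF that] by auto
  have cont: "continuous_on {0..1} \<phi>"
    unfolding \<phi>_def using slit piecewise_differentiable_on_imp_continuous_on[OF \<gamma>(1)]
    by (intro continuous_intros bounded_linear.continuous_on[OF bl]) auto
  let ?S = "S \<union> {0, 1}"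
  have der: "(\<phi> has_vector_derivative - (1/2) *\<^sub>R (l (vector_derivative \<gamma> (at t)) / (\<beta> - l (\<gamma> t)))) (at t)"
    if t: "t \<in> {0..1} - ?S" for t
  proof -
    have "\<gamma> differentiable (at t within {0..1})" using S t by auto
    then have "\<gamma> differentiable (at t)" using t by (subst (asm) at_within_interior) auto
    then have "(\<gamma> has_vector_derivative vector_derivative \<gamma> (at t)) (at t)" by (simp add: vector_derivative_works)
    from has_vector_derivative_diff[OF has_vector_derivative_const bounded_linear.has_vector_derivative[OF bl this]]
    have 1: "((\<lambda>t. \<beta> - l (\<gamma> t)) has_vector_derivative - l (vector_derivative \<gamma> (at t))) (at t)"
      by simp
    have "(Ln has_field_derivative inverse (\<beta> - l (\<gamma> t))) (at (\<beta> - l (\<gamma> t)))"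
      using slit t by (intro has_field_derivative_Ln) auto
    from field_vector_diff_chain_at[OF 1 this]
    have "((\<lambda>t. Ln (\<beta> - l (\<gamma> t))) has_vector_derivative - l (vector_derivative \<gamma> (at t)) * inverse (\<beta> - l (\<gamma> t))) (at t)"
      by (simp add: o_def)
    from bounded_linear.has_vector_derivative[OF bounded_linear_scaleR_right this, of "1/2"]
    show ?thesis unfolding \<phi>_def by (simp add: field_simps)
  qed
  have "norm (\<phi> 1 - \<phi> 0) \<le> R"
  proof (rule norm_increment_le_length[OF cont])
    show "finite ?S" using S by simp
    show "\<phi> differentiable at t" if "t \<in> {0..1} - ?S" for t
      using der[OF that] by (rule differentiableI_vector)
    have "(\<integral>\<^sup>+t\<in>{0..1}. ennreal (norm (vector_derivative \<phi> (at t))) \<partial>lborel) \<le> kobayashi_length D \<gamma>"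
      unfolding kobayashi_length_def
    proof (rule nn_integral_mono_AE)
      have "AE t in lborel. t \<notin> ?S"
        using S(1) by (intro AE_not_in finite_imp_null_set_lborel) auto
      then show "AE t in lborel. ennreal (norm (vector_derivative \<phi> (at t))) * indicator {0..1} t
          \<le> ennreal (kobayashi_metric D (\<gamma> t) (vector_derivative \<gamma> (at t))) * indicator {0..1} t"
      proof eventually_elim
        case (elim t)
        show ?case
        proof (cases "t \<in> {0..1}")
          case True
          then have t: "t \<in> {0..1} - ?S" using elim by blast
          have "norm (vector_derivative \<phi> (at t)) = cmod (l (vector_derivative \<gamma> (at t))) / (2 * cmod (\<beta> - l (\<gamma> t)))"
            using vector_derivative_at[OF der[OF t]] by (simp add: norm_divide)
          also have "\<dots> \<le> cmod (l (vector_derivative \<gamma> (at t))) / (2 * (b - Re (l (\<gamma> t))))"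
            using pos[OF True] complex_Re_le_cmod[of "\<beta> - l (\<gamma> t)"] by (intro divide_left_mono mult_pos_pos) auto
          also have "\<dots> \<le> kobayashi_metric D (\<gamma> t) (vector_derivative \<gamma> (at t))"
            unfolding l_def using True \<gamma>(2) by (intro kobayashi_metric_ge half D(1)) auto
          finally show ?thesis by (intro mult_right_mono ennreal_leI) auto
        qed simp
      qed
    qed
    also have "\<dots> \<le> ennreal R" using \<gamma>(5) by simp
    finally show "(\<integral>\<^sup>+t\<in>{0..1}. ennreal (norm (vector_derivative \<phi> (at t))) \<partial>lborel) \<le> ennreal R" .
  qed (use R in auto)
  moreover have "\<phi> 1 - \<phi> 0 = (1/2) *\<^sub>R (Ln (\<beta> - l z) - Ln (\<beta> - l q))" by (simp add: \<phi>_def \<gamma> scaleR_diff_right)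
  ultimately have "cmod (Ln (\<beta> - l z) - Ln (\<beta> - l q)) \<le> 2 * R" by simp
  then have "Re (Ln (\<beta> - l z)) \<le> 2 * R + Re (Ln (\<beta> - l q))"
    using complex_Re_le_cmod[of "Ln (\<beta> - l z) - Ln (\<beta> - l q)"] by simp
  moreover have "\<beta> - l z \<noteq> 0" "\<beta> - l q \<noteq> 0" using nz[of 0] nz[of 1] \<gamma> by auto
  ultimately have "ln (cmod (\<beta> - l z)) \<le> 2 * R + ln (cmod (\<beta> - l q))" by (simp add: Re_Ln)
  then have "cmod (\<beta> - l z) \<le> exp (2 * R) * cmod (\<beta> - l q)"
    using \<open>\<beta> - l z \<noteq> 0\<close> \<open>\<beta> - l q \<noteq> 0\<close>
    by (metis exp_add exp_le_cancel_iff exp_ln zero_less_norm_iff)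
  moreover have "\<beta> - l q = of_real (b - Re (l q))" by (simp add: \<beta>_def complex_eq_iff)
  then have "cmod (\<beta> - l q) = b - Re (l q)" using pos(2)[of 0] \<gamma> by (metis abs_of_pos atLeastAtMost_iff norm_of_real order_refl zero_le_one)
  moreover have "cmod (l z - l q) \<le> cmod (\<beta> - l z) + cmod (\<beta> - l q)"
    using norm_triangle_ineq4[of "\<beta> - l q" "\<beta> - l z"] by simp
  ultimately show ?thesis by (simp add: l_def ring_distribs)
qed

text \<open>If a point of the disc were outside the closure of \<open>D\<close>, a half-space containing \<open>D\<close> would
  separate it from \<open>D\<close>, against the previous estimate.\<close>

lemma kobayashi_ball_in_multiple_of_core:
  assumes D: "open D" "convex D" "q \<in> D" and z: "z \<in> kobayashi_ball D q R" and R: "R > 0"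
  shows "(1 / (exp (2 * R) + 1)) *\<^sub>R (z - q) \<in> balanced_core D q"
  unfolding balanced_core_def
proof safe
  fix c :: complex assume c: "cmod c \<le> 1"
  define M where "M = exp (2 * R) + 1"
  have M: "M > 0" by (simp add: M_def add_pos_pos)
  let ?y = "q + c *s ((1 / M) *\<^sub>R (z - q))"
  show "q + c *s ((1 / (exp (2 * R) + 1)) *\<^sub>R (z - q)) \<in> closure D"
  proof (rule ccontr)
    assume "q + c *s ((1 / (exp (2 * R) + 1)) *\<^sub>R (z - q)) \<notin> closure D"
    then have "?y \<notin> closure D" by (simp add: M_def)
    then obtain a b where ab: "a \<bullet> ?y < b" "\<And>x. x \<in> closure D \<Longrightarrow> a \<bullet> x > b"
      using separating_hyperplane_closed_point[of "closure D" ?y] D(2) convex_closure by blast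
    define l where "l x = hermitian_product x (- a)" for x
    have Re_l: "Re (l x) = - (a \<bullet> x)" for x by (simp add: l_def Re_hermitian_product inner_commute)
    have "cmod (l z - l q) \<le> M * (- b - Re (l q))"
      unfolding l_def M_def
    proof (rule kobayashi_ball_in_half_space[OF D(1,3) _ z R])
      fix x assume "x \<in> D"
      then show "Re (hermitian_product x (- a)) < - b"
        using ab(2)[of x] closure_subset[of D] Re_l[of x] by (auto simp: l_def)
    qed
    moreover have "l ?y - l q = (c / of_real M) * (l z - l q)"
      by (simp add: l_def hermitian_product_left scaleR_eq_vector_scalar_mult right_diff_distrib diff_divide_distrib)
    then have "cmod (l ?y - l q) = cmod c * (cmod (l z - l q) / M)" using M by (simp add: norm_mult norm_divide)
    moreover have "cmod c * (cmod (l z - l q) / M) \<le> cmod (l z - l q) / M"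
      using c M by (intro mult_left_le_one_le) auto
    moreover have "cmod (l z - l q) / M \<le> - b - Re (l q)"
      if "cmod (l z - l q) \<le> M * (- b - Re (l q))" using that M by (simp add: pos_divide_le_eq mult.commute)
    ultimately have "cmod (l ?y - l q) \<le> - b - Re (l q)" by linarith
    then have "Re (l ?y) \<le> - b" using complex_Re_le_cmod[of "l ?y - l q"] by simp
    then show False using ab(1) by (simp add: Re_l)
  qed
qed

text \<open>The disc of radius \<open>1 + N\<close> contains a disc of radius \<open>N\<close> about each point of the segment from
  \<open>q\<close> to \<open>z\<close>.\<close>

lemma kobayashi_dist_le_of_disc:
  assumes N: "N > 0" and disc: "\<And>c. cmod c < 1 + N \<Longrightarrow> q + c *s (z - q) \<in> D"
  shows "kobayashi_dist D q z \<le> ennreal (1 / N)"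
proof -
  define \<gamma> where "\<gamma> t = q + t *\<^sub>R (z - q)" for t :: real
  have \<gamma>': "(\<gamma> has_vector_derivative z - q) (at t within A)" for t A
    unfolding \<gamma>_def by (auto intro!: derivative_eq_intros)
  have mem: "\<gamma> t + (of_real N * \<zeta>) *s (z - q) \<in> D" if "t \<in> {0..1}" "cmod \<zeta> < 1" for t \<zeta>
  proof -
    have "cmod (of_real t + of_real N * \<zeta>) \<le> t + N * cmod \<zeta>"
      using norm_triangle_ineq[of "of_real t" "of_real N * \<zeta>"] that N by (simp add: norm_mult)
    also have "\<dots> < 1 + N" using that N by (intro add_le_less_mono) auto
    finally have "q + (of_real t + of_real N * \<zeta>) *s (z - q) \<in> D" by (rule disc)
    then show ?thesis by (simp add: \<gamma>_def scaleR_eq_vector_scalar_mult vector_sadd_rdistrib algebra_simps)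
  qed
  have metric: "kobayashi_metric D (\<gamma> t) (z - q) \<le> 1 / N" if "t \<in> {0..1}" for t
    using N mem[OF that] by (intro kobayashi_metric_le) auto
  have "kobayashi_dist D q z \<le> kobayashi_length D \<gamma>"
    unfolding kobayashi_dist_def
  proof (rule Inf_lower, intro CollectI exI conjI)
    have "continuous_on {0..1} \<gamma>" unfolding \<gamma>_def by (intro continuous_intros)
    then show "\<gamma> piecewise_differentiable_on {0..1}"
      unfolding piecewise_differentiable_on_def using \<gamma>' differentiableI_vector by blast
    show "\<gamma> ` {0..1} \<subseteq> D" using mem[of _ 0] by auto
  qed (auto simp: \<gamma>_def)
  also have "\<dots> \<le> (\<integral>\<^sup>+t. ennreal (1 / N) * indicator {0..1::real} t \<partial>lborel)"
    unfolding kobayashi_length_def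
  proof (intro nn_integral_mono)
    fix t :: real
    show "ennreal (kobayashi_metric D (\<gamma> t) (vector_derivative \<gamma> (at t))) * indicator {0..1} t
        \<le> ennreal (1 / N) * indicator {0..1} t"
      using metric[of t] vector_derivative_at[OF \<gamma>'[of t UNIV]] by (auto simp: indicator_def intro!: ennreal_leI)
  qed
  also have "\<dots> = ennreal (1 / N)" by (simp add: nn_integral_cmult_indicator)
  finally show ?thesis .
qed

section \<open>Finite type along complex lines\<close>

lemma continuous_greater_nearby:
  fixes f :: "'a::metric_space \<Rightarrow> real"
  assumes "continuous_on UNIV f" "c < f x"
  obtains e where "e > 0" "\<And>y. dist x y < e \<Longrightarrow> c < f y"
proof -
  have "open (f -` {c<..})" using assms(1) by (intro open_vimage) auto
  then obtain e where "e > 0" "ball x e \<subseteq> f -` {c<..}" using assms(2) open_contains_ball by blast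
  then show ?thesis by (intro that[of e]) auto
qed

lemma has_derivative_line: "((\<lambda>\<zeta>. p + \<zeta> *s v) has_derivative (\<lambda>c. c *s (v :: complex ^ 'n))) (at y)"
  using has_derivative_add[OF has_derivative_const[of p]
      bounded_linear_imp_has_derivative[OF bounded_linear_vector_scalar_mult_left[of v]]] by simp

text \<open>By the chain rule the derivative of the restriction in direction \<open>c\<close> is the restriction of the
  derivative in direction \<open>c v\<close>.\<close>

lemma vanishes_to_order_on_line:
  fixes f :: "complex ^ 'n \<Rightarrow> real"
  assumes "smooth_on f UNIV" "\<And>cs. iterated_derivative (map (\<lambda>c. c *s v) cs) f p = 0"
  shows "vanishes_to_order k (f \<circ> (\<lambda>\<zeta>. p + \<zeta> *s v)) 0"
  using assms
proof (induction k arbitrary: f)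
  case 0
  then show ?case by simp
next
  case (Suc k)
  let ?\<gamma> = "\<lambda>\<zeta>. p + \<zeta> *s v"
  have der: "(\<lambda>y. frechet_derivative (f \<circ> ?\<gamma>) (at y) c) = (\<lambda>x. frechet_derivative f (at x) (c *s v)) \<circ> ?\<gamma>" for c
  proof
    fix y
    have "(f has_derivative frechet_derivative f (at (?\<gamma> y))) (at (?\<gamma> y))"
      using smooth_on_differentiable[OF Suc.prems(1)] frechet_derivative_works by blast
    from diff_chain_at[OF has_derivative_line this]
    have "(f \<circ> ?\<gamma> has_derivative (\<lambda>c. frechet_derivative f (at (?\<gamma> y)) (c *s v))) (at y)"
      by (simp add: o_def)
    from fun_cong[OF frechet_derivative_at[OF this], of c]
    show "frechet_derivative (f \<circ> ?\<gamma>) (at y) c = ((\<lambda>x. frechet_derivative f (at x) (c *s v)) \<circ> ?\<gamma>) y" by simp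
  qed
  have "vanishes_to_order k ((\<lambda>x. frechet_derivative f (at x) (c *s v)) \<circ> ?\<gamma>) 0" for c
    using Suc.prems(2)[of "c # _"] by (intro Suc.IH smooth_on_directional_derivative[OF Suc.prems(1)]) simp
  moreover have "(f \<circ> ?\<gamma>) 0 = 0" using Suc.prems(2)[of "[]"] by simp
  ultimately show ?case unfolding vanishes_to_order.simps der by blast
qed

lemma vanishing_order_of_line:
  fixes v :: "complex ^ 'n"
  assumes "v \<noteq> 0" shows "vanishing_order (\<lambda>\<zeta>. p + \<zeta> *s v - p) 0 \<le> 1"
  unfolding vanishing_order_def
proof (rule Sup_least, safe)
  fix k assume k: "vanishes_to_order k (\<lambda>\<zeta>. p + \<zeta> *s v - p) 0"
  show "enat k \<le> 1"
  proof (rule ccontr)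
    assume "\<not> enat k \<le> 1"
    then have "k \<ge> 2" by (simp add: one_enat_def)
    then obtain j where j: "k = Suc (Suc j)" by (auto simp: numeral_2_eq_2 dest!: le_Suc_ex)
    have "((\<lambda>\<zeta>. p + \<zeta> *s v - p) has_derivative (\<lambda>c. c *s v)) (at 0)"
      using has_derivative_diff[OF has_derivative_line[of p v] has_derivative_const[of p]] by simp
    from fun_cong[OF frechet_derivative_at[OF this], of 1] show False
      using k assms unfolding j by (auto dest: spec[of _ 1])
  qed
qed

text \<open>A complex line through \<open>p\<close> is a holomorphic germ of vanishing order one. If all derivatives of
  \<open>f\<close> along it vanished, its order of contact would be infinite.\<close>

lemma finite_line_type:
  fixes f :: "complex ^ 'n \<Rightarrow> real"
  assumes f: "smooth_on f UNIV" and type: "dangelo_type f p < \<infinity>" and v: "v \<noteq> 0"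
  shows "\<exists>cs. iterated_derivative (map (\<lambda>c. c *s v) cs) f p \<noteq> 0"
proof (rule ccontr)
  assume "\<not> ?thesis"
  then have 0: "vanishes_to_order k (f \<circ> (\<lambda>\<zeta>. p + \<zeta> *s v)) 0" for k
    using vanishes_to_order_on_line[OF f] by blast
  let ?\<gamma> = "\<lambda>\<zeta>. p + \<zeta> *s v"
  have "{enat k |k. vanishes_to_order k (f \<circ> ?\<gamma>) 0} = range enat" using 0 by auto
  moreover have "Sup (range enat) = \<infinity>"
  proof (rule ccontr)
    assume "Sup (range enat) \<noteq> \<infinity>"
    then obtain m where m: "Sup (range enat) = enat m" by auto
    have "enat (Suc m) \<le> Sup (range enat)" by (rule Sup_upper) simp
    then show False by (simp add: m)
  qed
  ultimately have inf: "vanishing_order (f \<circ> ?\<gamma>) 0 = \<infinity>" by (simp add: vanishing_order_def)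
  have "?\<gamma> \<in> nonconstant_holomorphic_germs p"
  proof -
    have "\<not> (\<forall>\<^sub>F \<zeta> in nhds 0. ?\<gamma> \<zeta> = p)"
    proof
      assume "\<forall>\<^sub>F \<zeta> in nhds 0. ?\<gamma> \<zeta> = p"
      then obtain d where d: "d > 0" "\<And>\<zeta>. dist \<zeta> 0 < d \<Longrightarrow> p + \<zeta> *s v = p"
        unfolding eventually_nhds_metric by blast
      have "p + of_real (d / 2) *s v = p" using d(1) by (intro d(2)) (simp add: dist_norm)
      then have "norm (of_real (d / 2) *s v) = 0" by simp
      then show False using d(1) v by (simp add: norm_vector_scalar_mult norm_divide)
    qed
    moreover have "(\<lambda>\<zeta>. ?\<gamma> \<zeta> $ i) analytic_on {0}" for i
      by (auto intro!: analytic_intros)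
    ultimately show ?thesis by (simp add: nonconstant_holomorphic_germs_def)
  qed
  then have "ereal_of_enat (vanishing_order (f \<circ> ?\<gamma>) 0) / ereal_of_enat (vanishing_order (\<lambda>\<zeta>. ?\<gamma> \<zeta> - p) 0) \<le> dangelo_type f p"
    unfolding dangelo_type_def by (rule SUP_upper)
  moreover obtain m where m: "vanishing_order (\<lambda>\<zeta>. ?\<gamma> \<zeta> - p) 0 = enat m"
    using vanishing_order_of_line[OF v, of p] by (cases "vanishing_order (\<lambda>\<zeta>. ?\<gamma> \<zeta> - p) 0") auto
  moreover have "(\<infinity>::ereal) / ereal (real m) = \<infinity>" by (cases "m = 0") (auto simp: divide_ereal_def)
  ultimately show False using type inf by simp
qed

section \<open>Convex domains of finite type near the boundary\<close>

locale finite_type_convex_domain =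
  fixes D :: "('n::{finite,linorder}) cspace set" and \<rho> :: "'n cspace \<Rightarrow> real" and \<eta>\<^sub>0 :: real
  assumes open_D: "open D" and nonempty_D: "D \<noteq> {}" and bounded_D: "bounded D" and convex_D: "convex D"
    and defining: "smooth_defining_function \<rho> D"
    and \<eta>\<^sub>0_pos: "\<eta>\<^sub>0 > 0" and convex_sublevel: "\<And>\<eta>. - \<eta>\<^sub>0 < \<eta> \<Longrightarrow> \<eta> < \<eta>\<^sub>0 \<Longrightarrow> convex {z. \<rho> z < \<eta>}"
    and finite_type: "finite_type \<rho> D"
begin

abbreviation "bd \<equiv> frontier D"

lemma smooth: "smooth_on \<rho> UNIV" using defining by (simp add: smooth_defining_function_def)
lemma D_eq: "D = {z. \<rho> z < 0}" using defining by (simp add: smooth_defining_function_def)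

lemma continuous_\<rho>: "continuous_on A \<rho>"
  using smooth_on_continuous[OF smooth] by (rule continuous_on_subset) simp

lemma open_sublevel: "open {z. \<rho> z < \<eta>}"
  by (intro open_Collect_less continuous_\<rho> continuous_on_const)

lemma closure_sublevel: "z \<in> closure {z. \<rho> z < \<eta>} \<Longrightarrow> \<rho> z \<le> \<eta>"
proof -
  have "closure {z. \<rho> z < \<eta>} \<subseteq> {z. \<rho> z \<le> \<eta>}"
    by (intro closure_minimal closed_Collect_le continuous_\<rho> continuous_on_const) auto
  then show "z \<in> closure {z. \<rho> z < \<eta>} \<Longrightarrow> \<rho> z \<le> \<eta>" by auto
qed

lemma frontier_zero: assumes "p \<in> bd" shows "\<rho> p = 0"
proof -
  have "p \<in> closure D" "p \<notin> D" using assms open_D by (auto simp: frontier_def interior_open)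
  then show ?thesis using closure_sublevel[of p 0] by (simp add: D_eq)
qed

lemma compact_frontier: "compact bd"
  using bounded_D by (simp add: compact_frontier_bounded)

lemma frontier_nonempty: "bd \<noteq> {}"
  using nonempty_D bounded_D frontier_eq_empty[of D] not_bounded_UNIV by blast

lemma nearest_frontier_point: "\<exists>p\<in>bd. dist q p = infdist q bd"
  using infdist_attains_inf[OF frontier_closed frontier_nonempty, of q] by metis

lemma infdist_frontier_pos: assumes "q \<in> D" shows "infdist q bd > 0"
proof -
  obtain p where p: "p \<in> bd" "dist q p = infdist q bd" using nearest_frontier_point[of q] by blast
  then have "p \<noteq> q" using assms open_D by (auto simp: frontier_def interior_open)
  then show ?thesis using p(2) by (metis zero_less_dist_iff)
qed

lemma ball_infdist_subset: assumes "q \<in> D" "dist q y < infdist q bd" shows "y \<in> D"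
proof (rule ccontr)
  assume "y \<notin> D"
  then have "closed_segment q y \<inter> bd \<noteq> {}" using assms(1) by (intro connected_Int_frontier) auto
  then obtain x where "x \<in> closed_segment q y" "x \<in> bd" by blast
  then have "dist q x \<le> dist q y" "infdist q bd \<le> dist q x"
    using dist_in_closed_segment[of x q y] by (auto simp: infdist_le dist_commute)
  then show False using assms(2) by simp
qed

definition grad :: "'n cspace \<Rightarrow> 'n cspace" where
  "grad x = (\<Sum>b\<in>Basis. frechet_derivative \<rho> (at x) b *\<^sub>R b)"

lemma frechet_derivative_eq_grad: "frechet_derivative \<rho> (at x) w = grad x \<bullet> w"
proof -
  have L: "linear (frechet_derivative \<rho> (at x))"
    using linear_frechet_derivative[OF smooth_on_differentiable[OF smooth]] .
  have "frechet_derivative \<rho> (at x) w = frechet_derivative \<rho> (at x) (\<Sum>b\<in>Basis. (w \<bullet> b) *\<^sub>R b)"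
    by (simp add: euclidean_representation)
  also have "\<dots> = (\<Sum>b\<in>Basis. (w \<bullet> b) * frechet_derivative \<rho> (at x) b)"
    using L by (simp add: linear_sum linear_cmul)
  also have "\<dots> = grad x \<bullet> w"
    unfolding grad_def inner_sum_left by (rule sum.cong) (simp_all add: inner_commute)
  finally show ?thesis .
qed

lemma continuous_grad: "continuous_on UNIV grad"
proof -
  have "continuous_on UNIV (\<lambda>x. frechet_derivative \<rho> (at x) b)" for b
    using smooth_on_continuous[OF smooth_on_directional_derivative[OF smooth]] .
  then show ?thesis unfolding grad_def by (intro continuous_on_sum continuous_on_scaleR continuous_on_const) auto
qed

lemma grad_nonzero: "p \<in> bd \<Longrightarrow> grad p \<noteq> 0"
proof
  assume p: "p \<in> bd" and "grad p = 0"
  then have "frechet_derivative \<rho> (at p) = (\<lambda>v. 0)" by (intro ext) (simp add: frechet_derivative_eq_grad)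
  then show False using defining p unfolding smooth_defining_function_def by blast
qed

lemma derivative_along_line:
  "((\<lambda>t. \<rho> (x + t *\<^sub>R w)) has_real_derivative grad (x + t *\<^sub>R w) \<bullet> w) (at t)"
proof -
  have "frechet_derivative \<rho> (at y) = (\<lambda>w. grad y \<bullet> w)" for y
    by (rule ext) (rule frechet_derivative_eq_grad)
  then have "(\<rho> has_derivative (\<lambda>w. grad y \<bullet> w)) (at y)" for y
    using smooth_on_differentiable[OF smooth, of y] unfolding frechet_derivative_works by simp
  then have "((\<lambda>t. \<rho> (x + t *\<^sub>R w)) has_derivative (\<lambda>s. grad (x + t *\<^sub>R w) \<bullet> (s *\<^sub>R w))) (at t)"
    by (rule has_derivative_compose[of "\<lambda>t. x + t *\<^sub>R w" "\<lambda>s. s *\<^sub>R w", rotated])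
       (auto intro!: derivative_eq_intros)
  moreover have "(\<lambda>s. grad (x + t *\<^sub>R w) \<bullet> (s *\<^sub>R w)) = (*) (grad (x + t *\<^sub>R w) \<bullet> w)"
    by (auto simp: fun_eq_iff)
  ultimately show ?thesis by (simp only: has_field_derivative_def)
qed

lemma mean_value:
  assumes "t \<ge> 0"
  shows "\<exists>s. 0 \<le> s \<and> s \<le> t \<and> \<rho> (x + t *\<^sub>R w) - \<rho> x = t * (grad (x + s *\<^sub>R w) \<bullet> w)"
proof (cases "t = 0")
  case False
  then show ?thesis
    using MVT2[of 0 t "\<lambda>t. \<rho> (x + t *\<^sub>R w)" "\<lambda>t. grad (x + t *\<^sub>R w) \<bullet> w"] derivative_along_line assms
    by (auto intro: less_imp_le)
qed auto

text \<open>Suppose \<open>\<rho> (q + w) < \<rho> q\<close>. After a small change of \<open>w\<close> the derivative of \<open>\<rho>\<close> in direction \<open>w\<close> is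
  positive, so \<open>\<rho>\<close> is below \<open>\<rho> q\<close> also at some point \<open>q - s w\<close>. Then \<open>q\<close> lies between two points of a
  convex sublevel set to which it does not belong.\<close>

lemma ascent_direction:
  assumes conv: "convex {z. \<rho> z < \<rho> q}" and g: "grad q \<noteq> 0" and w: "grad q \<bullet> w \<ge> 0"
  shows "\<rho> (q + w) \<ge> \<rho> q"
proof (rule ccontr)
  assume "\<not> \<rho> (q + w) \<ge> \<rho> q"
  then have "q + w \<in> {z. \<rho> z < \<rho> q}" by simp
  then obtain e where e: "e > 0" "ball (q + w) e \<subseteq> {z. \<rho> z < \<rho> q}"
    using open_sublevel open_contains_ball by blast
  \<comment> \<open>Moving along the gradient turns the weak inequality on the derivative into a strict one.\<close>
  define w' where "w' = w + (e / (2 * norm (grad q))) *\<^sub>R grad q"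
  have "dist (q + w) (q + w') = e / 2" using g e by (simp add: w'_def dist_norm)
  then have 1: "\<rho> (q + w') < \<rho> q" using e by (auto simp: subset_iff)
  have "grad q \<bullet> w' > 0" using g e w by (simp add: w'_def inner_right_distrib add_nonneg_pos)
  then have "grad (q + 0 *\<^sub>R (- w')) \<bullet> (- w') < 0" by simp
  from DERIV_neg_dec_right[OF derivative_along_line this]
  obtain d where d: "d > 0" "\<And>h. h > 0 \<Longrightarrow> h < d \<Longrightarrow> \<rho> (q + h *\<^sub>R (- w')) < \<rho> q"
    by auto
  define s where "s = d / 2"
  have s: "s > 0" "\<rho> (q + s *\<^sub>R (- w')) < \<rho> q" using d by (auto simp: s_def)
  have "(s / (1 + s)) *\<^sub>R (q + w') + (1 / (1 + s)) *\<^sub>R (q + s *\<^sub>R (- w')) \<in> {z. \<rho> z < \<rho> q}"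
    using 1 s by (intro convexD[OF conv]) (auto simp: field_simps)
  moreover have "(s / (1 + s)) *\<^sub>R (q + w') + (1 / (1 + s)) *\<^sub>R (q + s *\<^sub>R (- w')) = ((s + 1) / (1 + s)) *\<^sub>R q"
    unfolding add_divide_distrib scaleR_add_left by (simp add: algebra_simps)
  ultimately show False using s(1) by (simp add: add.commute)
qed

lemma uniform_near_frontier:
  assumes mono: "\<And>m n q. m \<le> n \<Longrightarrow> P m q \<Longrightarrow> P n q"
    and loc: "\<And>p. p \<in> bd \<Longrightarrow> \<exists>N::nat. \<exists>e>0. \<forall>q. dist p q < e \<longrightarrow> P N q"
  shows "\<exists>N. \<exists>e>0. \<forall>q. infdist q bd < e \<longrightarrow> P N q"
proof -
  obtain N e where e: "e > 0" "\<And>p q. p \<in> bd \<Longrightarrow> dist p q < e \<Longrightarrow> P N q"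
    using compact_uniform_neighbourhood[OF compact_frontier, of P] mono loc by blast
  have "P N q" if "infdist q bd < e" for q
  proof -
    obtain p where "p \<in> bd" "dist q p = infdist q bd" using nearest_frontier_point[of q] by blast
    then show ?thesis using that by (intro e(2)[of p]) (auto simp: dist_commute)
  qed
  then show ?thesis using e(1) by blast
qed

text \<open>Near the boundary \<open>\<rho>\<close> increases at a definite rate along the gradient at \<open>q\<close>, not only at \<open>q\<close> but
  on a ball about \<open>q\<close> of fixed radius.\<close>

lemma local_estimates:
  obtains r a L where "r > 0" "r \<le> 1" "a > 0" "L > 0"
    "\<And>q. infdist q bd < r \<Longrightarrow> \<bar>\<rho> q\<bar> < \<eta>\<^sub>0"
    "\<And>q x. infdist q bd < r \<Longrightarrow> dist q x \<le> r \<Longrightarrow> a \<le> grad x \<bullet> grad q"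
    "\<And>q x. infdist q bd < r \<Longrightarrow> dist q x \<le> r \<Longrightarrow> norm (grad x) \<le> L"
proof -
  define P where "P N q \<longleftrightarrow> \<bar>\<rho> q\<bar> < \<eta>\<^sub>0 \<and> (\<forall>x. dist q x \<le> 1 / real (Suc N) \<longrightarrow>
      1 / real (Suc N) \<le> grad x \<bullet> grad q \<and> norm (grad x) \<le> real (Suc N))" for N q
  have "\<exists>N. \<exists>e>0. \<forall>q. infdist q bd < e \<longrightarrow> P N q"
  proof (rule uniform_near_frontier)
    fix m n q assume "m \<le> n" "P m q"
    moreover have "1 / real (Suc n) \<le> 1 / real (Suc m)" using \<open>m \<le> n\<close> by (intro divide_left_mono) auto
    moreover have "real (Suc m) \<le> real (Suc n)" using \<open>m \<le> n\<close> by simp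
    ultimately show "P n q" unfolding P_def by (meson order_trans)
  next
    fix p assume p: "p \<in> bd"
    define b where "b = (norm (grad p))\<^sup>2"
    have b: "b > 0" using grad_nonzero[OF p] by (simp add: b_def)
    obtain e1 where e1: "e1 > 0" "\<And>q. dist p q < e1 \<Longrightarrow> - \<eta>\<^sub>0 < - \<bar>\<rho> q\<bar>"
    proof (rule continuous_greater_nearby)
      show "continuous_on UNIV (\<lambda>q. - \<bar>\<rho> q\<bar>)" by (intro continuous_on_minus continuous_on_rabs continuous_\<rho>)
      show "- \<eta>\<^sub>0 < - \<bar>\<rho> p\<bar>" using frontier_zero[OF p] \<eta>\<^sub>0_pos by simp
    qed (rule that)
    obtain e2 where e2: "e2 > 0" "\<And>z. dist (p, p) z < e2 \<Longrightarrow> b / 2 < grad (fst z) \<bullet> grad (snd z)"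
    proof (rule continuous_greater_nearby)
      show "continuous_on UNIV (\<lambda>z. grad (fst z) \<bullet> grad (snd z))"
        by (intro continuous_on_inner continuous_on_compose2[OF continuous_grad] continuous_on_fst continuous_on_snd continuous_on_id) auto
      show "b / 2 < grad (fst (p, p)) \<bullet> grad (snd (p, p))" using b by (simp add: b_def power2_norm_eq_inner)
    qed (rule that)
    obtain e3 where e3: "e3 > 0" "\<And>x. dist p x < e3 \<Longrightarrow> - (norm (grad p) + 1) < - norm (grad x)"
    proof (rule continuous_greater_nearby)
      show "continuous_on UNIV (\<lambda>x. - norm (grad x))" by (intro continuous_on_minus continuous_on_norm continuous_grad)
      show "- (norm (grad p) + 1) < - norm (grad p)" by simp
    qed (rule that)
    define e where "e = min e1 (min (e2 / 2) e3) / 2"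
    have e: "e > 0" "2 * e \<le> e1" "4 * e \<le> e2" "2 * e \<le> e3" using e1 e2 e3 by (auto simp: e_def min_def)
    obtain N :: nat where N: "real N \<ge> max (1 / e) (max (2 / b) (norm (grad p) + 1))"
      using real_arch_simple by blast
    have N1: "1 / real (Suc N) \<le> e" "1 / real (Suc N) \<le> b / 2" "norm (grad p) + 1 \<le> real (Suc N)"
    proof -
      have "1 / e \<le> real (Suc N)" "2 / b \<le> real (Suc N)" using N by auto
      then show "1 / real (Suc N) \<le> e" "1 / real (Suc N) \<le> b / 2" using e(1) b by (auto simp: divide_simps mult.commute)
      show "norm (grad p) + 1 \<le> real (Suc N)" using N by simp
    qed
    have "P N q" if q: "dist p q < e" for q
      unfolding P_def
    proof (intro conjI allI impI)
      show "\<bar>\<rho> q\<bar> < \<eta>\<^sub>0" using q e e1(2)[of q] by simp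
      fix x assume "dist q x \<le> 1 / real (Suc N)"
      then have x: "dist p x < 2 * e" using q N1(1) dist_triangle[of p x q] by linarith
      have "dist (p, p) (x, q) \<le> dist p x + dist p q" unfolding dist_Pair_Pair by (rule sqrt_sum_squares_le_sum) auto
      then have "dist (p, p) (x, q) < e2" using x q e by linarith
      then have "b / 2 < grad x \<bullet> grad q" using e2(2)[of "(x, q)"] by (simp add: dist_commute)
      then show "1 / real (Suc N) \<le> grad x \<bullet> grad q" using N1(2) by linarith
      have "dist p x < e3" using x e by linarith
      then show "norm (grad x) \<le> real (Suc N)" using e3(2)[of x] N1(3) by linarith
    qed
    then show "\<exists>N. \<exists>e>0. \<forall>q. dist p q < e \<longrightarrow> P N q" using e(1) by blast
  qed
  then obtain N e where Ne: "e > 0" "\<And>q. infdist q bd < e \<Longrightarrow> P N q" by blast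
  define r where "r = min e (1 / real (Suc N))"
  have r: "r > 0" "r \<le> 1" "r \<le> e" "r \<le> 1 / real (Suc N)" using Ne(1) by (auto simp: r_def min_le_iff_disj)
  have P: "P N q" if "infdist q bd < r" for q using Ne(2) r(3) that by simp
  show ?thesis
  proof (rule that[of r "1 / real (Suc N)" "real (Suc N)"])
    show "\<bar>\<rho> q\<bar> < \<eta>\<^sub>0" if "infdist q bd < r" for q using P[OF that] by (simp add: P_def)
    fix q x assume q: "infdist q bd < r" and "dist q x \<le> r"
    then have "dist q x \<le> 1 / real (Suc N)" using r(4) by linarith
    then show "1 / real (Suc N) \<le> grad x \<bullet> grad q" "norm (grad x) \<le> real (Suc N)"
      using P[OF q] unfolding P_def by blast+
  qed (use r in auto)
qed

text \<open>Following the gradient at \<open>q\<close> for a time \<open>d / (2 L)\<close> increases \<open>\<rho>\<close> by a multiple of \<open>d\<close>, yet does not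
  leave \<open>D\<close>. The other estimate is the mean value theorem towards the nearest boundary point.\<close>

lemma defining_function_comparable_to_distance:
  obtains r c C where "r > 0" "c > 0" "C > 0"
    "\<And>q. q \<in> D \<Longrightarrow> infdist q bd < r \<Longrightarrow> c * infdist q bd \<le> - \<rho> q"
    "\<And>q. q \<in> D \<Longrightarrow> infdist q bd < r \<Longrightarrow> - \<rho> q \<le> C * infdist q bd"
proof -
  obtain r a L where r: "r > 0" "r \<le> 1" "a > 0" "L > 0"
    and "\<And>q. infdist q bd < r \<Longrightarrow> \<bar>\<rho> q\<bar> < \<eta>\<^sub>0"
    and est: "\<And>q x. infdist q bd < r \<Longrightarrow> dist q x \<le> r \<Longrightarrow> a \<le> grad x \<bullet> grad q"
      "\<And>q x. infdist q bd < r \<Longrightarrow> dist q x \<le> r \<Longrightarrow> norm (grad x) \<le> L"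
    using that by (rule local_estimates)
  have "a / (2 * L) * infdist q bd \<le> - \<rho> q \<and> - \<rho> q \<le> L * infdist q bd"
    if q: "q \<in> D" "infdist q bd < r" for q
  proof
    define d where "d = infdist q bd"
    have d: "d > 0" "d < r" using infdist_frontier_pos[OF q(1)] q(2) by (auto simp: d_def)
    define t where "t = d / (2 * L)"
    have t: "t > 0" using d r by (simp add: t_def)
    have ng: "norm (grad q) \<le> L" using est(2)[OF q(2), of q] r by simp
    have tg: "s * norm (grad q) \<le> d / 2" if "0 \<le> s" "s \<le> t" for s
    proof -
      have "s * norm (grad q) \<le> t * L" using that t ng by (intro mult_mono) auto
      then show ?thesis using r by (simp add: t_def)
    qed
    have "q + t *\<^sub>R grad q \<in> D"
      using tg[of t] t d by (intro ball_infdist_subset[OF q(1)]) (simp add: dist_norm d_def)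
    then have neg: "\<rho> (q + t *\<^sub>R grad q) < 0" by (simp add: D_eq)
    obtain s where s: "0 \<le> s" "s \<le> t" "\<rho> (q + t *\<^sub>R grad q) - \<rho> q = t * (grad (q + s *\<^sub>R grad q) \<bullet> grad q)"
      using mean_value[of t q "grad q"] t by auto
    have "a \<le> grad (q + s *\<^sub>R grad q) \<bullet> grad q"
      using tg[OF s(1,2)] d s by (intro est(1)[OF q(2)]) (simp add: dist_norm)
    then have "t * a \<le> \<rho> (q + t *\<^sub>R grad q) - \<rho> q" using t s(3) by simp
    then show "a / (2 * L) * infdist q bd \<le> - \<rho> q" using neg by (simp add: t_def d_def mult.commute)
    obtain p where p: "p \<in> bd" "dist q p = d" using nearest_frontier_point[of q] by (auto simp: d_def)
    obtain s where s: "0 \<le> s" "s \<le> 1" "\<rho> (q + 1 *\<^sub>R (p - q)) - \<rho> q = 1 * (grad (q + s *\<^sub>R (p - q)) \<bullet> (p - q))"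
      using mean_value[of 1 q "p - q"] by auto
    have "norm (p - q) = d" using p(2) by (simp add: dist_norm norm_minus_commute)
    moreover have "norm (grad (q + s *\<^sub>R (p - q))) \<le> L"
    proof (rule est(2)[OF q(2)])
      have "s * d \<le> d" using s d by (intro mult_left_le_one_le) auto
      moreover have "dist q (q + s *\<^sub>R (p - q)) = s * d" using s(1) \<open>norm (p - q) = d\<close> by (simp add: dist_norm)
      ultimately show "dist q (q + s *\<^sub>R (p - q)) \<le> r" using d by linarith
    qed
    then have "norm (grad (q + s *\<^sub>R (p - q))) * d \<le> L * d" using d by (intro mult_right_mono) auto
    ultimately have "grad (q + s *\<^sub>R (p - q)) \<bullet> (p - q) \<le> L * d"
      using norm_cauchy_schwarz[of "grad (q + s *\<^sub>R (p - q))" "p - q"] by simp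
    then show "- \<rho> q \<le> L * infdist q bd" using s(3) frontier_zero[OF p(1)] by (simp add: d_def)
  qed
  then show ?thesis using r by (intro that[of r "a / (2 * L)" L]) simp_all
qed

text \<open>Let \<open>w\<close> lie in the disc. If \<open>\<rho>\<close> does not decrease to first order in direction \<open>w\<close>, then
  \<open>\<rho> (q + w) \<ge> \<rho> q\<close> by convexity. Otherwise convexity applies to \<open>w\<close> and to \<open>- w\<close> after removing their
  components \<open>\<plusminus> t g\<close> along the gradient \<open>g\<close>. As \<open>\<rho>\<close> grows at a definite rate along \<open>g\<close>, the bound
  at \<open>q - w\<close> limits \<open>t\<close> to a multiple of \<open>s\<close>, and \<open>\<rho> (q + w)\<close> is below \<open>\<rho> q\<close> by at most a multiple of \<open>t\<close>.\<close>

lemma two_sided_bound: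
  obtains r B where "r > 0" "r \<le> 1" "B > 0"
    "\<And>q v s \<zeta>. infdist q bd < r \<Longrightarrow> norm v \<le> r \<Longrightarrow>
      \<forall>\<zeta>. cmod \<zeta> \<le> 1 \<longrightarrow> \<rho> (q + \<zeta> *s v) \<le> \<rho> q + s \<Longrightarrow> cmod \<zeta> \<le> 1 \<Longrightarrow>
      \<bar>\<rho> (q + \<zeta> *s v) - \<rho> q\<bar> \<le> B * s"
proof -
  obtain r a L where r: "r > 0" "r \<le> 1" "a > 0" "L > 0"
    and est: "\<And>q. infdist q bd < r \<Longrightarrow> \<bar>\<rho> q\<bar> < \<eta>\<^sub>0"
      "\<And>q x. infdist q bd < r \<Longrightarrow> dist q x \<le> r \<Longrightarrow> a \<le> grad x \<bullet> grad q"
      "\<And>q x. infdist q bd < r \<Longrightarrow> dist q x \<le> r \<Longrightarrow> norm (grad x) \<le> L"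
    using that by (rule local_estimates)
  define B where "B = 1 + L\<^sup>2 / a"
  have B: "B \<ge> 1" using r by (simp add: B_def)
  have "\<bar>\<rho> (q + \<zeta> *s v) - \<rho> q\<bar> \<le> B * s"
    if q: "infdist q bd < r / 2" and v: "norm v \<le> r / 2"
      and disc: "\<forall>\<zeta>. cmod \<zeta> \<le> 1 \<longrightarrow> \<rho> (q + \<zeta> *s v) \<le> \<rho> q + s" and \<zeta>: "cmod \<zeta> \<le> 1" for q v s \<zeta>
  proof -
    have upper: "\<rho> (q + \<zeta> *s v) \<le> \<rho> q + s" if "cmod \<zeta> \<le> 1" for \<zeta> using disc that by blast
    define w g where "w = \<zeta> *s v" and "g = grad q"
    have qr: "infdist q bd < r" using q r by simp
    have g0: "g \<noteq> 0" using est(2)[OF qr, of q] r by (auto simp: g_def)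
    have asc: "\<rho> (q + w) \<ge> \<rho> q" if "g \<bullet> w \<ge> 0" for w
      using est(1)[OF qr] that g0 unfolding g_def by (intro ascent_direction convex_sublevel) auto
    have s0: "s \<ge> 0" using upper[of 0] by simp
    have up: "\<rho> (q + w) \<le> \<rho> q + s" using upper[OF \<zeta>] by (simp add: w_def)
    have up': "\<rho> (q - w) \<le> \<rho> q + s"
      using upper[of "- \<zeta>"] \<zeta> by (simp add: w_def vector_smult_lneg)
    have Bs: "s \<le> B * s" using B s0 mult_right_mono[of 1 B s] by simp
    show ?thesis
    proof (cases "g \<bullet> w \<ge> 0")
      case True
      then show ?thesis using asc[OF True] up Bs s0 by (auto simp: w_def)
    next
      case False
      \<comment> \<open>Adding \<open>t g\<close> makes \<open>w\<close> orthogonal to the gradient.\<close>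
      define t where "t = - (g \<bullet> w) / (norm g)\<^sup>2"
      have t: "t > 0" using False g0 by (simp add: t_def divide_neg_pos)
      have tg: "t * (g \<bullet> g) = - (g \<bullet> w)" using g0 by (simp add: t_def power2_norm_eq_inner)
      have nw: "norm w \<le> r / 2"
      proof -
        have "norm w \<le> norm v" using \<zeta> by (simp add: w_def norm_vector_scalar_mult mult_left_le_one_le)
        then show ?thesis using v by simp
      qed
      have ntg: "t * norm g \<le> norm w"
      proof -
        have "- (g \<bullet> w) \<le> norm g * norm w" using norm_cauchy_schwarz[of "- g" w] by simp
        then have "t * (norm g)\<^sup>2 \<le> norm g * norm w" using g0 by (simp add: t_def)
        then show ?thesis using g0 by (simp add: power2_eq_square)
      qed
      have near: "dist q (q + y + u *\<^sub>R g) \<le> r" if "norm y \<le> r / 2" "\<bar>u\<bar> \<le> t" for y u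
      proof -
        have "\<bar>u\<bar> * norm g \<le> r / 2" using mult_right_mono[OF that(2), of "norm g"] ntg nw by simp
        then have "norm (y + u *\<^sub>R g) \<le> r" using norm_triangle_ineq[of y "u *\<^sub>R g"] that(1) by simp
        moreover have "q + y + u *\<^sub>R g - q = y + u *\<^sub>R g" by simp
        ultimately show ?thesis by (simp only: dist_norm norm_minus_commute[of q])
      qed
      have grow: "t * a \<le> \<rho> (x + t *\<^sub>R g) - \<rho> x \<and> \<rho> (x + t *\<^sub>R g) - \<rho> x \<le> t * L\<^sup>2"
        if x: "\<And>u. 0 \<le> u \<Longrightarrow> u \<le> t \<Longrightarrow> dist q (x + u *\<^sub>R g) \<le> r" for x
      proof -
        obtain u where u: "0 \<le> u" "u \<le> t" "\<rho> (x + t *\<^sub>R g) - \<rho> x = t * (grad (x + u *\<^sub>R g) \<bullet> g)"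
          using mean_value[of t x g] t by auto
        have "a \<le> grad (x + u *\<^sub>R g) \<bullet> g" unfolding g_def using x[OF u(1,2)] by (intro est(2)[OF qr]) (simp add: g_def)
        moreover have "grad (x + u *\<^sub>R g) \<bullet> g \<le> L\<^sup>2"
        proof -
          have "grad (x + u *\<^sub>R g) \<bullet> g \<le> norm (grad (x + u *\<^sub>R g)) * norm g" by (rule norm_cauchy_schwarz)
          also have "\<dots> \<le> L * L"
            using est(3)[OF qr x[OF u(1,2)]] est(3)[OF qr, of q] r by (intro mult_mono) (auto simp: g_def)
          finally show ?thesis by (simp add: power2_eq_square)
        qed
        ultimately show ?thesis using t by (simp add: u(3))
      qed
      have "t * a \<le> \<rho> ((q - w - t *\<^sub>R g) + t *\<^sub>R g) - \<rho> (q - w - t *\<^sub>R g)"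
      proof (rule conjunct1[OF grow])
        fix u assume "0 \<le> u" "u \<le> t"
        then show "dist q (q - w - t *\<^sub>R g + u *\<^sub>R g) \<le> r"
          using near[of "- w" "u - t"] nw by (simp add: scaleR_diff_left algebra_simps)
      qed
      moreover have "\<rho> q \<le> \<rho> (q - w - t *\<^sub>R g)"
        using asc[of "- w - t *\<^sub>R g"] tg by (simp add: inner_diff_right algebra_simps)
      ultimately have ta: "t * a \<le> s" using up' by simp
      have "\<rho> (q + w + t *\<^sub>R g) - \<rho> (q + w) \<le> t * L\<^sup>2"
        by (rule conjunct2[OF grow]) (use near nw in auto)
      moreover have "\<rho> q \<le> \<rho> (q + w + t *\<^sub>R g)"
        using asc[of "w + t *\<^sub>R g"] tg by (simp add: inner_right_distrib add.assoc)
      ultimately have "\<rho> q - \<rho> (q + w) \<le> t * L\<^sup>2" by simp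
      also have "\<dots> \<le> s / a * L\<^sup>2" using ta r by (intro mult_right_mono) (auto simp: pos_le_divide_eq)
      also have "\<dots> \<le> B * s" using s0 by (simp add: B_def algebra_simps)
      finally show ?thesis using up Bs by (auto simp: w_def)
    qed
  qed
  then show ?thesis using r B by (intro that[of "r / 2" B]) simp_all
qed

text \<open>If \<open>\<rho>\<close> vanished at a point outside, the segment from there to \<open>D\<close> would lie in \<open>{\<rho> < \<eta>}\<close> for all
  small \<open>\<eta> > 0\<close>. But \<open>\<rho>\<close> becomes positive where the segment leaves \<open>D\<close>, since the gradient
  does not vanish there.\<close>

lemma positive_outside: assumes z: "z \<notin> closure D" shows "\<rho> z > 0"
proof (rule ccontr)
  assume "\<not> \<rho> z > 0"
  moreover have "z \<notin> D" using z closure_subset by blast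
  ultimately have z0: "\<rho> z = 0" by (simp add: D_eq)
  obtain w where w: "w \<in> D" using nonempty_D by blast
  have "closed_segment w z \<inter> bd \<noteq> {}" using w \<open>z \<notin> D\<close> by (intro connected_Int_frontier) auto
  then obtain t where t: "0 \<le> t" "t \<le> 1" "(1 - t) *\<^sub>R w + t *\<^sub>R z \<in> bd" by (auto simp: in_segment)
  define x where "x = (1 - t) *\<^sub>R w + t *\<^sub>R z"
  have x: "x \<in> bd" "\<rho> x = 0" using t(3) frontier_zero by (auto simp: x_def)
  have t1: "t < 1" using t x(1) z by (cases "t = 1") (auto simp: x_def frontier_def)
  have t0: "0 < t" using t x(2) w by (cases "t = 0") (auto simp: x_def D_eq)
  have wx: "w - x = - t *\<^sub>R (z - w)" by (simp add: x_def algebra_simps)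
  have "\<not> grad x \<bullet> (w - x) \<ge> 0"
    using ascent_direction[of x "w - x"] grad_nonzero[OF x(1)] convex_D w x(2) by (auto simp: D_eq)
  then have "0 < t * (grad x \<bullet> (z - w))" by (simp add: wx)
  then have "grad (x + 0 *\<^sub>R (z - w)) \<bullet> (z - w) > 0" using t0 by (simp add: zero_less_mult_iff)
  from DERIV_pos_inc_right[OF derivative_along_line this]
  obtain d where d: "d > 0" "\<And>h. h > 0 \<Longrightarrow> h < d \<Longrightarrow> \<rho> x < \<rho> (x + h *\<^sub>R (z - w))" by auto
  define h where "h = min (d / 2) (1 - t)"
  have h: "h > 0" "h < d" "t + h \<le> 1" using d(1) t1 by (auto simp: h_def)
  define y where "y = x + h *\<^sub>R (z - w)"
  have y: "\<rho> y > 0" using d(2)[OF h(1,2)] x(2) by (simp add: y_def)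
  define \<eta> where "\<eta> = min (\<rho> y) (\<eta>\<^sub>0 / 2)"
  have \<eta>: "0 < \<eta>" "\<eta> < \<eta>\<^sub>0" "\<eta> \<le> \<rho> y" using y \<eta>\<^sub>0_pos by (auto simp: \<eta>_def)
  have "(1 - (t + h)) *\<^sub>R w + (t + h) *\<^sub>R z \<in> {z. \<rho> z < \<eta>}"
    using w z0 \<eta> h t0 by (intro convexD[OF convex_sublevel]) (auto simp: D_eq)
  moreover have "(1 - (t + h)) *\<^sub>R w + (t + h) *\<^sub>R z = y" by (simp add: y_def x_def algebra_simps)
  ultimately show False using \<eta>(3) by simp
qed

text \<open>On a sphere around the closure of \<open>D\<close> the function \<open>\<rho>\<close> has a positive minimum. A connected
  sublevel set below it contains points inside the sphere and cannot cross it.\<close>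

lemma bounded_sublevel: obtains \<eta> where "0 < \<eta>" "\<eta> < \<eta>\<^sub>0" "bounded {z. \<rho> z < \<eta>}"
proof -
  obtain B where B: "\<And>z. z \<in> closure D \<Longrightarrow> norm z \<le> B"
    using bounded_closure[OF bounded_D] by (auto simp: bounded_iff)
  obtain w where w: "w \<in> D" using nonempty_D by blast
  have "norm w \<le> B" using w closure_subset B by blast
  then have B0: "B + 1 > 0" using norm_ge_zero[of w] by linarith
  have "sphere (0 :: 'n cspace) (B + 1) \<noteq> {}" using B0 by simp
  then obtain x where x: "x \<in> sphere 0 (B + 1)" "\<And>y. y \<in> sphere 0 (B + 1) \<Longrightarrow> \<rho> x \<le> \<rho> y"
    using continuous_attains_inf[OF compact_sphere _ continuous_\<rho>] by metis
  have "x \<notin> closure D" using B[of x] x(1) by auto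
  then have pos: "\<rho> x > 0" by (rule positive_outside)
  define \<eta> where "\<eta> = min (\<rho> x) (\<eta>\<^sub>0 / 2)"
  have \<eta>: "0 < \<eta>" "\<eta> < \<eta>\<^sub>0" "\<eta> \<le> \<rho> x" using pos \<eta>\<^sub>0_pos by (auto simp: \<eta>_def)
  have conv: "convex {z. \<rho> z < \<eta>}" using \<eta> by (intro convex_sublevel) auto
  have "norm z \<le> B + 1" if z: "\<rho> z < \<eta>" for z
  proof (rule ccontr)
    assume "\<not> norm z \<le> B + 1"
    moreover have "connected {z. \<rho> z < \<eta>}" using conv by (rule convex_connected)
    moreover have "w \<in> {z. \<rho> z < \<eta>} \<inter> cball 0 (B + 1)"
      using w \<eta>(1) \<open>norm w \<le> B\<close> by (auto simp: D_eq)
    ultimately have "{z. \<rho> z < \<eta>} \<inter> frontier (cball 0 (B + 1)) \<noteq> {}"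
      using z by (intro connected_Int_frontier) auto
    then obtain y where "\<rho> y < \<eta>" "y \<in> sphere 0 (B + 1)" by auto
    then show False using x(2)[of y] \<eta>(3) by linarith
  qed
  then have "bounded {z. \<rho> z < \<eta>}" by (auto simp: bounded_iff)
  then show ?thesis using that \<eta> by blast
qed

lemma mcneal_domain_pointed_convex:
  obtains r e where "r > 0" "e > 0"
    "\<And>q \<epsilon>. q \<in> D \<Longrightarrow> infdist q bd < r \<Longrightarrow> 0 < \<epsilon> \<Longrightarrow> \<epsilon> < e \<Longrightarrow> pointed_convex_domain (mcneal_domain \<rho> q \<epsilon>) q"
proof -
  obtain \<eta> where \<eta>: "0 < \<eta>" "\<eta> < \<eta>\<^sub>0" "bounded {z. \<rho> z < \<eta>}" by (rule bounded_sublevel)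
  obtain r a L where r: "r > 0" "r \<le> 1" "a > 0" "L > 0"
    and est: "\<And>q. infdist q bd < r \<Longrightarrow> \<bar>\<rho> q\<bar> < \<eta>\<^sub>0"
    and "\<And>q x. infdist q bd < r \<Longrightarrow> dist q x \<le> r \<Longrightarrow> a \<le> grad x \<bullet> grad q"
      "\<And>q x. infdist q bd < r \<Longrightarrow> dist q x \<le> r \<Longrightarrow> norm (grad x) \<le> L"
    using that by (rule local_estimates)
  have "pointed_convex_domain (mcneal_domain \<rho> q \<epsilon>) q"
    if q: "q \<in> D" "infdist q bd < r" and \<epsilon>: "0 < \<epsilon>" "\<epsilon> < \<eta>" for q \<epsilon>
  proof
    have *: "\<rho> q + \<epsilon> < \<eta>" "- \<eta>\<^sub>0 < \<rho> q + \<epsilon>" using q \<epsilon> est[OF q(2)] by (auto simp: D_eq)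
    show "open (mcneal_domain \<rho> q \<epsilon>)" unfolding mcneal_domain_def by (rule open_sublevel)
    show "convex (mcneal_domain \<rho> q \<epsilon>)" unfolding mcneal_domain_def using * \<eta> by (intro convex_sublevel) auto
    show "bounded (mcneal_domain \<rho> q \<epsilon>)"
      unfolding mcneal_domain_def using * by (intro bounded_subset[OF \<eta>(3)]) auto
    show "q \<in> mcneal_domain \<rho> q \<epsilon>" using \<epsilon> by (simp add: mcneal_domain_def)
  qed
  then show ?thesis using r \<eta> by (intro that[of r \<eta>])
qed

text \<open>Finite type provides a nonvanishing derivative of some order \<open>j\<close> along the line. The corresponding
  \<open>j\<close>-th difference with steps proportional to \<open>r\<close> has size at least a multiple of \<open>r\<^sup>j\<close>, also at nearby
  points and in nearby directions, whereas it is at most \<open>2\<^sup>j\<close> times the largest value of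
  \<open>|\<rho> - \<rho>(q)|\<close> on the disc of radius \<open>r\<close>. A single \<open>N\<close> serves as exponent and in the constant, which
  makes the claim monotone in \<open>N\<close>.\<close>

lemma nondegenerate_at_point:
  assumes p: "p \<in> bd" and v: "v \<noteq> 0"
  shows "\<exists>N::nat. \<exists>e>0. \<forall>z. dist (p, v) z < e \<longrightarrow>
    (\<forall>r. 0 < r \<longrightarrow> r \<le> 1 / real (Suc N) \<longrightarrow>
      (\<exists>\<zeta>. cmod \<zeta> \<le> r \<and> r ^ N / real (Suc N) \<le> \<bar>\<rho> (fst z + \<zeta> *s snd z) - \<rho> (fst z)\<bar>))"
proof -
  have "dangelo_type \<rho> p < \<infinity>" using finite_type p by (simp add: finite_type_def)
  then obtain cs where cs: "iterated_derivative (map (\<lambda>c. c *s v) cs) \<rho> p \<noteq> 0"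
    using finite_line_type[OF smooth _ v] by blast
  have ne: "cs \<noteq> []" using cs frontier_zero[OF p] by auto
  define G where "G z = \<bar>iterated_derivative (map (\<lambda>c. c *s snd z) cs) \<rho> (fst z)\<bar>" for z
  define a where "a = G (p, v) / 2"
  have a: "a > 0" using cs by (simp add: a_def G_def)
  obtain e where e: "e > 0" "\<And>z. dist (p, v) z < e \<Longrightarrow> a < G z"
  proof (rule continuous_greater_nearby)
    have "continuous_on UNIV (\<lambda>z. iterated_derivative (map (\<lambda>g. g z) (map (\<lambda>c z. c *s snd z) cs)) \<rho> (fst z))"
      by (rule continuous_on_iterated_derivative[OF smooth]) (auto intro!: continuous_intros)
    then show "continuous_on UNIV G" unfolding G_def by (intro continuous_on_rabs) (simp add: o_def)
    show "a < G (p, v)" using a by (simp add: a_def)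
  qed (rule that)
  define j where "j = length cs"
  define S where "S = 1 + sum_list (map cmod cs)"
  have S0: "sum_list (map cmod cs) \<ge> 0" by (rule sum_list_nonneg) auto
  have S: "S \<ge> 1" using S0 by (simp add: S_def)
  define W where "W = norm v + 1"
  have W: "W > 0" by (simp add: W_def add_nonneg_pos)
  obtain N :: nat where N: "real N \<ge> max (real j) (max ((2 * S) ^ j / a) (2 * W / e))" using real_arch_simple by blast
  have N1: "j \<le> N" "1 / real (Suc N) \<le> a / (2 * S) ^ j" "W * (1 / real (Suc N)) \<le> e / 2"
  proof -
    show "j \<le> N" using N by simp
    have "(2 * S) ^ j / a \<le> real (Suc N)" "2 * W / e \<le> real (Suc N)" using N by auto
    then show "1 / real (Suc N) \<le> a / (2 * S) ^ j" "W * (1 / real (Suc N)) \<le> e / 2"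
      using a e(1) S by (simp_all add: pos_divide_le_eq pos_le_divide_eq mult.commute)
  qed
  define e' where "e' = min (e / 2) 1"
  have e': "e' > 0" "e' \<le> e / 2" "e' \<le> 1" using e(1) by (auto simp: e'_def)
  have "\<exists>\<zeta>. cmod \<zeta> \<le> r \<and> r ^ N / real (Suc N) \<le> \<bar>\<rho> (q + \<zeta> *s w) - \<rho> q\<bar>"
    if qw: "dist (p, v) (q, w) < e'" and r: "0 < r" "r \<le> 1 / real (Suc N)" for q w r
  proof (rule ccontr)
    assume "\<not> ?thesis"
    then have small: "\<bar>\<rho> (q + \<zeta> *s w) - \<rho> q\<bar> \<le> r ^ N / real (Suc N)" if "cmod \<zeta> \<le> r" for \<zeta>
      using that by fastforce
    have r1: "r \<le> 1" using r(2) by (rule order_trans) simp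
    define h where "h = r / S"
    have h: "h > 0" using r S by (simp add: h_def)
    have hS: "h * sum_list (map cmod cs) \<le> r"
    proof -
      have "h * sum_list (map cmod cs) \<le> h * S" using h by (intro mult_left_mono) (auto simp: S_def)
      then show ?thesis using S by (simp add: h_def)
    qed
    define hs where "hs = map (\<lambda>c. h *\<^sub>R c) cs"
    define ws where "ws = map (\<lambda>c. c *s w) hs"
    have ws: "ws = map (\<lambda>x. h *\<^sub>R x) (map (\<lambda>c. c *s w) cs)"
      by (simp add: ws_def hs_def o_def scaleR_eq_vector_scalar_mult vector_smult_assoc scaleR_conv_of_real[where 'a = complex])
    have sum_hs: "sum_list (map cmod hs) = h * sum_list (map cmod cs)"
      using h by (simp add: hs_def o_def sum_list_const_mult)
    have sum_ws: "sum_list (map norm ws) = norm w * (h * sum_list (map cmod cs))"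
    proof -
      have "sum_list (map norm ws) = norm w * sum_list (map cmod hs)"
        unfolding ws_def by (induction hs) (auto simp: norm_vector_scalar_mult algebra_simps)
      then show ?thesis by (simp add: sum_hs)
    qed
    have nw: "norm w \<le> W"
    proof -
      have "dist v w \<le> dist (p, v) (q, w)" using dist_snd_le[of "(p, v)" "(q, w)"] by simp
      then show ?thesis using qw e'(3) norm_triangle_ineq[of v "w - v"] by (simp add: W_def dist_norm norm_minus_commute)
    qed
    obtain y where y: "norm (y - q) \<le> sum_list (map norm ws)" "finite_difference ws \<rho> q = iterated_derivative ws \<rho> y"
      using finite_difference_mean_value[OF smooth] by blast
    have "norm (y - q) \<le> W * (1 / real (Suc N))"
    proof -
      have "norm w * (h * sum_list (map cmod cs)) \<le> W * r"
        using nw hS W h S0 by (intro mult_mono) auto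
      also have "\<dots> \<le> W * (1 / real (Suc N))" using r W by (intro mult_left_mono) auto
      finally show ?thesis using y(1) sum_ws by simp
    qed
    then have "dist q y \<le> e / 2" using N1(3) by (metis dist_commute dist_norm order_trans)
    then have "dist (q, w) (y, w) \<le> e / 2" by (simp add: dist_Pair_Pair)
    then have "dist (p, v) (y, w) < e" using dist_triangle[of "(p, v)" "(y, w)" "(q, w)"] qw e' by linarith
    have der: "iterated_derivative ws \<rho> y = h ^ j * iterated_derivative (map (\<lambda>c. c *s w) cs) \<rho> y"
      unfolding ws iterated_derivative_scale[OF smooth] by (simp add: j_def)
    from e(2)[OF \<open>dist (p, v) (y, w) < e\<close>] have "h ^ j * a < h ^ j * G (y, w)" using h by simp
    also have "\<dots> = \<bar>finite_difference ws \<rho> q\<bar>"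
      unfolding y(2) der using h by (simp add: G_def abs_mult)
    also have "finite_difference ws \<rho> q = finite_difference hs (\<lambda>\<zeta>. \<rho> (q + \<zeta> *s w)) 0"
      using finite_difference_compose[of "\<lambda>\<zeta>. q + \<zeta> *s w" "\<lambda>c. c *s w" hs \<rho> 0]
      by (simp add: ws_def vector_sadd_rdistrib add.assoc)
    also have "\<dots> = finite_difference hs (\<lambda>\<zeta>. \<rho> (q + \<zeta> *s w) - \<rho> q) 0"
      using ne by (intro finite_difference_diff_const[symmetric]) (simp add: hs_def)
    also have "\<bar>\<dots>\<bar> \<le> 2 ^ length hs * (r ^ N / real (Suc N))"
      by (rule finite_difference_bound) (use small sum_hs hS in auto)
    also have "length hs = j" by (simp add: hs_def j_def)
    also have "2 ^ j * (r ^ N / real (Suc N)) \<le> 2 ^ j * (r ^ j * (a / (2 * S) ^ j))"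
    proof (rule mult_left_mono)
      have "r ^ N * (1 / real (Suc N)) \<le> r ^ j * (a / (2 * S) ^ j)"
        using r r1 N1 by (intro mult_mono power_decreasing) auto
      then show "r ^ N / real (Suc N) \<le> r ^ j * (a / (2 * S) ^ j)" by simp
    qed simp
    also have "\<dots> = h ^ j * a" using S by (simp add: h_def power_mult_distrib power_divide)
    finally show False by simp
  qed
  then show ?thesis using e'(1) by (intro exI[of _ N] exI[of _ e']) auto
qed

lemma nondegenerate_near_frontier:
  obtains N :: nat and e where "e > 0"
    "\<And>q v r. infdist q bd < e \<Longrightarrow> norm v = 1 \<Longrightarrow> 0 < r \<Longrightarrow> r \<le> 1 / real (Suc N) \<Longrightarrow>
      \<exists>\<zeta>. cmod \<zeta> \<le> r \<and> r ^ N / real (Suc N) \<le> \<bar>\<rho> (q + \<zeta> *s v) - \<rho> q\<bar>"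
proof -
  define P where "P N z \<longleftrightarrow> (\<forall>r. 0 < r \<longrightarrow> r \<le> 1 / real (Suc N) \<longrightarrow>
      (\<exists>\<zeta>. cmod \<zeta> \<le> r \<and> r ^ N / real (Suc N) \<le> \<bar>\<rho> (fst z + \<zeta> *s snd z) - \<rho> (fst z)\<bar>))" for N z
  have "\<exists>N. \<exists>e>0. \<forall>x\<in>bd \<times> sphere 0 1. \<forall>y. dist x y < e \<longrightarrow> P N y"
  proof (rule compact_uniform_neighbourhood)
    show "compact (bd \<times> sphere (0 :: 'n cspace) 1)" by (intro compact_Times compact_frontier compact_sphere)
  next
    fix m n z assume mn: "m \<le> n" and Pm: "P m z"
    show "P n z" unfolding P_def
    proof (intro allI impI)
      fix r :: real assume r: "0 < r" "r \<le> 1 / real (Suc n)"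
      have le: "1 / real (Suc n) \<le> 1 / real (Suc m)" using mn by (intro divide_left_mono) auto
      then obtain \<zeta> where \<zeta>: "cmod \<zeta> \<le> r" "r ^ m / real (Suc m) \<le> \<bar>\<rho> (fst z + \<zeta> *s snd z) - \<rho> (fst z)\<bar>"
        using Pm r unfolding P_def by (meson order_trans)
      have r1: "r \<le> 1" using r(2) by (rule order_trans) simp
      have "r ^ n * (1 / real (Suc n)) \<le> r ^ m * (1 / real (Suc m))"
        using r r1 mn le by (intro mult_mono power_decreasing) auto
      then have "r ^ n / real (Suc n) \<le> r ^ m / real (Suc m)" by simp
      then show "\<exists>\<zeta>. cmod \<zeta> \<le> r \<and> r ^ n / real (Suc n) \<le> \<bar>\<rho> (fst z + \<zeta> *s snd z) - \<rho> (fst z)\<bar>"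
        using \<zeta> by (meson order_trans)
    qed
  next
    fix x assume x: "x \<in> bd \<times> sphere (0 :: 'n cspace) 1"
    then obtain p v where pv: "x = (p, v)" "p \<in> bd" "norm v = 1" by auto
    then have "v \<noteq> 0" by auto
    then show "\<exists>N. \<exists>e>0. \<forall>y. dist x y < e \<longrightarrow> P N y"
      using nondegenerate_at_point[OF pv(2), of v] unfolding P_def pv(1) by blast
  qed
  then obtain N e where e: "e > 0" "\<And>x y. x \<in> bd \<times> sphere 0 1 \<Longrightarrow> dist x y < e \<Longrightarrow> P N y" by blast
  show ?thesis
  proof (rule that[OF e(1)])
    fix q v :: "'n cspace" and r :: real
    assume q: "infdist q bd < e" and v: "norm v = 1" and r: "0 < r" "r \<le> 1 / real (Suc N)"
    obtain p where p: "p \<in> bd" "dist q p = infdist q bd" using nearest_frontier_point[of q] by blast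
    have "P N (q, v)"
      using p q v by (intro e(2)[of "(p, v)"]) (auto simp: dist_Pair_Pair dist_commute infdist_nonneg)
    then show "\<exists>\<zeta>. cmod \<zeta> \<le> r \<and> r ^ N / real (Suc N) \<le> \<bar>\<rho> (q + \<zeta> *s v) - \<rho> q\<bar>"
      using r by (simp add: P_def)
  qed
qed

lemma pure_difference_bound:
  obtains A where "A > 0"
    "\<And>q x u h. infdist q bd < 1 \<Longrightarrow> dist q x \<le> 1 \<Longrightarrow> norm u = h \<Longrightarrow> real k * h \<le> 1 \<Longrightarrow>
      \<bar>finite_difference (replicate k u) \<rho> x\<bar> \<le> A * h ^ k"
proof -
  obtain b where b: "\<And>p. p \<in> bd \<Longrightarrow> norm p \<le> b" using compact_imp_bounded[OF compact_frontier] by (auto simp: bounded_iff)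
  define S :: "('n cspace \<times> 'n cspace) set" where "S = cball 0 (b + 3) \<times> cball 0 1"
  define F where "F z = iterated_derivative (map (\<lambda>g. g z) (replicate k snd)) \<rho> (fst z)" for z
  have "continuous_on S F" unfolding F_def
    by (rule continuous_on_iterated_derivative[OF smooth]) (auto intro!: continuous_intros)
  then have "bounded (F ` S)" by (intro compact_imp_bounded compact_continuous_image) (auto simp: S_def intro!: compact_Times)
  then obtain A where A: "A > 0" "\<And>z. z \<in> S \<Longrightarrow> \<bar>F z\<bar> \<le> A" by (auto simp: bounded_pos)
  have "\<bar>finite_difference (replicate k u) \<rho> x\<bar> \<le> A * h ^ k"
    if q: "infdist q bd < 1" and x: "dist q x \<le> 1" and u: "norm u = h" and kh: "real k * h \<le> 1" for q x u h
  proof -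
    obtain p where p: "p \<in> bd" "dist q p = infdist q bd" using nearest_frontier_point[of q] by blast
    obtain y where y: "norm (y - x) \<le> sum_list (map norm (replicate k u))"
        "finite_difference (replicate k u) \<rho> x = iterated_derivative (replicate k u) \<rho> y"
      using finite_difference_mean_value[OF smooth] by blast
    have "norm (y - x) \<le> 1" using y(1) u kh by (simp add: sum_list_replicate)
    then have "dist p y \<le> 3" using dist_triangle[of p y q] dist_triangle[of q y x] p q x by (simp add: dist_norm norm_minus_commute)
    then have ny: "norm y \<le> b + 3" using b[OF p(1)] norm_triangle_ineq[of p "y - p"] by (simp add: dist_norm norm_minus_commute)
    define w where "w = (1 / h) *\<^sub>R u"
    have hw: "h *\<^sub>R w = u" "norm w \<le> 1" using u by (auto simp: w_def)
    have "(y, w) \<in> S" using ny hw(2) by (simp add: S_def)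
    have "iterated_derivative (replicate k u) \<rho> y = h ^ k * F (y, w)"
      using iterated_derivative_scale[OF smooth, of h "replicate k w" y] by (simp add: F_def hw(1) map_replicate_const)
    then have "\<bar>iterated_derivative (replicate k u) \<rho> y\<bar> = h ^ k * \<bar>F (y, w)\<bar>" using u by (auto simp: abs_mult)
    also have "\<dots> \<le> h ^ k * A" using A(2)[OF \<open>(y, w) \<in> S\<close>] u by (intro mult_left_mono) auto
    finally show ?thesis using y(2) by (simp add: mult.commute)
  qed
  then show ?thesis using that A(1) by blast
qed

section \<open>Comparison of sublevel sets\<close>

text \<open>For a disc of radius \<open>r\<close> in the sublevel set, nondegeneracy and the two-sided bound give
  \<open>r\<^sup>N \<le> k s\<close> with \<open>k = N + 1\<close> and \<open>s = B c \<epsilon>\<close>. The \<open>k\<close>-th differences of \<open>\<rho>\<close> with steps of length \<open>r / k\<close> are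
  of order \<open>r\<^sup>k \<le> r\<^sup>N\<close>, hence also bounded by a multiple of \<open>s\<close>. So along each ray in the disc the bound
  \<open>|\<rho> - \<rho>(q)| \<le> s\<close> extrapolates from length \<open>r\<close> to length \<open>M r\<close> with a factor that does not depend
  on \<open>\<epsilon>\<close>, and \<open>c\<close> absorbs this factor.\<close>

lemma doubling:
  assumes M: "M > 0"
  obtains c e r where "0 < c" "c \<le> 1" "e > 0" "r > 0"
    "\<And>q \<epsilon> v \<zeta>. infdist q bd < r \<Longrightarrow> 0 < \<epsilon> \<Longrightarrow> \<epsilon> \<le> e \<Longrightarrow>
      \<forall>\<zeta>. cmod \<zeta> \<le> 1 \<longrightarrow> \<rho> (q + \<zeta> *s v) \<le> \<rho> q + c * \<epsilon> \<Longrightarrow> cmod \<zeta> \<le> M \<Longrightarrow>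
      \<rho> (q + \<zeta> *s v) \<le> \<rho> q + \<epsilon>"
proof -
  obtain r0 B where B: "r0 > 0" "r0 \<le> 1" "B > 0"
    and two_sided: "\<And>q v s \<zeta>. infdist q bd < r0 \<Longrightarrow> norm v \<le> r0 \<Longrightarrow>
      \<forall>\<zeta>. cmod \<zeta> \<le> 1 \<longrightarrow> \<rho> (q + \<zeta> *s v) \<le> \<rho> q + s \<Longrightarrow> cmod \<zeta> \<le> 1 \<Longrightarrow>
      \<bar>\<rho> (q + \<zeta> *s v) - \<rho> q\<bar> \<le> B * s"
    using that by (rule two_sided_bound)
  obtain N :: nat and e1 where e1: "e1 > 0"
    and nondeg: "\<And>q v r. infdist q bd < e1 \<Longrightarrow> norm v = 1 \<Longrightarrow> 0 < r \<Longrightarrow> r \<le> 1 / real (Suc N) \<Longrightarrow>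
      \<exists>\<zeta>. cmod \<zeta> \<le> r \<and> r ^ N / real (Suc N) \<le> \<bar>\<rho> (q + \<zeta> *s v) - \<rho> q\<bar>"
    using that by (rule nondegenerate_near_frontier)
  define k where "k = Suc N"
  obtain A where A: "A > 0"
    and diff: "\<And>q x u h. infdist q bd < 1 \<Longrightarrow> dist q x \<le> 1 \<Longrightarrow> norm u = h \<Longrightarrow> real k * h \<le> 1 \<Longrightarrow>
      \<bar>finite_difference (replicate k u) \<rho> x\<bar> \<le> A * h ^ k"
    using that by (rule pure_difference_bound[of k])
  obtain J :: nat where J: "real J \<ge> real k * M" using real_arch_simple by blast
  define Q where "Q = (2 ^ k + 1 :: real) ^ J * (B + A * real k * B)"
  have Q: "Q > 0" 
    unfolding Q_def using A B by (intro mult_pos_pos zero_less_power add_pos_nonneg) auto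
  define c where "c = min 1 (1 / Q)"
  have c: "0 < c" "c \<le> 1" "c * Q \<le> 1"
    using Q by (auto simp: c_def min_def divide_simps)
  \<comment> \<open>Up to this radius, all points used in the extrapolation stay where the differences are controlled.\<close>
  define r' where "r' = min r0 (1 / (real J + real k))"
  have r': "r' > 0" "r' \<le> r0" "r' \<le> 1" "r' \<le> 1 / real k" "real J * r' \<le> 1"
  proof -
    show "r' > 0" "r' \<le> r0" "r' \<le> 1" using B by (auto simp: r'_def k_def)
    have le: "r' \<le> 1 / (real J + real k)" by (simp add: r'_def)
    also have "\<dots> \<le> 1 / real k" by (intro divide_left_mono) (auto simp: k_def)
    finally show "r' \<le> 1 / real k" .
    have "real J * r' \<le> real J * (1 / (real J + real k))" using le by (intro mult_left_mono) auto
    also have "\<dots> \<le> 1" by (simp add: k_def)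
    finally show "real J * r' \<le> 1" .
  qed
  \<comment> \<open>For \<open>\<epsilon>\<close> up to this bound a disc in the sublevel set has radius less than \<open>r'\<close>.\<close>
  define e where "e = r' ^ N / (2 * real k * B)"
  have e: "e > 0" using r' B by (simp add: e_def k_def)
  define r where "r = min (min r0 e1) 1"
  have r: "r > 0" using B e1 by (simp add: r_def)
  have "\<rho> (q + \<zeta> *s v) \<le> \<rho> q + \<epsilon>"
    if q: "infdist q bd < r" and \<epsilon>: "0 < \<epsilon>" "\<epsilon> \<le> e"
      and hyp: "\<forall>\<zeta>. cmod \<zeta> \<le> 1 \<longrightarrow> \<rho> (q + \<zeta> *s v) \<le> \<rho> q + c * \<epsilon>" and \<zeta>: "cmod \<zeta> \<le> M" for q \<epsilon> v \<zeta>
  proof (cases "v = 0 \<or> \<zeta> = 0")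
    case True
    then show ?thesis using \<epsilon> by auto
  next
    case False
    then have v: "v \<noteq> 0" and \<zeta>0: "\<zeta> \<noteq> 0" by auto
    have qr: "infdist q bd < r0" "infdist q bd < e1" "infdist q bd < 1" using q by (auto simp: r_def)
    define s where "s = B * (c * \<epsilon>)"
    have s0: "s \<ge> 0" using B c \<epsilon> by (simp add: s_def)
    \<comment> \<open>Local estimates apply to the part of the disc of radius \<open>l\<close>; this turns out to be the whole disc.\<close>
    define l where "l = min (norm v) r'"
    have l: "0 < l" "l \<le> norm v" "l \<le> r'" using v r' by (auto simp: l_def)
    define w where "w = of_real (1 / norm v) *s v"
    have w: "norm w = 1" using v by (simp add: w_def norm_vector_scalar_mult norm_divide)
    have two: "\<bar>\<rho> (q + \<xi> *s w) - \<rho> q\<bar> \<le> s" if "cmod \<xi> \<le> l" for \<xi>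
    proof -
      define v' where "v' = of_real l *s w"
      have "norm v' \<le> r0" using l r' w by (simp add: v'_def norm_vector_scalar_mult)
      moreover have "\<forall>\<xi>. cmod \<xi> \<le> 1 \<longrightarrow> \<rho> (q + \<xi> *s v') \<le> \<rho> q + c * \<epsilon>"
      proof (intro allI impI)
        fix \<xi> :: complex assume \<xi>: "cmod \<xi> \<le> 1"
        have "\<xi> *s v' = (\<xi> * of_real (l / norm v)) *s v" by (simp add: v'_def w_def vector_smult_assoc)
        moreover have "cmod (\<xi> * of_real (l / norm v)) \<le> 1"
          using \<xi> l v unfolding norm_mult norm_of_real by (intro mult_le_one) auto
        ultimately show "\<rho> (q + \<xi> *s v') \<le> \<rho> q + c * \<epsilon>" using hyp by metis
      qed
      moreover have "cmod (\<xi> / of_real l) \<le> 1" using \<open>cmod \<xi> \<le> l\<close> l by (simp add: norm_divide)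
      ultimately have "\<bar>\<rho> (q + (\<xi> / of_real l) *s v') - \<rho> q\<bar> \<le> B * (c * \<epsilon>)" by (rule two_sided[OF qr(1)])
      then show ?thesis using l by (simp add: v'_def vector_smult_assoc s_def)
    qed
    have "l \<le> 1 / real (Suc N)" using l(3) r'(4) by (simp add: k_def)
    then obtain \<xi> where "cmod \<xi> \<le> l" "l ^ N / real (Suc N) \<le> \<bar>\<rho> (q + \<xi> *s w) - \<rho> q\<bar>"
      using nondeg[OF qr(2) w l(1)] by blast
    then have "l ^ N / real k \<le> s" using two[of \<xi>] by (simp add: k_def)
    then have lN: "l ^ N \<le> real k * s" by (simp add: pos_divide_le_eq k_def mult.commute)
    have "l = norm v"
    proof (rule ccontr)
      assume "l \<noteq> norm v"
      then have "l = r'" by (simp add: l_def min_def split: if_splits)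
      have "real k * s \<le> real k * (B * (1 * e))"
        unfolding s_def using c \<epsilon> B by (intro mult_left_mono mult_mono) auto
      also have "\<dots> = r' ^ N / 2"
      proof -
        have "real k \<noteq> 0" by (simp add: k_def)
        then show ?thesis using B by (simp add: e_def)
      qed
      also have "\<dots> < r' ^ N" using r' by simp
      finally show False using lN \<open>l = r'\<close> by simp
    qed
    define \<theta> where "\<theta> = \<zeta> / of_real (cmod \<zeta>)"
    have \<theta>: "cmod \<theta> = 1" "\<zeta> = of_real (cmod \<zeta>) * \<theta>" using \<zeta>0 by (auto simp: \<theta>_def norm_divide)
    define u where "u = (of_real (l / real k) * \<theta>) *s w"
    have k0: "real k > 0" by (simp add: k_def)
    have nu: "norm u = l / real k" 
      using w \<theta>(1) l k0 by (simp add: u_def norm_vector_scalar_mult norm_mult norm_divide)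
    have tu: "t *\<^sub>R u = (of_real (t * l / real k) * \<theta>) *s w" for t
      by (simp add: u_def scaleR_eq_vector_scalar_mult vector_smult_assoc)
    have "\<bar>\<rho> (q + (cmod \<zeta> * real k) *\<^sub>R u) - \<rho> q\<bar> \<le> (2 ^ k + 1) ^ J * (s + A * (l / real k) ^ k)"
    proof (rule finite_difference_extrapolation[where \<phi> = "\<lambda>x. \<rho> x - \<rho> q"])
      fix t assume t: "0 \<le> t" "t \<le> real J"
      have "t * l / real k \<le> real J * r' / 1"
        using t l r' by (intro frac_le mult_mono) (auto simp: k_def)
      moreover have "dist q (q + t *\<^sub>R u) = t * l / real k" using t nu by (simp add: dist_norm)
      ultimately have "dist q (q + t *\<^sub>R u) \<le> 1" using r'(5) by linarith
      moreover have "real k * (l / real k) \<le> 1" using l r' k0 by simp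
      ultimately have "\<bar>finite_difference (replicate k u) \<rho> (q + t *\<^sub>R u)\<bar> \<le> A * (l / real k) ^ k"
        by (intro diff[OF qr(3) _ nu])
      then show "\<bar>finite_difference (replicate k u) (\<lambda>x. \<rho> x - \<rho> q) (q + t *\<^sub>R u)\<bar> \<le> A * (l / real k) ^ k"
        by (subst finite_difference_diff_const) (auto simp: k_def)
    next
      fix t assume t: "0 \<le> t" "t \<le> real k"
      have "cmod (of_real (t * l / real k) * \<theta>) \<le> l"
      proof -
        have "t * l \<le> real k * l" using t l by (intro mult_right_mono) auto
        then show ?thesis using t l k0 unfolding norm_mult \<theta>(1) norm_of_real by (simp add: pos_divide_le_eq mult.commute)
      qed
      then show "\<bar>\<rho> (q + t *\<^sub>R u) - \<rho> q\<bar> \<le> s" unfolding tu by (rule two)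
    next
      have "cmod \<zeta> * real k \<le> real J" using J \<zeta> mult_right_mono[of "cmod \<zeta>" M "real k"] by (simp add: mult.commute)
      then show "cmod \<zeta> * real k \<le> real k + real J" by simp
    qed (auto simp: k_def)
    also have "(cmod \<zeta> * real k) *\<^sub>R u = \<zeta> *s v"
    proof -
      have "(cmod \<zeta> * real k) *\<^sub>R u = (of_real (cmod \<zeta>) * \<theta>) *s (of_real l *s w)"
        using k0 by (simp add: tu vector_smult_assoc mult_ac)
      also have "of_real l *s w = v" using v by (simp add: w_def vector_smult_assoc \<open>l = norm v\<close>)
      finally show ?thesis using \<theta>(2) by simp
    qed
    finally have "\<bar>\<rho> (q + \<zeta> *s v) - \<rho> q\<bar> \<le> (2 ^ k + 1) ^ J * (s + A * (l / real k) ^ k)" .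
    also have "\<dots> \<le> (2 ^ k + 1) ^ J * (s + A * (real k * s))"
    proof -
      have "(l / real k) ^ k \<le> l ^ k" using l by (intro power_mono) (auto simp: k_def divide_le_eq)
      also have "l ^ k \<le> l ^ N" using l r' by (intro power_decreasing) (auto simp: k_def)
      also have "\<dots> \<le> real k * s" by (rule lN)
      finally show ?thesis using A by (intro mult_left_mono add_left_mono) auto
    qed
    also have "\<dots> = c * Q * \<epsilon>" by (simp add: Q_def s_def algebra_simps)
    also have "\<dots> \<le> 1 * \<epsilon>" using c \<epsilon> by (intro mult_right_mono) auto
    finally show ?thesis by simp
  qed
  then show ?thesis using c e r by (intro that[of c e r])
qed

section \<open>Polydiscs and Kobayashi balls\<close>

text \<open>Let \<open>d\<close> be the distance of \<open>q\<close> to the boundary and \<open>c d \<le> - \<rho>(q) \<le> C d\<close>. The smaller polydisc is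
  chosen such that doubling takes its core, scaled by \<open>n (1 + N)\<close>, into \<open>{\<rho> < 0} = D\<close>, which forces
  Kobayashi distances below \<open>1 / N < R\<close>. For the larger polydisc, the core of \<open>D\<close> lies in that of
  the sublevel set of height \<open>C d\<close>, and doubling enlarges it by the factors lost in passing from the
  ball to the core and from the core to the polydisc.\<close>

lemma polydisc_kobayashi_ball_comparison:
  assumes R: "R > 0"
  shows "\<exists>C\<^sub>1>0. \<exists>C\<^sub>2>0. \<exists>\<delta>>0. \<forall>q\<in>D. infdist q bd < \<delta> \<longrightarrow>
           mcneal_polydiscs \<rho> q (C\<^sub>1 * infdist q bd) \<noteq> {} \<and>
           mcneal_polydiscs \<rho> q (C\<^sub>2 * infdist q bd) \<noteq> {} \<and>
           (\<forall>P\<in>mcneal_polydiscs \<rho> q (C\<^sub>1 * infdist q bd). P \<subseteq> kobayashi_ball D q R) \<and>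
           (\<forall>P\<in>mcneal_polydiscs \<rho> q (C\<^sub>2 * infdist q bd). kobayashi_ball D q R \<subseteq> P)"
proof -
  obtain rd c C where cC: "rd > 0" "c > 0" "C > 0"
    and dist_le: "\<And>q. q \<in> D \<Longrightarrow> infdist q bd < rd \<Longrightarrow> c * infdist q bd \<le> - \<rho> q"
    and le_dist: "\<And>q. q \<in> D \<Longrightarrow> infdist q bd < rd \<Longrightarrow> - \<rho> q \<le> C * infdist q bd"
    using that by (rule defining_function_comparable_to_distance)
  obtain rp ep where pointed: "rp > 0" "ep > 0"
    "\<And>q \<epsilon>. q \<in> D \<Longrightarrow> infdist q bd < rp \<Longrightarrow> 0 < \<epsilon> \<Longrightarrow> \<epsilon> < ep \<Longrightarrow> pointed_convex_domain (mcneal_domain \<rho> q \<epsilon>) q"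
    using that by (rule mcneal_domain_pointed_convex)
  define n where "n = real CARD('n)"
  have n: "n > 0" by (simp add: n_def)
  define N where "N = 1 / R + 1"
  have N: "N > 0" "1 / N < R" using R by (auto simp: N_def divide_simps add_pos_pos algebra_simps)
  have nN: "n * (1 + N) > 0" using n N by simp
  obtain c1 e1 r1 where d1: "0 < c1" "c1 \<le> 1" "e1 > 0" "r1 > 0"
    and doubling1: "\<And>q \<epsilon> v \<zeta>. infdist q bd < r1 \<Longrightarrow> 0 < \<epsilon> \<Longrightarrow> \<epsilon> \<le> e1 \<Longrightarrow>
      \<forall>\<zeta>. cmod \<zeta> \<le> 1 \<longrightarrow> \<rho> (q + \<zeta> *s v) \<le> \<rho> q + c1 * \<epsilon> \<Longrightarrow> cmod \<zeta> \<le> n * (1 + N) \<Longrightarrow>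
      \<rho> (q + \<zeta> *s v) \<le> \<rho> q + \<epsilon>"
    using that by (rule doubling[OF nN])
  define M where "M = exp (2 * R) + 1"
  have M: "M > 0" by (simp add: M_def add_pos_pos)
  have M2: "2 ^ CARD('n) * M > 0" using M by simp
  obtain c2 e2 r2 where d2: "0 < c2" "c2 \<le> 1" "e2 > 0" "r2 > 0"
    and doubling2: "\<And>q \<epsilon> v \<zeta>. infdist q bd < r2 \<Longrightarrow> 0 < \<epsilon> \<Longrightarrow> \<epsilon> \<le> e2 \<Longrightarrow>
      \<forall>\<zeta>. cmod \<zeta> \<le> 1 \<longrightarrow> \<rho> (q + \<zeta> *s v) \<le> \<rho> q + c2 * \<epsilon> \<Longrightarrow> cmod \<zeta> \<le> 2 ^ CARD('n) * M \<Longrightarrow>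
      \<rho> (q + \<zeta> *s v) \<le> \<rho> q + \<epsilon>"
    using that by (rule doubling[OF M2])
  \<comment> \<open>Half of \<open>c\<close> keeps the doubled disc strictly inside \<open>D\<close>; likewise the summand \<open>1\<close> in \<open>C2\<close> gives strict inclusion.\<close>
  define C1 where "C1 = c1 * (c / 2)"
  define C2 where "C2 = C / c2 + 1"
  have C1: "C1 > 0" using d1 cC by (simp add: C1_def)
  have C2: "C2 > 0" using d2 cC by (simp add: C2_def add_pos_pos)
  \<comment> \<open>A common bound for the multiples of the distance at which the local lemmas are applied.\<close>
  define S where "S = C1 + C2 + c + C / c2"
  have S: "S > 0" "C1 < S" "C2 < S" "c / 2 < S" "C / c2 < S"
    using C1 C2 cC d2 by (auto simp: S_def intro!: add_pos_pos add_nonneg_pos add_strict_increasing2)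
  define \<delta> where "\<delta> = min (min (min rd rp) (min r1 r2)) (min (min e1 e2) ep / S)"
  have \<delta>: "\<delta> > 0" using cC pointed d1 d2 S by (simp add: \<delta>_def)
  show ?thesis
  proof (rule exI[of _ C1], rule conjI[OF C1], rule exI[of _ C2], rule conjI[OF C2],
      rule exI[of _ \<delta>], rule conjI[OF \<delta>], intro ballI impI conjI)
    fix q assume q: "q \<in> D" and near: "infdist q bd < \<delta>"
    define d where "d = infdist q bd"
    have d0: "d > 0" using infdist_frontier_pos[OF q] by (simp add: d_def)
    have near': "infdist q bd < rd" "infdist q bd < rp" "infdist q bd < r1" "infdist q bd < r2"
      using near by (auto simp: \<delta>_def)
    have Sd: "S * d < min (min e1 e2) ep"
      using near S(1) by (simp add: \<delta>_def d_def pos_less_divide_eq mult.commute)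
    have small: "T * d < min (min e1 e2) ep" if "T < S" for T
      using Sd mult_strict_right_mono[OF that d0] by linarith
    have dom1: "pointed_convex_domain (mcneal_domain \<rho> q (C1 * d)) q"
      using small[OF S(2)] C1 d0 by (intro pointed(3)[OF q near'(2)]) auto
    have dom2: "pointed_convex_domain (mcneal_domain \<rho> q (C2 * d)) q"
      using small[OF S(3)] C2 d0 by (intro pointed(3)[OF q near'(2)]) auto
    show "mcneal_polydiscs \<rho> q (C1 * infdist q bd) \<noteq> {}"
      using mcneal_polydiscs_nonempty[OF dom1] by (simp add: d_def)
    show "mcneal_polydiscs \<rho> q (C2 * infdist q bd) \<noteq> {}"
      using mcneal_polydiscs_nonempty[OF dom2] by (simp add: d_def)
    {
      fix P assume P: "P \<in> mcneal_polydiscs \<rho> q (C1 * infdist q bd)"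
      show "P \<subseteq> kobayashi_ball D q R"
      proof
        fix z assume "z \<in> P"
        then have core: "(1 / n) *\<^sub>R (z - q) \<in> balanced_core (mcneal_domain \<rho> q (C1 * d)) q"
          using mcneal_polydisc_in_multiple_of_core[OF dom1, of P z] P by (simp add: n_def d_def)
        have disc: "q + \<zeta> *s (z - q) \<in> D" if "cmod \<zeta> < 1 + N" for \<zeta>
        proof -
          have "\<rho> (q + (\<zeta> * of_real n) *s ((1 / n) *\<^sub>R (z - q))) \<le> \<rho> q + c / 2 * d"
          proof (rule doubling1[OF near'(3)])
            show "0 < c / 2 * d" using cC d0 by simp
            show "c / 2 * d \<le> e1" using small[OF S(4)] by simp
            show "cmod (\<zeta> * of_real n) \<le> n * (1 + N)" using that n by (simp add: norm_mult)
            show "\<forall>\<xi>. cmod \<xi> \<le> 1 \<longrightarrow> \<rho> (q + \<xi> *s ((1 / n) *\<^sub>R (z - q))) \<le> \<rho> q + c1 * (c / 2 * d)"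
            proof (intro allI impI)
              fix \<xi> :: complex assume "cmod \<xi> \<le> 1"
              then have "q + \<xi> *s ((1 / n) *\<^sub>R (z - q)) \<in> closure {x. \<rho> x < \<rho> q + C1 * d}"
                using core unfolding balanced_core_def mcneal_domain_def by blast
              then show "\<rho> (q + \<xi> *s ((1 / n) *\<^sub>R (z - q))) \<le> \<rho> q + c1 * (c / 2 * d)"
                using closure_sublevel by (fastforce simp: C1_def)
            qed
          qed
          moreover have "(\<zeta> * of_real n) *s ((1 / n) *\<^sub>R (z - q)) = \<zeta> *s (z - q)"
            using n unfolding scaleR_eq_vector_scalar_mult vector_smult_assoc by simp
          moreover have "c / 2 * d < c * d" using cC d0 by simp
          moreover have "c * d \<le> - \<rho> q" using dist_le[OF q near'(1)] by (simp add: d_def)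
          ultimately show ?thesis unfolding D_eq by simp
        qed
        have "kobayashi_dist D q z \<le> ennreal (1 / N)" by (rule kobayashi_dist_le_of_disc[OF N(1) disc])
        also have "\<dots> < ennreal R" using N R by (intro ennreal_lessI) auto
        finally show "z \<in> kobayashi_ball D q R"
          using disc[of 1] N by (simp add: kobayashi_ball_def)
      qed
    }
    {
      fix P assume P: "P \<in> mcneal_polydiscs \<rho> q (C2 * infdist q bd)"
      show "kobayashi_ball D q R \<subseteq> P"
      proof
        fix z assume z: "z \<in> kobayashi_ball D q R"
        define v where "v = (1 / M) *\<^sub>R (z - q)"
        have v: "v \<in> balanced_core D q"
          using kobayashi_ball_in_multiple_of_core[OF open_D convex_D q z R] by (simp add: v_def M_def)
        have "2 ^ CARD('n) *\<^sub>R (z - q) \<in> balanced_core (mcneal_domain \<rho> q (C2 * d)) q"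
          unfolding balanced_core_def
        proof safe
          fix \<zeta> :: complex assume \<zeta>: "cmod \<zeta> \<le> 1"
          have "\<rho> (q + (\<zeta> * of_real (2 ^ CARD('n) * M)) *s v) \<le> \<rho> q + C / c2 * d"
          proof (rule doubling2[OF near'(4)])
            show "0 < C / c2 * d" using cC d2 d0 by simp
            show "C / c2 * d \<le> e2" using small[OF S(5)] by simp
            show "cmod (\<zeta> * of_real (2 ^ CARD('n) * M)) \<le> 2 ^ CARD('n) * M"
              using \<zeta> M2 unfolding norm_mult norm_of_real by (simp add: mult_left_le_one_le)
            show "\<forall>\<xi>. cmod \<xi> \<le> 1 \<longrightarrow> \<rho> (q + \<xi> *s v) \<le> \<rho> q + c2 * (C / c2 * d)"
            proof (intro allI impI)
              fix \<xi> :: complex assume "cmod \<xi> \<le> 1"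
              then have "q + \<xi> *s v \<in> closure {x. \<rho> x < 0}"
                using v unfolding balanced_core_def D_eq by blast
              then have "\<rho> (q + \<xi> *s v) \<le> 0" by (rule closure_sublevel)
              also have "0 \<le> \<rho> q + c2 * (C / c2 * d)"
                using le_dist[OF q near'(1)] d2 by (simp add: d_def)
              finally show "\<rho> (q + \<xi> *s v) \<le> \<rho> q + c2 * (C / c2 * d)" .
            qed
          qed
          moreover have "(\<zeta> * of_real (2 ^ CARD('n) * M)) *s v = \<zeta> *s (2 ^ CARD('n) *\<^sub>R (z - q))"
            using M unfolding v_def scaleR_eq_vector_scalar_mult vector_smult_assoc by simp
          moreover have "C / c2 * d < C2 * d" using d0 by (simp add: C2_def distrib_right)
          ultimately have "q + \<zeta> *s (2 ^ CARD('n) *\<^sub>R (z - q)) \<in> mcneal_domain \<rho> q (C2 * d)"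
            by (simp add: mcneal_domain_def)
          then show "q + \<zeta> *s (2 ^ CARD('n) *\<^sub>R (z - q)) \<in> closure (mcneal_domain \<rho> q (C2 * d))"
            using closure_subset by blast
        qed
        then show "z \<in> P" using core_in_multiple_of_mcneal_polydisc[OF dom2, of P z] P by (simp add: d_def)
      qed
    }
  qed
qed

end

theorem proposition8p9:
  fixes D :: "('n::{finite,linorder}) cspace set"
    and \<rho> :: "'n cspace \<Rightarrow> real"
    and \<eta>\<^sub>0 :: real
  assumes "open D" and "connected D" and "D \<noteq> {}" and "bounded D" and "convex D"
    and "smooth_defining_function \<rho> D"
    and "\<eta>\<^sub>0 > 0" and "\<And>\<eta>. - \<eta>\<^sub>0 < \<eta> \<Longrightarrow> \<eta> < \<eta>\<^sub>0 \<Longrightarrow> convex {z. \<rho> z < \<eta>}"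
    and "finite_type \<rho> D"
  shows "\<forall>R>0. \<exists>C\<^sub>1>0. \<exists>C\<^sub>2>0. \<exists>\<delta>>0. \<forall>q\<in>D. infdist q (frontier D) < \<delta> \<longrightarrow>
           mcneal_polydiscs \<rho> q (C\<^sub>1 * infdist q (frontier D)) \<noteq> {} \<and>
           mcneal_polydiscs \<rho> q (C\<^sub>2 * infdist q (frontier D)) \<noteq> {} \<and>
           (\<forall>P\<in>mcneal_polydiscs \<rho> q (C\<^sub>1 * infdist q (frontier D)). P \<subseteq> kobayashi_ball D q R) \<and>
           (\<forall>P\<in>mcneal_polydiscs \<rho> q (C\<^sub>2 * infdist q (frontier D)). kobayashi_ball D q R \<subseteq> P)"
proof -
  interpret finite_type_convex_domain D \<rho> \<eta>\<^sub>0
    using assms by (intro finite_type_convex_domain.intro)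
  show ?thesis using polydisc_kobayashi_ball_comparison by blast
qed

end
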